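(* Every Gorenstein sequence $H=(1,4,7,\dots)$ of socle degree $j$ for $R=K[w,x,y,z]$ satisfies: $\Delta H_{\le j/2}$ is an $O$-sequence.
   Context: $K$ algebraically closed, $R$ standard graded; a Gorenstein sequence of socle degree $j$ is the Hilbert function $(h_0,\dots,h_j)$, $h_j\ne0$, of a standard graded Artinian Gorenstein quotient of $R$. $\Delta H_i=h_i-h_{i-1}$ ($h_{-1}=0$) and $\Delta H_{\le j/2}=(\Delta H_i)_{0\le i\le j/2}$. For $c,d>0$ write $c=\sum_{i=1}^d\binom{k(i)}{i}$ with $k(d)>\dots>k(1)\ge0$ and $c^{(d)}=\sum_{i=1}^d\binom{k(i)+1}{i+1}$, $0^{(d)}=0$; an $O$-sequence is $(1,t_1,t_2,\dots)$ with $t_i\ge0$ and $t_{d+1}\le t_d^{(d)}$ for all $d\ge1$. *)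

theory Defs
  imports Main "HOL-Library.Poly_Mapping" "HOL-Computational_Algebra.Polynomial"
begin

datatype var4 = W | X | Y | Z

type_synonym 'k poly4 = "(var4 \<Rightarrow>\<^sub>0 nat) \<Rightarrow>\<^sub>0 'k"

definition mon_deg :: "(var4 \<Rightarrow>\<^sub>0 nat) \<Rightarrow> nat" where
  "mon_deg m = Poly_Mapping.lookup m W + Poly_Mapping.lookup m X + Poly_Mapping.lookup m Y + Poly_Mapping.lookup m Z"

definition pscale :: "'k::field \<Rightarrow> 'k poly4 \<Rightarrow> 'k poly4" where
  "pscale c p = Poly_Mapping.map (\<lambda>a. c * a) p"

definition kdim :: "'k::field poly4 set \<Rightarrow> nat" where
  "kdim S = vector_space.dim pscale S"

definition pvar :: "var4 \<Rightarrow> 'k::field poly4" where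
  "pvar v = Poly_Mapping.single (Poly_Mapping.single v 1) 1"

definition forms :: "nat \<Rightarrow> 'k::field poly4 set" where
  "forms i = {p. \<forall>m \<in> Poly_Mapping.keys p. mon_deg m = i}"

definition hcomp :: "nat \<Rightarrow> 'k::field poly4 \<Rightarrow> 'k poly4" where
  "hcomp i p = Abs_poly_mapping (\<lambda>m. if mon_deg m = i then Poly_Mapping.lookup p m else 0)"

definition hom_ideal :: "'k::field poly4 set \<Rightarrow> bool" where
  "hom_ideal I \<longleftrightarrow> 0 \<in> I \<and> (\<forall>p\<in>I. \<forall>q\<in>I. p + q \<in> I) \<and>
     (\<forall>p\<in>I. \<forall>f. f * p \<in> I) \<and> (\<forall>p\<in>I. \<forall>i. hcomp i p \<in> I)"

text \<open>Hilbert function of R/I: h_i = dim_K (R/I)_i = dim R_i - dim I_i\<close>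
definition hilb :: "'k::field poly4 set \<Rightarrow> nat \<Rightarrow> nat" where
  "hilb I i = kdim (forms i :: 'k poly4 set) - kdim (I \<inter> forms i)"

definition artinian :: "'k::field poly4 set \<Rightarrow> bool" where
  "artinian I \<longleftrightarrow> (\<exists>N. \<forall>i\<ge>N. forms i \<subseteq> I)"

text \<open>degree i part of the socle (0 :_{R/I} m), lifted to R\<close>
definition socle_part :: "'k::field poly4 set \<Rightarrow> nat \<Rightarrow> 'k poly4 set" where
  "socle_part I i = {p \<in> forms i. \<forall>v. pvar v * p \<in> I}"

definition socle_dim_at :: "'k::field poly4 set \<Rightarrow> nat \<Rightarrow> nat" where
  "socle_dim_at I i = kdim (socle_part I i) - kdim (I \<inter> forms i)"

text \<open>total socle dimension of the graded module R/I (the socle is a homogeneous ideal)\<close>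
definition socle_dim :: "'k::field poly4 set \<Rightarrow> nat" where
  "socle_dim I = (\<Sum>i\<in>{i. socle_dim_at I i \<noteq> 0}. socle_dim_at I i)"

definition artinian_gorenstein :: "'k::field poly4 set \<Rightarrow> bool" where
  "artinian_gorenstein I \<longleftrightarrow> hom_ideal I \<and> artinian I \<and> socle_dim I = 1"

definition gorenstein_seq :: "'k::field itself \<Rightarrow> (nat \<Rightarrow> nat) \<Rightarrow> nat \<Rightarrow> bool" where
  "gorenstein_seq TYPE('k) h j \<longleftrightarrow>
     (\<exists>I :: 'k poly4 set. artinian_gorenstein I \<and> (\<forall>i. hilb I i = h i)) \<and>
     h j \<noteq> 0 \<and> (\<forall>i>j. h i = 0)"

definition macaulay_rep :: "nat \<Rightarrow> nat \<Rightarrow> (nat \<Rightarrow> nat) \<Rightarrow> bool" where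
  "macaulay_rep c d k \<longleftrightarrow> (\<forall>i\<in>{1..<d}. k i < k (Suc i)) \<and> c = (\<Sum>i=1..d. k i choose i)"

definition macaulay_upper :: "nat \<Rightarrow> nat \<Rightarrow> nat" where
  "macaulay_upper c d = (if c = 0 then 0 else
     (let k = (SOME k. macaulay_rep c d k) in \<Sum>i=1..d. (k i + 1) choose (i + 1)))"

definition O_seq :: "(nat \<Rightarrow> int) \<Rightarrow> nat \<Rightarrow> bool" where
  "O_seq t n \<longleftrightarrow> t 0 = 1 \<and> (\<forall>i\<le>n. t i \<ge> 0) \<and>
     (\<forall>d. 1 \<le> d \<and> d + 1 \<le> n \<longrightarrow> t (d + 1) \<le> int (macaulay_upper (nat (t d)) d))"

definition delta :: "(nat \<Rightarrow> nat) \<Rightarrow> nat \<Rightarrow> int" where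
  "delta h i = (if i = 0 then int (h 0) else int (h i) - int (h (i - 1)))"

definition alg_closed :: "'k::field itself \<Rightarrow> bool" where
  "alg_closed TYPE('k) \<longleftrightarrow> (\<forall>p :: 'k poly. degree p > 0 \<longrightarrow> (\<exists>x. poly p x = 0))"

end

(*
Let A = R/I be the Gorenstein algebra and, for a linear form L, let c_i be the Hilbert function of
A/LA. The pairing on A gives h_i - h_{i-1} = c_i - c_{j+1-i}. By an elementary form of Macaulay's
growth bound, c_a <= a implies that c_i is at most a and non-increasing for i >= a, and then
h_i - h_{i-1} is non-negative and non-increasing for a <= i <= j/2. So everything follows once
c_a <= a for some L and some a >= 3 such that h_i - h_{i-1} = i + 1 for 2 <= i < a.

If c_3 <= 3 for some L, take a = 3. Otherwise c_2 = 3 and c_3 >= 4 for general L, which forces the net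
of quadrics in I to vanish on a line in a general plane L = 0. These lines fill a plane l = 0, so
that the quadrics of I are multiples of l. Take for a the least degree in which I has an element that
is not a multiple of l. Below a the ideal I consists of the multiples l*g with g in the ideal I : l,
which has codimension one in each degree, and this gives h_i - h_{i-1} = i + 1; in degree a the new
element makes c_a at most a.
*)

theory Submission
  imports Defs
begin

text \<open>With \<open>c_a <= a\<close>, a general linear form \<open>M\<close> fills degree
  \<open>a\<close> of A/LA, and this fullness persists, so multiplication by \<open>M\<close> maps
  each later degree onto the next. Here "general" means outside finitely many proper subspaces of
  the four-dimensional space of linear forms; over an infinite field such forms exist. The limit j/2
  enters because \<open>j + 1 - i >= i\<close> there, so that the subtracted term is a later and
  hence smaller one.

  The obstacle is the growth from \<open>c_2 = 3\<close> to \<open>c_3 = 4\<close>. As 3 =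
  binom(3,2) and 4 = binom(4,3), this is Macaulay's maximal growth, that of the coordinate ring of a
  line. Gotzmann's theorem would name the line; here it is built from points. For general
  \<open>M\<close>, a functional on cubics modulo I, L and M turns out to be a multiple of
  evaluation at one point. Four such points impose dependent conditions on quadrics, so three of
  them are collinear, and a quadric with three zeros on a line contains it.

  The ideal I : l has codimension one because its linear forms define a point. A form
  \<open>L\<close> avoiding that point brings all multiples of \<open>l\<close> of degree at least
  two into I + (L), and only the forms on the line \<open>l = L = 0\<close> remain to be
  counted.\<close>

section \<open>Finite-dimensional subspaces of a vector space\<close>

text \<open>A separate locale, because definitions made in \<open>vector_space\<close> itself would be
  captured by the interpretation for real vector spaces.\<close>

locale vspace = vector_space scale for scale :: "'a::field \<Rightarrow> 'b::ab_group_add \<Rightarrow> 'b"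
begin

definition vsum :: "'b set \<Rightarrow> 'b set \<Rightarrow> 'b set" where
  "vsum U V = {x + y | x y. x \<in> U \<and> y \<in> V}"

text \<open>The polynomial ring has infinite dimension, and \<open>dim\<close> of a space with an
  infinite basis is 0 because \<open>card\<close> is. Dimensions are therefore compared only inside
  finite spans.\<close>

definition fd :: "'b set \<Rightarrow> bool" where
  "fd V \<longleftrightarrow> subspace V \<and> (\<exists>B. finite B \<and> V \<subseteq> span B)"

lemma fd_subspace: "fd V \<Longrightarrow> subspace V"
  by (simp add: fd_def)

lemma fdI_span: "finite B \<Longrightarrow> fd (span B)"
  by (auto simp: fd_def)

lemma fd_subset: "fd V \<Longrightarrow> subspace U \<Longrightarrow> U \<subseteq> V \<Longrightarrow> fd U"
  by (auto simp: fd_def)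

lemma fd_extend_basis:
  assumes "fd V" "A \<subseteq> V" "independent A"
  obtains B where "A \<subseteq> B" "B \<subseteq> V" "finite B" "independent B" "span B = V" "card B = dim V"
proof -
  obtain B where B: "A \<subseteq> B" "B \<subseteq> V" "independent B" "V \<subseteq> span B"
    using maximal_independent_subset_extend[OF assms(2,3)] by blast
  obtain F where F: "finite F" "V \<subseteq> span F"
    using assms(1) by (auto simp: fd_def)
  have "finite B"
    using independent_span_bound[OF F(1) B(3)] B(2) F(2) by auto
  moreover have "span B = V"
    using B(2,4) fd_subspace[OF assms(1)] by (meson span_minimal subset_antisym)
  ultimately show thesis
    using that B basis_card_eq_dim[OF B(2,4,3)] by blast
qed

lemma fd_basis:
  assumes "fd V"
  obtains B where "B \<subseteq> V" "finite B" "independent B" "span B = V" "card B = dim V"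
  using fd_extend_basis[OF assms, of "{}"] by (metis empty_subsetI independent_empty)

lemma dim_mono_fd:
  assumes "fd V" "U \<subseteq> V"
  shows "dim U \<le> dim V"
proof -
  obtain B where "finite B" "span B = V" "card B = dim V"
    using fd_basis[OF assms(1)] by metis
  then show ?thesis using dim_le_card[of U B] assms(2) by auto
qed

lemma subspace_eq_if_dim_le:
  assumes "fd V" "subspace U" "U \<subseteq> V" "dim V \<le> dim U"
  shows "U = V"
proof -
  obtain A where A: "A \<subseteq> U" "independent A" "span A = U" "card A = dim U"
    using fd_basis[OF fd_subset[OF assms(1-3)]] by metis
  obtain B where B: "A \<subseteq> B" "finite B" "span B = V" "card B = dim V"
    using fd_extend_basis[OF assms(1), of A] A(1,2) assms(3) by (metis subset_trans)
  have "A = B"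
    using B(1,2,4) A(4) assms(4) by (simp add: card_seteq)
  then show ?thesis using A(3) B(3) by simp
qed

lemma dim_less_if_psubset:
  "fd V \<Longrightarrow> subspace U \<Longrightarrow> U \<subseteq> V \<Longrightarrow> U \<noteq> V \<Longrightarrow> dim U < dim V"
  using subspace_eq_if_dim_le by (meson not_le)

lemma independent_card_le_dim_fd:
  assumes "fd V" "B \<subseteq> V" "independent B"
  shows "finite B" "card B \<le> dim V"
proof -
  obtain C where "B \<subseteq> C" "finite C" "card C = dim V"
    using fd_extend_basis[OF assms] by metis
  then show "finite B" "card B \<le> dim V"
    using card_mono[of C B] by (auto intro: finite_subset)
qed

section \<open>Sums, complements and dimension formulas\<close>

lemma vsum_left: "subspace V \<Longrightarrow> U \<subseteq> vsum U V"
  unfolding vsum_def using subspace_0 by force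

lemma vsum_right: "subspace U \<Longrightarrow> V \<subseteq> vsum U V"
  unfolding vsum_def using subspace_0 by force

lemma subspace_vsum: "subspace U \<Longrightarrow> subspace V \<Longrightarrow> subspace (vsum U V)"
  unfolding vsum_def by (rule subspace_sums)

lemma vsum_least: "subspace S \<Longrightarrow> U \<subseteq> S \<Longrightarrow> V \<subseteq> S \<Longrightarrow> vsum U V \<subseteq> S"
  unfolding vsum_def using subspace_add by blast

lemma vsum_mono: "U \<subseteq> U' \<Longrightarrow> V \<subseteq> V' \<Longrightarrow> vsum U V \<subseteq> vsum U' V'"
  unfolding vsum_def by blast

lemma vsumI: "x \<in> U \<Longrightarrow> y \<in> V \<Longrightarrow> x + y \<in> vsum U V"
  unfolding vsum_def by blast

lemma vsumE:
  assumes "z \<in> vsum U V"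
  obtains x y where "x \<in> U" "y \<in> V" "z = x + y"
  using assms unfolding vsum_def by blast

lemma fd_vsum:
  assumes "fd U" "fd V"
  shows "fd (vsum U V)"
proof -
  obtain A B where "finite A" "U = span A" "finite B" "V = span B"
    using fd_basis[OF assms(1)] fd_basis[OF assms(2)] by metis
  then show ?thesis
    using fdI_span[of "A \<union> B"] by (simp add: vsum_def span_Un)
qed

lemma independent_Un_span:
  assumes A: "independent A" and B: "independent B" and disj: "span A \<inter> span B = {0}"
  shows "independent (A \<union> B)" "A \<inter> B = {}"
proof -
  have *: "x \<notin> span ((A \<union> B) - {x})" if x: "x \<in> A" and A: "independent A"
    and disj: "span A \<inter> span B = {0}" for A B x
  proof
    assume "x \<in> span ((A \<union> B) - {x})"
    also have "span ((A \<union> B) - {x}) \<subseteq> span ((A - {x}) \<union> B)"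
      by (intro span_mono) auto
    finally obtain y z where yz: "x = y + z" "y \<in> span (A - {x})" "z \<in> span B"
      unfolding span_Un by blast
    have "y \<in> span A" using yz(2) span_mono[of "A - {x}" A] by auto
    then have "z \<in> span A"
      using yz(1) x by (metis add_diff_cancel_left' span_base span_diff)
    then have "z = 0" using yz(3) disj by auto
    then show False using yz A x by (simp add: dependent_def)
  qed
  show "independent (A \<union> B)"
    unfolding dependent_def
    using *[OF _ A disj] *[OF _ B, of _ A] disj by (metis Int_commute UnE Un_commute)
  show "A \<inter> B = {}"
  proof (rule ccontr)
    assume "A \<inter> B \<noteq> {}"
    then obtain x where "x \<in> A" "x \<in> B" by auto
    then have "x = 0" using disj span_base by blast
    then show False using \<open>x \<in> A\<close> A dependent_zero by blast
  qed
qed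

lemma complement_exists:
  assumes "fd V" "subspace U" "U \<subseteq> V"
  obtains C where "fd C" "C \<subseteq> V" "U \<inter> C = {0}" "vsum U C = V" "dim V = dim U + dim C"
proof -
  obtain A where A: "A \<subseteq> U" "finite A" "independent A" "span A = U" "card A = dim U"
    using fd_basis[OF fd_subset[OF assms]] by metis
  obtain B where B: "A \<subseteq> B" "finite B" "independent B" "span B = V" "card B = dim V"
    using fd_extend_basis[OF assms(1), of A] A assms(3) by (metis subset_trans)
  let ?C = "span (B - A)"
  have indep: "independent (B - A)"
    using B(3) independent_mono by blast
  have "vsum U ?C = V"
  proof -
    have "vsum U ?C = span (A \<union> (B - A))"
      unfolding span_Un vsum_def A(4)[symmetric] by simp
    also have "A \<union> (B - A) = B" using B(1) by auto
    finally show ?thesis using B(4) by simp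
  qed
  moreover have "dim V = dim U + dim ?C"
    using B A indep by (simp add: dim_eq_card_independent
        card_Diff_subset) (metis card_mono le_add_diff_inverse)
  moreover have "U \<inter> ?C = {0}"
  proof (rule ccontr)
    assume "U \<inter> ?C \<noteq> {0}"
    then obtain x where x: "x \<in> U" "x \<in> ?C" "x \<noteq> 0"
      using assms(2) span_zero subspace_0 by blast
    \<comment> \<open>With respect to the basis \<open>B\<close>, the coordinates of
      \<open>x\<close> are supported in \<open>A\<close> and also in \<open>B - A\<close>, so all of
      them vanish.\<close>
    have "span A \<inter> span (B - A) = {0}"
    proof -
      have "representation B x b = 0" if "b \<in> B" for b
      proof (cases "b \<in> A")
        case True
        have "representation B x = representation (B - A) x"
          by (rule representation_extend) (use B x in auto)
        then show ?thesis using True representation_ne_zero[of "B - A" x b] by auto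
      next
        case False
        have "representation B x = representation A x"
          by (rule representation_extend) (use B A x in auto)
        then show ?thesis using False representation_ne_zero[of A x b] by auto
      qed
      moreover have "x \<in> span B" using x assms(3) B(4) by auto
      ultimately have "x = 0"
        using sum_representation_eq[OF B(3), of x B] B(2) by simp
      then show ?thesis using x by simp
    qed
    then show False using x A(4) by blast
  qed
  moreover have "?C \<subseteq> V" using B(4) span_mono[of "B - A" B] by auto
  ultimately show thesis
    using that fdI_span[of "B - A"] B(2) by blast
qed

lemma dim_vsum_Int:
  assumes "fd U" "fd V"
  shows "dim (vsum U V) + dim (U \<inter> V) = dim U + dim V"
proof -
  have sub: "subspace (U \<inter> V)" using assms fd_subspace subspace_inter by blast
  obtain C where C: "fd C" "C \<subseteq> V" "(U \<inter> V) \<inter> C = {0}" "vsum (U \<inter> V) C = V"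
      "dim V = dim (U \<inter> V) + dim C"
    using complement_exists[OF assms(2) sub] by blast
  obtain A B where A: "finite A" "independent A" "span A = U" "card A = dim U"
    and B: "finite B" "independent B" "span B = C" "card B = dim C"
    using fd_basis[OF assms(1)] fd_basis[OF C(1)] by metis
  have disj: "span A \<inter> span B = {0}"
    using A(3) B(3) C(2,3) by auto
  note AB = independent_Un_span[OF A(2) B(2) disj]
  have "vsum U V = vsum U C"
  proof
    show "vsum U C \<subseteq> vsum U V" using C(2) by (intro vsum_mono) auto
    show "vsum U V \<subseteq> vsum U C"
    proof (rule vsum_least)
      show "subspace (vsum U C)" "U \<subseteq> vsum U C"
        using assms(1) C(1) fd_subspace subspace_vsum vsum_left by auto
      have "vsum (U \<inter> V) C \<subseteq> vsum U C" by (intro vsum_mono) auto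
      then show "V \<subseteq> vsum U C" using C(4) by simp
    qed
  qed
  also have "\<dots> = span (A \<union> B)" by (simp add: vsum_def span_Un A(3) B(3))
  finally have "dim (vsum U V) = card (A \<union> B)"
    using AB(1) by (simp add: dim_eq_card_independent)
  also have "\<dots> = dim U + dim C" using A B AB(2) by (simp add: card_Un_disjoint)
  finally show ?thesis using C(5) by simp
qed

lemma dim_vsum_le: "fd U \<Longrightarrow> fd V \<Longrightarrow> dim (vsum U V) \<le> dim U + dim V"
  using dim_vsum_Int by (metis le_add1)

lemma dim_span_singleton_le: "dim (span {x}) \<le> 1"
  using dim_le_card[of "span {x}" "{x}"] by simp

lemma dim_span_insert:
  assumes "fd V" "x \<notin> V"
  shows "dim (vsum V (span {x})) = Suc (dim V)"
proof -
  have sub: "subspace V" using assms fd_subspace by auto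
  have x0: "x \<noteq> 0" using assms(2) subspace_0[OF sub] by auto
  have "V \<inter> span {x} = {0}"
    using assms(2) subspace_0[OF sub] subspace_scale[OF sub]
    by (auto simp: span_singleton span_zero) (metis scale_eq_0_iff scale_scale left_inverse scale_one)
  moreover have "dim (span {x}) = 1"
    using x0 by (simp add: dim_eq_card_independent)
  moreover have "dim {0} = 0" using dim_eq_card_independent[OF independent_empty] dim_span[of "{}"] by simp
  ultimately show ?thesis
    using dim_vsum_Int[OF assms(1) fdI_span[of "{x}"]] by simp
qed

lemma dim_kernel_functional:
  assumes "fd V" and add: "\<And>x y. f (x + y) = f x + f y"
    and scl: "\<And>c x. f (scale c x) = c * f x"
  shows "fd {x \<in> V. f x = 0}" "dim V \<le> Suc (dim {x \<in> V. f x = 0})"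
proof -
  let ?K = "{x \<in> V. f x = 0}"
  have V: "subspace V" using assms fd_subspace by auto
  have f0: "f 0 = 0" using scl[of 0 0] by simp
  have K: "subspace ?K"
    unfolding subspace_def using V f0 add scl by (auto simp: subspace_def)
  show fdK: "fd ?K" by (rule fd_subset[OF assms(1) K]) auto
  show "dim V \<le> Suc (dim ?K)"
  proof (cases "?K = V")
    case True
    then show ?thesis by simp
  next
    case False
    then obtain v where v: "v \<in> V" "f v \<noteq> 0" by auto
    have "V \<subseteq> vsum ?K (span {v})"
    proof
      fix x assume x: "x \<in> V"
      define c where "c = f x / f v"
      have "f (x - scale c v) = 0"
      proof -
        have "f x = f (x - scale c v) + f (scale c v)" using add[of "x - scale c v" "scale c v"] by simp
        then show ?thesis using scl v by (simp add: c_def)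
      qed
      moreover have "x - scale c v \<in> V" using x v V by (simp add: subspace_diff subspace_scale)
      ultimately have "(x - scale c v) + scale c v \<in> vsum ?K (span {v})"
        by (intro vsumI) (auto simp: span_scale span_base)
      then show "x \<in> vsum ?K (span {v})" by simp
    qed
    then have "dim V \<le> dim (vsum ?K (span {v}))"
      by (intro dim_mono_fd fd_vsum fdK fdI_span) auto
    also have "\<dots> \<le> dim ?K + 1"
      using dim_vsum_le[OF fdK fdI_span[of "{v}"]] dim_span_singleton_le[of v] by simp
    finally show ?thesis by simp
  qed
qed

text \<open>Each linear condition costs at most one dimension. Applied to points this yields linear
  forms through them; applied to a pairing it compares row and column rank.\<close>

lemma dim_kernel_functionals:
  assumes "fd V" "finite I" and "\<And>i x y. i \<in> I \<Longrightarrow> f i (x + y) = f i x + f i y"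
    and "\<And>i c x. i \<in> I \<Longrightarrow> f i (scale c x) = c * f i x"
  shows "fd {x \<in> V. \<forall>i\<in>I. f i x = 0}" "dim V \<le> card I + dim {x \<in> V. \<forall>i\<in>I. f i x = 0}"
proof -
  have "fd {x \<in> V. \<forall>i\<in>I. f i x = 0} \<and> dim V \<le> card I + dim {x \<in> V. \<forall>i\<in>I. f i x = 0}"
    using assms(2-)
  proof (induction I rule: finite_induct)
    case empty
    then show ?case using assms(1) by simp
  next
    case (insert i I)
    let ?K = "{x \<in> V. \<forall>i\<in>I. f i x = 0}"
    have eq: "{x \<in> V. \<forall>i\<in>insert i I. f i x = 0} = {x \<in> ?K. f i x = 0}" by auto
    have IH: "fd ?K" "dim V \<le> card I + dim ?K" using insert by auto
    show ?case unfolding eq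
      using dim_kernel_functional[OF IH(1), of "f i"] IH(2) insert by (auto simp: card_insert_if)
  qed
  then show "fd {x \<in> V. \<forall>i\<in>I. f i x = 0}" "dim V \<le> card I + dim {x \<in> V. \<forall>i\<in>I. f i x = 0}"
    by auto
qed

lemma dim_image_inj_fd:
  assumes f: "Vector_Spaces.linear scale scale f" and V: "fd V" and inj: "\<And>x. x \<in> V \<Longrightarrow> f x = 0 \<Longrightarrow> x = 0"
  shows "fd (f ` V)" "dim (f ` V) = dim V"
proof -
  interpret f: Vector_Spaces.linear scale scale f by (rule f)
  obtain B where B: "finite B" "independent B" "span B = V" "card B = dim V"
    using fd_basis[OF V] by metis
  have inj': "inj_on f V"
    using inj fd_subspace[OF V]
    by (intro inj_onI) (metis eq_iff_diff_eq_0 f.diff subspace_diff)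
  have img: "f ` V = span (f ` B)" using f.span_image[of B] B(3) by simp
  show "fd (f ` V)" unfolding img using B(1) by (intro fdI_span) auto
  have "independent (f ` B)"
    using f.independent_injective_image[OF B(2)] inj' B(3) by simp
  then have "dim (f ` V) = card (f ` B)"
    unfolding img by (simp add: dim_eq_card_independent)
  also have "\<dots> = card B"
    using inj' B(3) span_superset by (metis card_image inj_on_subset)
  finally show "dim (f ` V) = dim V" using B(4) by simp
qed

end

section \<open>Forms in four variables\<close>

lemma UNIV_var4: "(UNIV :: var4 set) = {W, X, Y, Z}"
  using var4.exhaust by auto

instance var4 :: finite
  by standard (simp add: UNIV_var4)

text \<open>Any linear order on the variables makes polynomials an integral domain in the library.\<close>

instantiation var4 :: linorder
begin

primrec var4_index :: "var4 \<Rightarrow> nat" where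
  "var4_index W = 0" | "var4_index X = 1" | "var4_index Y = 2" | "var4_index Z = 3"

definition "u \<le> v \<longleftrightarrow> var4_index u \<le> var4_index v"
definition "u < v \<longleftrightarrow> var4_index u < var4_index v" for u v :: var4

instance
proof
  fix u v :: var4
  show "u \<le> v \<Longrightarrow> v \<le> u \<Longrightarrow> u = v"
    by (cases u; cases v) (auto simp: less_eq_var4_def)
qed (auto simp: less_eq_var4_def less_var4_def)

end

lemma lookup_pscale [simp]: "Poly_Mapping.lookup (pscale c p) m = c * Poly_Mapping.lookup p m"
  by (simp add: pscale_def Poly_Mapping.map.rep_eq when_def)

lemma pscale_conv_mult: "pscale c p = Poly_Mapping.single 0 c * p"
  unfolding pscale_def by (rule mult_map_scale_conv_mult)

global_interpretation Vec: vspace "pscale :: 'k::field \<Rightarrow> 'k poly4 \<Rightarrow> 'k poly4"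
  by unfold_locales (auto intro!: poly_mapping_eqI simp: lookup_add algebra_simps)

lemma kdim_eq: "kdim S = Vec.dim S"
  by (simp add: kdim_def)

lemma pscale_mult_left [simp]: "pscale c p * q = pscale c (p * q)"
  by (simp add: pscale_conv_mult mult.assoc)

lemma pscale_mult_right [simp]: "q * pscale c p = pscale c (q * p)"
  by (simp add: pscale_conv_mult mult.left_commute)

lemma linear_mult: "Vector_Spaces.linear pscale pscale ((*) (g :: 'k::field poly4))"
  by (simp add: Vector_Spaces.linear_iff Vec.vector_space_axioms distrib_left)

lemma poly4_sum_monomials:
  "f = (\<Sum>m\<in>Poly_Mapping.keys f. pscale (Poly_Mapping.lookup f m) (Poly_Mapping.single m 1))"
  by (rule poly_mapping_eqI)
    (auto simp: lookup_sum lookup_single when_def in_keys_iff if_distrib cong: if_cong)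

lemma mon_deg_add: "mon_deg (a + b) = mon_deg a + mon_deg b"
  by (simp add: mon_deg_def lookup_add)

lemma mon_deg_zero [simp]: "mon_deg 0 = 0"
  by (simp add: mon_deg_def)

lemma mon_deg_single [simp]: "mon_deg (Poly_Mapping.single v n) = n"
  by (cases v) (auto simp: mon_deg_def lookup_single)

lemma subspace_forms: "Vec.subspace (forms i)"
  unfolding Vec.subspace_def forms_def
  by (auto simp: in_keys_iff lookup_add)

lemmas forms_zero [simp] = Vec.subspace_0[OF subspace_forms]
  and forms_add = Vec.subspace_add[OF subspace_forms]
  and forms_diff = Vec.subspace_diff[OF subspace_forms]
  and forms_pscale = Vec.subspace_scale[OF subspace_forms]

lemma forms_mult: "f \<in> forms i \<Longrightarrow> g \<in> forms j \<Longrightarrow> f * g \<in> forms (i + j)"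
  unfolding forms_def using keys_mult[of f g] by (force simp: mon_deg_add)

lemma pvar_in_forms [simp]: "pvar v \<in> forms (Suc 0)"
  by (simp add: forms_def pvar_def)

lemma forms_mult_linear: "f \<in> forms (Suc 0) \<Longrightarrow> g \<in> forms i \<Longrightarrow> f * g \<in> forms (Suc i)"
  using forms_mult[of f 1 g i] by simp

lemma monomial_in_forms: "Poly_Mapping.single m c \<in> forms (mon_deg m)"
  by (auto simp: forms_def)

lemma forms_subset_monomials:
  fixes S :: "'k::field poly4 set"
  assumes "Vec.subspace S" "\<And>m. mon_deg m = i \<Longrightarrow> Poly_Mapping.single m 1 \<in> S"
  shows "forms i \<subseteq> S"
proof
  fix f :: "'k poly4" assume "f \<in> forms i"
  then show "f \<in> S"
    by (subst poly4_sum_monomials) (auto simp: forms_def intro!: Vec.subspace_sum Vec.subspace_scale assms)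
qed

text \<open>Every monomial of positive degree is a variable times a smaller one. This is the
  induction principle for forms: a property closed under linear combinations is checked on the
  products \<open>pvar v * g\<close>.\<close>

lemma forms_Suc_subset:
  fixes S :: "'k::field poly4 set"
  assumes "Vec.subspace S" "\<And>v g. g \<in> forms i \<Longrightarrow> pvar v * g \<in> S"
  shows "forms (Suc i) \<subseteq> S"
proof (rule forms_subset_monomials[OF assms(1)])
  fix m :: "var4 \<Rightarrow>\<^sub>0 nat" assume m: "mon_deg m = Suc i"
  then obtain v where v: "Poly_Mapping.lookup m v > 0"
    unfolding mon_deg_def by (metis add_is_0 gr0I nat.distinct(1))
  define m' where "m' = m - Poly_Mapping.single v 1"
  have mm: "m = Poly_Mapping.single v 1 + m'"
    using v by (intro poly_mapping_eqI) (auto simp: m'_def lookup_add lookup_minus lookup_single when_def)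
  then have "mon_deg m' = i" using m by (simp add: mon_deg_add)
  moreover have "(Poly_Mapping.single m 1 :: 'k poly4) = pvar v * Poly_Mapping.single m' 1"
    unfolding pvar_def mult_single by (simp add: mm)
  ultimately show "(Poly_Mapping.single m 1 :: 'k poly4) \<in> S"
    using assms(2)[of "Poly_Mapping.single m' 1" v] monomial_in_forms[of m' 1] by simp
qed

lemma mon_deg_eq_0: "mon_deg m = 0 \<longleftrightarrow> m = 0"
proof
  assume "mon_deg m = 0"
  then have "Poly_Mapping.lookup m v = 0" for v by (cases v) (auto simp: mon_deg_def)
  then show "m = 0" by (intro poly_mapping_eqI) auto
qed simp

lemma forms_0: "forms 0 = range (\<lambda>c. pscale c 1)"
proof -
  have "Vec.subspace (range (\<lambda>c. pscale c (1 :: 'a poly4)))"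
    using Vec.subspace_span[of "{1}"] by (simp add: Vec.span_singleton)
  then have "forms 0 \<subseteq> range (\<lambda>c. pscale c (1 :: 'a poly4))"
    by (rule forms_subset_monomials) (auto simp: mon_deg_eq_0 intro: image_eqI[of _ _ 1])
  moreover have "pscale c 1 \<in> forms 0" for c :: 'a
    by (intro forms_pscale) (simp add: forms_def)
  ultimately show ?thesis by auto
qed

lemma one_in_forms [simp]: "1 \<in> forms 0"
  by (simp add: forms_def)

section \<open>Dimensions of the spaces of forms\<close>

lemma finite_mon_deg [simp]: "finite {m. mon_deg m = n}"
  and card_mon_deg: "card {m. mon_deg m = n} = (\<Sum>a\<le>n. \<Sum>b\<le>n - a. Suc (n - a - b))"
proof -
  define A where "A = (SIGMA a : {..n}. SIGMA b : {..n - a}. {..n - a - b})"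
  define f where "f = (\<lambda>m :: var4 \<Rightarrow>\<^sub>0 nat. (Poly_Mapping.lookup m W, Poly_Mapping.lookup m X, Poly_Mapping.lookup m Y))"
  define g where "g = (\<lambda>(a, b, c). Poly_Mapping.single W a + Poly_Mapping.single X b +
    Poly_Mapping.single Y c + Poly_Mapping.single Z (n - a - b - c))"
  have bij: "bij_betw f {m. mon_deg m = n} A"
  proof (rule bij_betw_byWitness[where f' = g])
    show "\<forall>m\<in>{m. mon_deg m = n}. g (f m) = m"
    proof
      fix m assume "m \<in> {m. mon_deg m = n}"
      then have "Poly_Mapping.lookup (g (f m)) v = Poly_Mapping.lookup m v" for v
        by (cases v) (auto simp: f_def g_def mon_deg_def lookup_add lookup_single)
      then show "g (f m) = m" by (intro poly_mapping_eqI)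
    qed
    show "\<forall>x\<in>A. f (g x) = x"
      by (auto simp: A_def f_def g_def lookup_add lookup_single)
    show "f ` {m. mon_deg m = n} \<subseteq> A"
      by (auto simp: A_def f_def mon_deg_def)
    show "g ` A \<subseteq> {m. mon_deg m = n}"
      by (auto simp: A_def g_def mon_deg_add)
  qed
  have "finite A" by (simp add: A_def)
  then show "finite {m. mon_deg m = n}" using bij bij_betw_finite by blast
  show "card {m. mon_deg m = n} = (\<Sum>a\<le>n. \<Sum>b\<le>n - a. Suc (n - a - b))"
    using bij_betw_same_card[OF bij] by (simp add: A_def)
qed

lemma fd_forms: "Vec.fd (forms i :: 'k::field poly4 set)"
  and dim_forms_card: "Vec.dim (forms i :: 'k poly4 set) = card {m. mon_deg m = i}"
proof -
  let ?b = "\<lambda>m. Poly_Mapping.single m 1 :: 'k poly4"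
  let ?B = "?b ` {m. mon_deg m = i}"
  have inj: "inj ?b" by (intro injI) (metis lookup_single_eq lookup_single_not_eq zero_neq_one)
  have sub: "forms i \<subseteq> Vec.span ?B"
    by (rule forms_subset_monomials) (auto intro: Vec.span_base)
  then show "Vec.fd (forms i :: 'k poly4 set)"
    unfolding Vec.fd_def using finite_mon_deg subspace_forms by blast
  have "Vec.independent ?B"
  proof (rule Vec.independent_if_scalars_zero)
    show "finite ?B" using finite_mon_deg by simp
    fix u x assume 0: "(\<Sum>x\<in>?B. pscale (u x) x) = 0" and "x \<in> ?B"
    then obtain m where m: "x = ?b m" "mon_deg m = i" by auto
    have "0 = Poly_Mapping.lookup (\<Sum>x\<in>?B. pscale (u x) x) m" using 0 by simp
    also have "\<dots> = (\<Sum>n\<in>{m. mon_deg m = i}. u (?b n) * Poly_Mapping.lookup (?b n) m)"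
      by (simp add: lookup_sum sum.reindex[OF inj_on_subset[OF inj]])
    also have "\<dots> = u x"
      using m finite_mon_deg by (simp add: lookup_single when_def if_distrib cong: if_cong)
    finally show "u x = 0" by simp
  qed
  then have "Vec.dim (forms i :: 'k poly4 set) = card ?B"
    using sub monomial_in_forms by (intro Vec.basis_card_eq_dim[symmetric]) auto
  then show "Vec.dim (forms i :: 'k poly4 set) = card {m. mon_deg m = i}"
    by (simp add: card_image inj_on_subset[OF inj])
qed

lemma dim_forms:
  "Vec.dim (forms n :: 'k::field poly4 set) = (\<Sum>k\<le>n. \<Sum>b\<le>k. Suc b)"
proof -
  have "(\<Sum>a\<le>n. \<Sum>b\<le>n - a. Suc (n - a - b)) = (\<Sum>a\<le>n. \<Sum>b\<le>n - a. Suc b)"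
  proof (rule sum.cong[OF refl])
    fix a
    show "(\<Sum>b\<le>n - a. Suc (n - a - b)) = (\<Sum>b\<le>n - a. Suc b)"
      by (rule sum.reindex_bij_witness[of _ "\<lambda>b. n - a - b" "\<lambda>b. n - a - b"]) auto
  qed
  also have "\<dots> = (\<Sum>k\<le>n. \<Sum>b\<le>k. Suc b)"
    by (rule sum.reindex_bij_witness[of _ "\<lambda>b. n - b" "\<lambda>b. n - b"]) auto
  finally show ?thesis by (simp add: dim_forms_card card_mon_deg)
qed

lemma dim_forms_1: "Vec.dim (forms (Suc 0) :: 'k::field poly4 set) = 4"
  and dim_forms_2: "Vec.dim (forms 2 :: 'k::field poly4 set) = 10"
  by (simp_all add: dim_forms numeral_2_eq_2)

text \<open>The second difference of binom(n+3,3). The excess \<open>n + 3\<close> counts the forms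
  of degree \<open>n + 2\<close> in two variables, that is, on the line cut out by two independent
  linear forms.\<close>

lemma dim_forms_second_difference:
  "Vec.dim (forms (n + 2) :: 'k::field poly4 set) + Vec.dim (forms n :: 'k poly4 set) =
    2 * Vec.dim (forms (n + 1) :: 'k poly4 set) + n + 3"
  by (simp add: dim_forms)

section \<open>Substitution and evaluation\<close>

definition mon_eval :: "(var4 \<Rightarrow> 'a::comm_ring_1) \<Rightarrow> (var4 \<Rightarrow>\<^sub>0 nat) \<Rightarrow> 'a" where
  "mon_eval g m = (\<Prod>v\<in>UNIV. g v ^ Poly_Mapping.lookup m v)"

text \<open>One definition for three homomorphisms: evaluation at a point, restriction to a
  parametrized curve (values in univariate polynomials) and substitution of polynomials for the
  variables.\<close>

definition subst :: "('k::field \<Rightarrow> 'a::comm_ring_1) \<Rightarrow> (var4 \<Rightarrow> 'a) \<Rightarrow> 'k poly4 \<Rightarrow> 'a" where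
  "subst c g f = (\<Sum>m\<in>Poly_Mapping.keys f. c (Poly_Mapping.lookup f m) * mon_eval g m)"

lemma mon_eval_add: "mon_eval g (m + n) = mon_eval g m * mon_eval g n"
  by (simp add: mon_eval_def lookup_add power_add prod.distrib)

lemma mon_eval_zero [simp]: "mon_eval g 0 = 1"
  by (simp add: mon_eval_def)

lemma mon_eval_single [simp]: "mon_eval g (Poly_Mapping.single v n) = g v ^ n"
proof -
  have "mon_eval g (Poly_Mapping.single v n) = (\<Prod>u\<in>UNIV. if u = v then g v ^ n else 1)"
    unfolding mon_eval_def by (intro prod.cong) (auto simp: lookup_single when_def)
  then show ?thesis by simp
qed

locale coeff_hom =
  fixes c :: "'k::field \<Rightarrow> 'a::comm_ring_1"
  assumes c_zero: "c 0 = 0" and c_one: "c 1 = 1"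
    and c_add: "c (a + b) = c a + c b" and c_mult: "c (a * b) = c a * c b"
begin

lemma subst_superset:
  assumes "finite S" "Poly_Mapping.keys f \<subseteq> S"
  shows "subst c g f = (\<Sum>m\<in>S. c (Poly_Mapping.lookup f m) * mon_eval g m)"
  unfolding subst_def
  by (rule sum.mono_neutral_left) (use assms in \<open>auto simp: in_keys_iff c_zero\<close>)

lemma subst_zero [simp]: "subst c g 0 = 0"
  by (simp add: subst_def)

lemma subst_single: "subst c g (Poly_Mapping.single m a) = c a * mon_eval g m"
  by (subst subst_superset[of "{m}"]) auto

lemma subst_one [simp]: "subst c g 1 = 1"
  using subst_single[of g 0 1] by (simp add: c_one)

lemma subst_pvar [simp]: "subst c g (pvar v) = g v"
  by (simp add: pvar_def subst_single c_one)

lemma subst_add: "subst c g (f + h) = subst c g f + subst c g h"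
proof -
  let ?S = "Poly_Mapping.keys f \<union> Poly_Mapping.keys h"
  have "Poly_Mapping.keys (f + h) \<subseteq> ?S" by (rule keys_add)
  then show ?thesis
    by (simp add: subst_superset[of ?S] lookup_add c_add distrib_right sum.distrib)
qed

lemma subst_sum: "subst c g (\<Sum>i\<in>I. f i) = (\<Sum>i\<in>I. subst c g (f i))"
  by (induction I rule: infinite_finite_induct) (auto simp: subst_add)

lemma poly4_sum_single: "f = (\<Sum>m\<in>Poly_Mapping.keys f. Poly_Mapping.single m (Poly_Mapping.lookup f m))"
  by (rule poly_mapping_eqI)
    (auto simp: lookup_sum lookup_single when_def in_keys_iff if_distrib cong: if_cong)

lemma subst_mult: "subst c g (f * h) = subst c g f * subst c g h"
proof -
  have "subst c g (Poly_Mapping.single m a * h) = c a * mon_eval g m * subst c g h" for m a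
  proof -
    have "Poly_Mapping.single m a * h =
        (\<Sum>n\<in>Poly_Mapping.keys h. Poly_Mapping.single (m + n) (a * Poly_Mapping.lookup h n))"
      by (subst poly4_sum_single[of h]) (simp add: sum_distrib_left mult_single)
    then show ?thesis
      by (simp add: subst_sum subst_single mon_eval_add c_mult subst_def[of c g h] sum_distrib_left mult_ac)
  qed
  moreover have "f * h = (\<Sum>m\<in>Poly_Mapping.keys f. Poly_Mapping.single m (Poly_Mapping.lookup f m) * h)"
    by (subst poly4_sum_single[of f]) (simp add: sum_distrib_right)
  ultimately show ?thesis
    by (simp add: subst_sum subst_def[of c g f] sum_distrib_right)
qed

lemma subst_pscale: "subst c g (pscale a f) = c a * subst c g f"
  by (simp add: pscale_conv_mult subst_mult subst_single)

lemma subst_diff: "subst c g (f - h) = subst c g f - subst c g h"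
  using subst_add[of g "f - h" h] by (simp add: algebra_simps)

lemma hom_subst:
  assumes "coeff_hom (h \<circ> c)"
    and "\<And>a b. h (a + b) = h a + h b" "\<And>a b. h (a * b) = h a * h b"
  shows "h (subst c g f) = subst (h \<circ> c) (h \<circ> g) f"
proof -
  have 0: "h 0 = 0" using coeff_hom.c_zero[OF assms(1)] c_zero by simp
  have 1: "h 1 = 1" using coeff_hom.c_one[OF assms(1)] c_one by simp
  have sum: "h (sum F S) = (\<Sum>x\<in>S. h (F x))" for F and S :: "(var4 \<Rightarrow>\<^sub>0 nat) set"
    by (induction S rule: infinite_finite_induct) (auto simp: 0 assms)
  have pow: "h (x ^ n) = h x ^ n" for x n
    by (induction n) (auto simp: 1 assms)
  have prod: "h (prod F S) = (\<Prod>x\<in>S. h (F x))" for F and S :: "var4 set"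
    by (induction S rule: infinite_finite_induct) (auto simp: 1 assms)
  show ?thesis unfolding subst_def mon_eval_def by (simp add: sum assms prod pow)
qed

end

interpretation ev: coeff_hom "\<lambda>x :: 'k::field. x"
  by unfold_locales auto

interpretation pev: coeff_hom "\<lambda>x :: 'k::field. [:x:]"
  by unfold_locales (auto simp: one_pCons)

interpretation lsub: coeff_hom "\<lambda>x :: 'k::field. Poly_Mapping.single (0 :: var4 \<Rightarrow>\<^sub>0 nat) x"
  by unfold_locales (auto simp: single_add mult_single)

abbreviation ev :: "(var4 \<Rightarrow> 'k::field) \<Rightarrow> 'k poly4 \<Rightarrow> 'k" where
  "ev \<equiv> subst (\<lambda>x. x)"

abbreviation lsub :: "(var4 \<Rightarrow> 'k::field poly4) \<Rightarrow> 'k poly4 \<Rightarrow> 'k poly4" where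
  "lsub \<equiv> subst (Poly_Mapping.single 0)"

lemma ev_lsub: "ev p (lsub s f) = ev (\<lambda>v. ev p (s v)) f"
  using lsub.hom_subst[of "ev p" s f] ev.coeff_hom_axioms
  by (simp add: comp_def ev.subst_add ev.subst_mult ev.subst_single)

lemma poly_pev: "poly (subst (\<lambda>x. [:x:]) q f) s = ev (\<lambda>v. poly (q v) s) f"
  using pev.hom_subst[of "\<lambda>r. poly r s" q f] ev.coeff_hom_axioms
  by (simp add: comp_def)

lemma exists_ev_nonzero:
  fixes f :: "'k::field poly4"
  assumes inf: "infinite (UNIV :: 'k set)" and "f \<noteq> 0"
  shows "\<exists>p. ev p f \<noteq> 0"
proof -
  text \<open>Kronecker substitution: for large \<open>D\<close> distinct monomials of \<open>f\<close> become distinct powers.\<close>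
  define D where "D = Suc (\<Sum>m\<in>Poly_Mapping.keys f. mon_deg m)"
  define e where "e = (\<lambda>m. Poly_Mapping.lookup m W + D * (Poly_Mapping.lookup m X +
    D * (Poly_Mapping.lookup m Y + D * Poly_Mapping.lookup m Z)))"
  define q where "q = (\<lambda>v. monom (1::'k) (D ^ var4_index v))"
  have eval: "mon_eval q m = monom 1 (e m)" for m
    by (simp add: mon_eval_def UNIV_var4 q_def monom_power mult_monom e_def algebra_simps
        power2_eq_square power3_eq_cube)
  have bound: "Poly_Mapping.lookup m v < D" if "m \<in> Poly_Mapping.keys f" for m v
  proof -
    have "Poly_Mapping.lookup m v \<le> mon_deg m" by (cases v) (auto simp: mon_deg_def)
    also have "\<dots> \<le> (\<Sum>m\<in>Poly_Mapping.keys f. mon_deg m)"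
      using that by (intro member_le_sum) auto
    finally show ?thesis by (simp add: D_def)
  qed
  have digit: "a = a' \<and> b = b'" if "a + D * b = a' + D * b'" "a < D" "a' < D" for a a' b b'
  proof -
    have "a = a'" using arg_cong[OF that(1), of "\<lambda>x. x mod D"] that(2,3) by simp
    then show ?thesis using that by auto
  qed
  have inj: "inj_on e (Poly_Mapping.keys f)"
  proof
    fix m n assume mn: "m \<in> Poly_Mapping.keys f" "n \<in> Poly_Mapping.keys f" "e m = e n"
    have "Poly_Mapping.lookup m v = Poly_Mapping.lookup n v" for v
      using digit[OF mn(3)[unfolded e_def] bound[OF mn(1)] bound[OF mn(2)]]
        digit[OF _ bound[OF mn(1)] bound[OF mn(2)]]
      by (cases v) blast+
    then show "m = n" by (intro poly_mapping_eqI)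
  qed
  obtain m where m: "m \<in> Poly_Mapping.keys f" using \<open>f \<noteq> 0\<close> by fastforce
  have "coeff (subst (\<lambda>x. [:x:]) q f) (e m) =
      (\<Sum>n\<in>Poly_Mapping.keys f. if n = m then Poly_Mapping.lookup f n else 0)"
    unfolding subst_def coeff_sum
    by (intro sum.cong refl) (use inj m in \<open>auto simp: eval smult_monom dest: inj_onD\<close>)
  also have "\<dots> \<noteq> 0" using m by (simp add: in_keys_iff)
  finally have "subst (\<lambda>x. [:x:]) q f \<noteq> 0" by auto
  then have "finite {s. poly (subst (\<lambda>x. [:x:]) q f) s = 0}" by (rule poly_roots_finite)
  then obtain s where "poly (subst (\<lambda>x. [:x:]) q f) s \<noteq> 0"
    using inf by (metis (mono_tags, lifting) UNIV_eq_I mem_Collect_eq)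
  then show ?thesis unfolding poly_pev by blast
qed

text \<open>On the line through \<open>z\<close> in direction \<open>e\<close>, \<open>f\<close>
  becomes a univariate polynomial that is nonzero at 0, so only finitely many \<open>s\<close> are
  bad. It serves to move a point off a hyperplane while \<open>f\<close> stays nonzero.\<close>

lemma ev_nonzero_on_line:
  fixes f :: "'k::field poly4"
  assumes inf: "infinite (UNIV :: 'k set)" and "ev z f \<noteq> 0"
  shows "\<exists>s. s \<noteq> 0 \<and> ev (\<lambda>v. z v + s * e v) f \<noteq> 0"
proof -
  define F where "F = subst (\<lambda>x. [:x:]) (\<lambda>v. [:z v, e v:]) f"
  have F: "poly F s = ev (\<lambda>v. z v + s * e v) f" for s
    by (simp add: F_def poly_pev)
  have "F \<noteq> 0" using F[of 0] assms(2) by auto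
  then have "finite (insert 0 {s. poly F s = 0})" by (simp add: poly_roots_finite)
  then obtain s where "s \<notin> insert 0 {s. poly F s = 0}"
    using inf ex_new_if_finite by blast
  then show ?thesis using F by auto
qed

section \<open>Linear forms and points\<close>

definition lcoeff :: "'k::field poly4 \<Rightarrow> var4 \<Rightarrow> 'k" where
  "lcoeff N v = Poly_Mapping.lookup N (Poly_Mapping.single v 1)"

lemma linear_form_expand:
  fixes N :: "'k::field poly4"
  assumes "N \<in> forms (Suc 0)"
  shows "N = (\<Sum>v\<in>UNIV. pscale (lcoeff N v) (pvar v))"
proof -
  let ?S = "{N :: 'k poly4. N = (\<Sum>v\<in>UNIV. pscale (lcoeff N v) (pvar v))}"
  have lin: "lcoeff (x + y) v = lcoeff x v + lcoeff y v" "lcoeff (pscale c x) v = c * lcoeff x v"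
      "lcoeff 0 v = 0" for x y :: "'k poly4" and c v
    by (simp_all add: lcoeff_def lookup_add)
  have "forms (Suc 0) \<subseteq> ?S"
  proof (rule forms_Suc_subset)
    show "Vec.subspace ?S"
      unfolding Vec.subspace_def
    proof (intro conjI ballI allI)
      fix c and x :: "'k poly4" assume "x \<in> ?S"
      then have "pscale c x = pscale c (\<Sum>v\<in>UNIV. pscale (lcoeff x v) (pvar v))"
        by (intro arg_cong[of x _ "pscale c"]) blast
      also have "\<dots> = (\<Sum>v\<in>UNIV. pscale (lcoeff (pscale c x) v) (pvar v))"
        by (simp only: lin Vec.scale_sum_right Vec.scale_scale)
      finally show "pscale c x \<in> ?S" by blast
    qed (auto simp: lin Vec.scale_left_distrib sum.distrib)
    fix v :: var4 and g :: "'k poly4" assume "g \<in> forms 0"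
    then obtain c where c: "g = pscale c 1" by (auto simp: forms_0)
    have single: "Poly_Mapping.single v (1::nat) = Poly_Mapping.single u 1 \<longleftrightarrow> u = v" for u
      by (metis lookup_single_eq lookup_single_not_eq zero_neq_one)
    have "lcoeff (pvar v :: 'k poly4) u = (if u = v then 1 else 0)" for u
      by (simp only: lcoeff_def pvar_def lookup_single when_def single)
    then have "(\<Sum>u\<in>UNIV. pscale (lcoeff (pvar v * g) u) (pvar u)) =
        (\<Sum>u\<in>UNIV. if u = v then pscale c (pvar v) else 0)"
      unfolding c by (intro sum.cong) (auto simp: lin)
    then show "pvar v * g \<in> ?S" by (simp add: c)
  qed
  then show ?thesis using assms by blast
qed

lemma ev_linear_form:
  assumes "N \<in> forms (Suc 0)"
  shows "ev p N = (\<Sum>v\<in>UNIV. lcoeff N v * p v)"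
proof -
  have "ev p N = ev p (\<Sum>v\<in>UNIV. pscale (lcoeff N v) (pvar v))"
    by (rule arg_cong[where f = "ev p", OF linear_form_expand[OF assms]])
  then show ?thesis by (simp only: ev.subst_sum ev.subst_pscale ev.subst_pvar)
qed

lemma ev_linear_comb:
  assumes "N \<in> forms (Suc 0)"
  shows "ev (\<lambda>v. a * p v + b * q v) N = a * ev p N + b * ev q N"
  unfolding ev_linear_form[OF assms] sum_distrib_left sum.distrib[symmetric]
  by (intro sum.cong refl) (simp add: algebra_simps)

lemma ev_scale:
  assumes "f \<in> forms d"
  shows "ev (\<lambda>v. c * p v) f = c ^ d * ev p f"
  using assms
proof (induction d arbitrary: f)
  case 0
  then show ?case by (auto simp: forms_0 ev.subst_pscale)
next
  case (Suc d)
  have "forms (Suc d) \<subseteq> {f. ev (\<lambda>v. c * p v) f = c ^ Suc d * ev p f}"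
  proof (rule forms_Suc_subset)
    fix v :: var4 and g :: "'a poly4" assume "g \<in> forms d"
    then show "pvar v * g \<in> {f. ev (\<lambda>v. c * p v) f = c ^ Suc d * ev p f}"
      using Suc.IH[of g] by (simp add: ev.subst_mult)
  qed (auto simp: Vec.subspace_def ev.subst_add ev.subst_pscale distrib_left)
  then show ?case using Suc.prems by auto
qed

section \<open>Functionals as points, and systems of independent points\<close>

definition functional :: "('k::field poly4 \<Rightarrow> 'k) \<Rightarrow> bool" where
  "functional \<phi> \<longleftrightarrow> (\<forall>x y. \<phi> (x + y) = \<phi> x + \<phi> y) \<and> (\<forall>c x. \<phi> (pscale c x) = c * \<phi> x)"

lemma functional_add: "functional \<phi> \<Longrightarrow> \<phi> (x + y) = \<phi> x + \<phi> y"
  and functional_pscale: "functional \<phi> \<Longrightarrow> \<phi> (pscale c x) = c * \<phi> x"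
  by (auto simp: functional_def)

lemma functional_zero: "functional \<phi> \<Longrightarrow> \<phi> 0 = 0"
  using functional_pscale[of \<phi> 0 0] by simp

lemma functional_sum: "functional \<phi> \<Longrightarrow> \<phi> (\<Sum>i\<in>I. f i) = (\<Sum>i\<in>I. \<phi> (f i))"
  by (induction I rule: infinite_finite_induct) (auto simp: functional_zero functional_add)

lemma functional_separates:
  fixes T :: "'k::field poly4 set"
  assumes "Vec.subspace T" "x \<notin> T"
  obtains \<phi> where "functional \<phi>" "\<forall>t\<in>T. \<phi> t = 0" "\<phi> x = 1"
proof -
  interpret Fun: vector_space_pair "pscale :: 'k \<Rightarrow> 'k poly4 \<Rightarrow> 'k poly4" "(*)"
    by unfold_locales (auto simp: distrib_left distrib_right)
  obtain B where B: "B \<subseteq> T" "Vec.independent B" "T \<subseteq> Vec.span B"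
    using Vec.basis_exists by metis
  have span: "Vec.span B = T" using B assms(1) by (meson Vec.span_minimal subset_antisym)
  have "Vec.independent (insert x B)"
    using B(2) assms(2) span by (intro Vec.independent_insertI) auto
  then obtain \<phi> where \<phi>: "Vector_Spaces.linear pscale (*) \<phi>" "\<forall>b\<in>insert x B. \<phi> b = (if b = x then 1 else 0)"
    using Fun.linear_independent_extend[of "insert x B" "\<lambda>b. if b = x then 1 else 0"] by blast
  have "\<phi> t = 0" if "t \<in> T" for t
  proof -
    have "\<phi> b = 0" if "b \<in> B" for b using \<phi>(2) that assms(2) B(1) by auto
    then show ?thesis
      using Fun.linear_eq_0_on_span[OF \<phi>(1), of B t] that span by blast
  qed
  moreover have "functional \<phi>"
    using \<phi>(1) by (simp add: Vector_Spaces.linear_iff functional_def)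
  ultimately show thesis using that \<phi> by auto
qed

text \<open>The space of points is the dual of the space of linear forms. This is how a point is
  extracted from an abstract functional.\<close>

lemma functional_eq_ev:
  assumes "functional \<phi>" "N \<in> forms (Suc 0)"
  shows "\<phi> N = ev (\<lambda>v. \<phi> (pvar v)) N"
proof -
  have "\<phi> N = \<phi> (\<Sum>v\<in>UNIV. pscale (lcoeff N v) (pvar v))"
    by (rule arg_cong[where f = \<phi>, OF linear_form_expand[OF assms(2)]])
  then show ?thesis
    unfolding ev_linear_form[OF assms(2)] functional_sum[OF assms(1)] functional_pscale[OF assms(1)] .
qed

lemma point_separates:
  assumes "Vec.subspace T" "T \<subseteq> forms (Suc 0)" "N \<in> forms (Suc 0)" "N \<notin> T"
  obtains p where "\<forall>t\<in>T. ev p t = 0" "ev p N = 1"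
proof -
  obtain \<phi> where "functional \<phi>" "\<forall>t\<in>T. \<phi> t = 0" "\<phi> N = 1"
    using functional_separates[OF assms(1,4)] .
  then show thesis
    using that[of "\<lambda>v. \<phi> (pvar v)"] functional_eq_ev assms(2,3) by (metis subsetD)
qed

lemma linear_form_nonzero_ev:
  assumes "N \<in> forms (Suc 0)" "N \<noteq> 0"
  obtains p where "ev p N = 1"
  using point_separates[of "{0}" N] assms Vec.subspace_single_0 by auto

text \<open>Linear independence of points, witnessed by a dual system of linear forms.\<close>

definition indep_points :: "(nat \<Rightarrow> var4 \<Rightarrow> 'k::field) \<Rightarrow> nat \<Rightarrow> bool" where
  "indep_points p k \<longleftrightarrow> (\<exists>N. \<forall>i<k. N i \<in> forms (Suc 0) \<and> (\<forall>j<k. ev (p j) (N i) = (if i = j then 1 else 0)))"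

lemma indep_points_0: "indep_points p 0"
  by (simp add: indep_points_def)

lemma indep_points_Suc:
  fixes p :: "nat \<Rightarrow> var4 \<Rightarrow> 'k::field"
  assumes "indep_points p k" and not_comb: "\<And>a. p k \<noteq> (\<lambda>v. \<Sum>i<k. a i * p i v)"
  shows "indep_points p (Suc k)"
proof -
  obtain N where N: "\<And>i. i < k \<Longrightarrow> N i \<in> forms (Suc 0)"
      "\<And>i j. i < k \<Longrightarrow> j < k \<Longrightarrow> ev (p j) (N i) = (if i = j then 1 else 0)"
    using assms(1) unfolding indep_points_def by blast
  obtain v where v: "p k v \<noteq> (\<Sum>i<k. ev (p k) (N i) * p i v)"
    using not_comb[of "\<lambda>i. ev (p k) (N i)"] by auto
  \<comment> \<open>The \<open>N i\<close> interpolate the coordinate \<open>v\<close> at the old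
    points, so \<open>M0\<close> vanishes there; the choice of \<open>v\<close> makes it nonzero at
    the new point. Scaling and subtracting it then completes the dual system.\<close>
  define M0 where "M0 = pvar v - (\<Sum>i<k. pscale (p i v) (N i))"
  have M0: "M0 \<in> forms (Suc 0)"
    unfolding M0_def by (intro forms_diff Vec.subspace_sum[OF subspace_forms] forms_pscale) (auto simp: N)
  have M0_low: "ev (p j) M0 = 0" if "j < k" for j
  proof -
    have "(\<Sum>i<k. p i v * ev (p j) (N i)) = (\<Sum>i<k. if i = j then p j v else 0)"
      by (intro sum.cong) (auto simp: N that)
    then show ?thesis using that
      by (simp add: M0_def ev.subst_diff ev.subst_sum ev.subst_pscale)
  qed
  have M0_top: "ev (p k) M0 \<noteq> 0"
    using v by (simp add: M0_def ev.subst_diff ev.subst_sum ev.subst_pscale mult.commute)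
  define M where "M = pscale (inverse (ev (p k) M0)) M0"
  define N' where "N' = (\<lambda>i. if i = k then M else N i - pscale (ev (p k) (N i)) M)"
  have M: "M \<in> forms (Suc 0)" "ev (p k) M = 1" "\<And>j. j < k \<Longrightarrow> ev (p j) M = 0"
    using M0 M0_low M0_top by (auto simp: M_def forms_pscale ev.subst_pscale)
  have "N' i \<in> forms (Suc 0) \<and> (\<forall>j<Suc k. ev (p j) (N' i) = (if i = j then 1 else 0))" if "i < Suc k" for i
    using that M N by (auto simp: N'_def less_Suc_eq forms_diff forms_pscale ev.subst_diff ev.subst_pscale)
  then show ?thesis unfolding indep_points_def by blast
qed

text \<open>Evaluation at \<open>p j\<close> isolates the j-th coefficient of a relation, so the
  four dual forms are independent, and a nonzero form vanishing at all four points would be a fifth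
  independent one.\<close>

lemma indep_points_4:
  assumes "indep_points p 4" "M \<in> forms (Suc 0)" "\<And>i. i < 4 \<Longrightarrow> ev (p i) M = 0"
  shows "M = (0 :: 'k::field poly4)"
proof (rule ccontr)
  assume M0: "M \<noteq> 0"
  obtain N where N: "\<And>i. i < 4 \<Longrightarrow> N i \<in> forms (Suc 0)"
      "\<And>i j. i < 4 \<Longrightarrow> j < 4 \<Longrightarrow> ev (p j) (N i) = (if i = j then 1 else 0)"
    using assms(1) unfolding indep_points_def by blast
  have inj: "inj_on N {..<4}"
  proof
    fix i j :: nat assume ij: "i \<in> {..<4}" "j \<in> {..<4}" "N i = N j"
    have "(if j = i then 1 else 0) = ev (p i) (N j)" using N(2)[of j i] ij(1,2) by simp
    also have "\<dots> = 1" unfolding ij(3)[symmetric] using N(2)[of i i] ij(1) by simp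
    finally show "i = j" by (simp split: if_splits)
  qed
  have indep: "Vec.independent (N ` {..<4})"
  proof (rule Vec.independent_if_scalars_zero)
    fix u x assume 0: "(\<Sum>x\<in>N ` {..<4}. pscale (u x) x) = 0" and "x \<in> N ` {..<4}"
    then obtain j where j: "j < 4" "x = N j" by auto
    have "0 = ev (p j) (\<Sum>x\<in>N ` {..<4}. pscale (u x) x)" using 0 by simp
    also have "\<dots> = (\<Sum>i<4. u (N i) * ev (p j) (N i))"
      by (simp add: ev.subst_sum ev.subst_pscale sum.reindex[OF inj])
    also have "\<dots> = (\<Sum>i<4. if i = j then u (N i) else 0)"
      by (intro sum.cong) (auto simp: N j)
    also have "\<dots> = u x" using j by simp
    finally show "u x = 0" by simp
  qed simp
  have "M \<notin> Vec.span (N ` {..<4})"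
  proof
    assume "M \<in> Vec.span (N ` {..<4})"
    then have "M \<in> range (\<lambda>u. \<Sum>x\<in>N ` {..<4}. pscale (u x) x)"
      by (subst (asm) Vec.span_finite) simp_all
    then obtain u where u: "M = (\<Sum>x\<in>N ` {..<4}. pscale (u x) x)"
      by (rule rangeE)
    have "u (N j) = 0" if j: "j < 4" for j
    proof -
      have "0 = ev (p j) (\<Sum>x\<in>N ` {..<4}. pscale (u x) x)"
        unfolding u[symmetric] assms(3)[OF j] ..
      also have "\<dots> = (\<Sum>i<4. u (N i) * ev (p j) (N i))"
        by (simp add: ev.subst_sum ev.subst_pscale sum.reindex[OF inj])
      also have "\<dots> = (\<Sum>i<4. if i = j then u (N i) else 0)"
        by (intro sum.cong) (auto simp: N j)
      also have "\<dots> = u (N j)" using j by simp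
      finally show ?thesis by simp
    qed
    then have "M = 0" unfolding u by (intro sum.neutral) auto
    then show False using M0 by simp
  qed
  note M_notin = this
  have "M \<notin> N ` {..<4}" using M_notin Vec.span_superset[of "N ` {..<4}"] by (rule contra_subsetD[rotated])
  moreover have "Vec.independent (insert M (N ` {..<4}))"
    by (rule Vec.independent_insertI[OF M_notin indep])
  moreover have "insert M (N ` {..<4}) \<subseteq> forms (Suc 0)" using N assms(2) by auto
  ultimately have "Suc (card (N ` {..<4})) \<le> 4"
    using Vec.independent_card_le_dim_fd(2)[OF fd_forms, of "insert M (N ` {..<4})" "Suc 0"]
    by (simp add: dim_forms_1)
  then show False by (simp add: card_image[OF inj])
qed

text \<open>Polarization: the mixed coefficients are values of the bilinear form
  \<open>q(x + y) - q(x) - q(y)\<close>. No division by 2 occurs, so every characteristic is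
  covered.\<close>

lemma quadric_ev:
  fixes q :: "'k::field poly4"
  assumes "q \<in> forms 2"
  shows "ev (\<lambda>v. a * p v + b * r v + c * s v) q =
    a\<^sup>2 * ev p q + b\<^sup>2 * ev r q + c\<^sup>2 * ev s q
    + a * b * (ev (\<lambda>v. p v + r v) q - ev p q - ev r q)
    + a * c * (ev (\<lambda>v. p v + s v) q - ev p q - ev s q)
    + b * c * (ev (\<lambda>v. r v + s v) q - ev r q - ev s q)" 
proof -
  define E R where "E = ev (\<lambda>v. a * p v + b * r v + c * s v)"
    and "R = (\<lambda>q. a\<^sup>2 * ev p q + b\<^sup>2 * ev r q + c\<^sup>2 * ev s q
    + a * b * (ev (\<lambda>v. p v + r v) q - ev p q - ev r q)
    + a * c * (ev (\<lambda>v. p v + s v) q - ev p q - ev s q)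
    + b * c * (ev (\<lambda>v. r v + s v) q - ev r q - ev s q))"
  have lin: "E (x + y) = E x + E y" "E (pscale e x) = e * E x" "E 0 = 0"
      "R (x + y) = R x + R y" "R (pscale e x) = e * R x" "R 0 = 0" for x y e
    by (simp_all add: E_def R_def ev.subst_add ev.subst_pscale algebra_simps)
  have "forms (Suc (Suc 0)) \<subseteq> {q. E q = R q}"
  proof (rule forms_Suc_subset)
    show "Vec.subspace {q. E q = R q}" by (simp add: Vec.subspace_def lin)
    fix v :: var4 and g :: "'k poly4" assume g: "g \<in> forms (Suc 0)"
    have 3: "ev (\<lambda>v. a * p v + b * r v + c * s v) g = a * ev p g + b * ev r g + c * ev s g"
      using ev_linear_comb[OF g, of 1 "\<lambda>v. a * p v + b * r v" c s] ev_linear_comb[OF g, of a p b r] by simp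
    have 2: "ev (\<lambda>v. x v + y v) g = ev x g + ev y g" for x y
      using ev_linear_comb[OF g, of 1 x 1 y] by simp
    have "E (pvar v * g) = R (pvar v * g)"
      unfolding E_def R_def ev.subst_mult ev.subst_pvar 3
      unfolding 2 by (simp add: power2_eq_square algebra_simps)
    then show "pvar v * g \<in> {q. E q = R q}" by simp
  qed
  then have "E q = R q" using assms by (auto simp: numeral_2_eq_2)
  then show ?thesis unfolding E_def R_def .
qed

section \<open>Multiples of a linear form\<close>

text \<open>\<open>d\<close> is the degree of the product, not of the cofactor. Degree 0 is split
  off because \<open>d - 1\<close> would truncate and admit multiples of degree 1.\<close>

definition lmul :: "'k::field poly4 \<Rightarrow> nat \<Rightarrow> 'k poly4 set" where
  "lmul L d = (case d of 0 \<Rightarrow> {0} | Suc e \<Rightarrow> (*) L ` forms e)"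

lemma lmul_0 [simp]: "lmul L 0 = {0}" and lmul_Suc: "lmul L (Suc e) = (*) L ` forms e"
  by (simp_all add: lmul_def)

lemma subspace_lmul: "Vec.subspace (lmul L d)"
proof (cases d)
  case (Suc e)
  interpret L: Vector_Spaces.linear pscale pscale "(*) L" by (rule linear_mult)
  show ?thesis unfolding Suc lmul_Suc by (rule L.subspace_image[OF subspace_forms])
qed (simp add: Vec.subspace_single_0)

lemma lmul_subset: "L \<in> forms (Suc 0) \<Longrightarrow> lmul L d \<subseteq> forms d"
  by (cases d) (auto simp: lmul_Suc forms_mult_linear)

lemma lmulI: "g \<in> forms d \<Longrightarrow> L * g \<in> lmul L (Suc d)"
  unfolding lmul_Suc by (rule imageI)

lemma mult_lmul: "g \<in> lmul L d \<Longrightarrow> N \<in> forms (Suc 0) \<Longrightarrow> N * g \<in> lmul L (Suc d)"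
  by (cases d) (auto simp: lmul_Suc mult.left_commute[of N] forms_mult_linear)

lemma fd_lmul: "L \<in> forms (Suc 0) \<Longrightarrow> Vec.fd (lmul L d)"
  using Vec.fd_subset[OF fd_forms subspace_lmul lmul_subset] .

lemma dim_lmul:
  fixes L :: "'k::field poly4"
  assumes "L \<noteq> 0"
  shows "Vec.dim (lmul L (Suc d)) = Vec.dim (forms d :: 'k poly4 set)"
  unfolding lmul_Suc
  by (rule Vec.dim_image_inj_fd(2)[OF linear_mult fd_forms]) (use assms in auto)

lemma lsub_pscale: "lsub s (pscale c f) = pscale c (lsub s f)"
  by (simp only: lsub.subst_pscale pscale_conv_mult[of c "lsub s f"])

text \<open>The Nullstellensatz for a hyperplane. Modulo \<open>l\<close>, \<open>f\<close> equals
  its pullback along a projection onto the hyperplane; the pullback vanishes at every point, so over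
  an infinite field it is zero.\<close>

lemma vanishing_imp_lmul:
  fixes f l :: "'k::field poly4"
  assumes inf: "infinite (UNIV :: 'k set)" and l: "l \<in> forms (Suc 0)" "l \<noteq> 0" and f: "f \<in> forms d"
    and van: "\<And>z. ev z l = 0 \<Longrightarrow> ev z f = 0"
  shows "f \<in> lmul l d"
proof -
  obtain p where p: "ev p l = 1" using linear_form_nonzero_ev l by blast
  text \<open>The substitution \<open>s\<close> is the projection along \<open>p\<close> onto the hyperplane \<open>l = 0\<close>.\<close>
  define s where "s = (\<lambda>v. pvar v - pscale (p v) l)"
  have s: "s v \<in> forms (Suc 0)" for v by (simp add: s_def forms_diff forms_pscale l)
  have *: "lsub s f \<in> forms d \<and> f - lsub s f \<in> lmul l d" if "f \<in> forms d" for f d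
    using that
  proof (induction d arbitrary: f)
    case 0
    then show ?case by (auto simp: forms_0 lsub_pscale)
  next
    case (Suc d)
    let ?S = "{f. lsub s f \<in> forms (Suc d) \<and> f - lsub s f \<in> lmul l (Suc d)}"
    have "forms (Suc d) \<subseteq> ?S"
    proof (rule forms_Suc_subset)
      have add: "x + y - (lsub s x + lsub s y) = (x - lsub s x) + (y - lsub s y)" for x y by simp
      show "Vec.subspace ?S"
      proof (rule Vec.subspaceI)
        show "0 \<in> ?S" using Vec.subspace_0[OF subspace_lmul, of l "Suc d"] by simp
        show "x + y \<in> ?S" if "x \<in> ?S" "y \<in> ?S" for x y
          using that Vec.subspace_add[OF subspace_lmul, of "x - lsub s x" l "Suc d" "y - lsub s y"]
          by (simp only: mem_Collect_eq lsub.subst_add add forms_add simp_thms)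
        show "pscale c x \<in> ?S" if "x \<in> ?S" for c x
          using that Vec.subspace_scale[OF subspace_lmul, of "x - lsub s x" l "Suc d" c]
          by (simp only: mem_Collect_eq lsub_pscale Vec.scale_right_diff_distrib forms_pscale simp_thms)
      qed
      fix v :: var4 and g :: "'k poly4" assume g: "g \<in> forms d"
      have IH: "lsub s g \<in> forms d" "g - lsub s g \<in> lmul l d" using Suc.IH[OF g] by auto
      have eq: "pvar v * g - s v * lsub s g = pvar v * (g - lsub s g) + pscale (p v) (l * lsub s g)"
        by (simp add: s_def algebra_simps)
      have "pvar v * g - s v * lsub s g \<in> lmul l (Suc d)"
        unfolding eq using IH
        by (intro Vec.subspace_add[OF subspace_lmul] Vec.subspace_scale[OF subspace_lmul] mult_lmul lmulI)
          auto
      then show "pvar v * g \<in> ?S"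
        using IH s by (simp add: lsub.subst_mult forms_mult_linear)
    qed
    then show ?case using Suc.prems by auto
  qed
  have "lsub s f = 0"
  proof (rule ccontr)
    assume "lsub s f \<noteq> 0"
    then obtain z where z: "ev z (lsub s f) \<noteq> 0" using exists_ev_nonzero[OF inf] by blast
    define z' where "z' = (\<lambda>v. ev z (s v))"
    have z': "z' = (\<lambda>v. 1 * z v + (- ev z l) * p v)"
      by (auto simp: z'_def s_def ev.subst_diff ev.subst_pscale)
    have "ev z' l = 0"
      unfolding z' ev_linear_comb[OF l(1)] using p by simp
    then have "ev z' f = 0" by (rule van)
    then show False using z by (simp add: ev_lsub z'_def)
  qed
  then show ?thesis using *[OF f] by simp
qed

section \<open>Generic linear forms\<close>

text \<open>The complement of a thin set is where a general linear form is taken. Covering by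
  subspaces, rather than being one, lets arbitrary sets of bad forms qualify and keeps the notion
  closed under finite unions.\<close>

definition thin :: "'k::field poly4 set \<Rightarrow> bool" where
  "thin S \<longleftrightarrow> (\<exists>F. finite F \<and> (\<forall>H\<in>F. Vec.subspace H \<and> H \<subset> forms (Suc 0)) \<and> S \<inter> forms (Suc 0) \<subseteq> \<Union>F)"

lemma thin_subset: "thin T \<Longrightarrow> S \<inter> forms (Suc 0) \<subseteq> T \<Longrightarrow> thin S"
  unfolding thin_def by (meson Int_lower2 le_infI subset_trans)

lemma thin_Un: "thin S \<Longrightarrow> thin T \<Longrightarrow> thin (S \<union> T)"
  unfolding thin_def
proof (elim exE conjE)
  fix F G :: "'a poly4 set set"
  assume "finite F" "\<forall>H\<in>F. Vec.subspace H \<and> H \<subset> forms (Suc 0)" "S \<inter> forms (Suc 0) \<subseteq> \<Union>F"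
    "finite G" "\<forall>H\<in>G. Vec.subspace H \<and> H \<subset> forms (Suc 0)" "T \<inter> forms (Suc 0) \<subseteq> \<Union>G"
  then show "\<exists>F. finite F \<and> (\<forall>H\<in>F. Vec.subspace H \<and> H \<subset> forms (Suc 0)) \<and> (S \<union> T) \<inter> forms (Suc 0) \<subseteq> \<Union>F"
    by (intro exI[of _ "F \<union> G"]) auto
qed

lemma thin_empty [simp]: "thin {}"
  unfolding thin_def by (intro exI[of _ "{}"]) auto

lemma thin_UN: "finite A \<Longrightarrow> (\<And>a. a \<in> A \<Longrightarrow> thin (S a)) \<Longrightarrow> thin (\<Union>a\<in>A. S a)"
  by (induction A rule: finite_induct) (auto intro: thin_Un)

lemma thin_subspace: "Vec.subspace H \<Longrightarrow> H \<subset> forms (Suc 0) \<Longrightarrow> thin H"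
  unfolding thin_def by (intro exI[of _ "{H}"]) auto

lemma thin_small_subspace:
  fixes H :: "'k::field poly4 set"
  assumes "Vec.subspace H" "H \<subseteq> forms (Suc 0)" "Vec.dim H < 4"
  shows "thin H"
  using assms by (intro thin_subspace) (auto simp: dim_forms_1)

lemma thin_span:
  assumes "finite A" "card A < 4" "A \<subseteq> forms (Suc 0)"
  shows "thin (Vec.span A)"
proof (rule thin_small_subspace)
  show "Vec.span A \<subseteq> forms (Suc 0)" by (rule Vec.span_minimal[OF assms(3) subspace_forms])
  show "Vec.dim (Vec.span A) < 4" using Vec.dim_le_card[of "Vec.span A" A] assms by simp
qed simp

lemma thin_zero: "thin {0}"
  using thin_span[of "{}"] by simp

lemma thin_vanishing:
  assumes "p \<noteq> (\<lambda>_. 0)"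
  shows "thin {N \<in> forms (Suc 0). ev p N = 0}"
proof (rule thin_subspace)
  show "Vec.subspace {N \<in> forms (Suc 0). ev p N = 0}"
    by (auto simp: Vec.subspace_def forms_add forms_pscale ev.subst_add ev.subst_pscale)
  obtain v where "p v \<noteq> 0" using assms by auto
  then show "{N \<in> forms (Suc 0). ev p N = 0} \<subset> forms (Suc 0)"
    using pvar_in_forms[of v] ev.subst_pvar[of p v] by (metis (mono_tags, lifting) mem_Collect_eq psubsetI subsetI)
qed

lemma not_thin_obtain:
  assumes "\<not> thin S" "thin B"
  obtains L where "L \<in> S" "L \<in> forms (Suc 0)" "L \<notin> B"
  using assms thin_subset[of B S] by blast

text \<open>A vector space over an infinite field is no finite union of proper subspaces: with
  \<open>x\<close> in \<open>H\<close> but in no member of \<open>F\<close>, and \<open>y\<close>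
  outside \<open>H\<close>, the line \<open>y + s * x\<close> misses \<open>H\<close> and meets each
  member of \<open>F\<close> at most once.\<close>

lemma not_thin_forms:
  assumes inf: "infinite (UNIV :: 'k set)"
  shows "\<not> thin (forms (Suc 0) :: 'k::field poly4 set)"
proof
  assume "thin (forms (Suc 0) :: 'k poly4 set)"
  then obtain F where F: "finite F" "\<forall>H\<in>F. Vec.subspace H \<and> H \<subset> (forms (Suc 0) :: 'k poly4 set)"
      "forms (Suc 0) \<subseteq> \<Union>F"
    unfolding thin_def by auto
  have "\<exists>x\<in>forms (Suc 0). x \<notin> \<Union>F" using F(1,2)
  proof (induction F rule: finite_induct)
    case empty
    then show ?case by (auto intro: forms_zero)
  next
    case (insert H F)
    then obtain x where x: "x \<in> forms (Suc 0)" "x \<notin> \<Union>F" by auto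
    show ?case
    proof (cases "x \<in> H")
      case False
      then show ?thesis using x by auto
    next
      case True
      have H: "Vec.subspace H" "H \<subset> forms (Suc 0)" using insert.prems by auto
      then obtain y where y: "y \<in> forms (Suc 0)" "y \<notin> H" by auto
      have one: "finite {s. y + pscale s x \<in> G}" if "G \<in> F" for G
      proof (rule ccontr)
        assume inf': "infinite {s. y + pscale s x \<in> G}"
        obtain s where s: "y + pscale s x \<in> G" using infinite_imp_nonempty[OF inf'] by blast
        obtain t where "t \<in> {s. y + pscale s x \<in> G} - {s}"
          using infinite_imp_nonempty[OF infinite_remove[OF inf', of s]] by blast
        then have st: "s \<noteq> t" "y + pscale s x \<in> G" "y + pscale t x \<in> G" using s by auto
        have G: "Vec.subspace G" using insert.prems that by auto
        have "pscale (inverse (s - t)) ((y + pscale s x) - (y + pscale t x)) \<in> G"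
          using st G by (intro Vec.subspace_scale Vec.subspace_diff)
        also have "pscale (inverse (s - t)) ((y + pscale s x) - (y + pscale t x)) = x"
          using st by (simp flip: Vec.scale_left_diff_distrib)
        finally show False using x that by auto
      qed
      have "finite (\<Union>G\<in>F. {s. y + pscale s x \<in> G})" using insert.hyps one by auto
      then obtain s where s: "s \<notin> (\<Union>G\<in>F. {s. y + pscale s x \<in> G})"
        using inf ex_new_if_finite by blast
      have "y + pscale s x \<notin> H"
      proof
        assume "y + pscale s x \<in> H"
        then have "(y + pscale s x) - pscale s x \<in> H"
          using H True by (intro Vec.subspace_diff Vec.subspace_scale)
        then show False using y by simp
      qed
      then show ?thesis
        using s x y by (intro bexI[of _ "y + pscale s x"]) (auto intro: forms_add forms_pscale)
    qed
  qed
  then show False using F(3) by auto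
qed

lemma thin_obtain:
  fixes B :: "'k::field poly4 set"
  assumes "infinite (UNIV :: 'k set)" "thin B"
  obtains L where "L \<in> forms (Suc 0)" "L \<notin> B"
  using not_thin_obtain[OF not_thin_forms[OF assms(1)] assms(2)] by metis

text \<open>For a bad form \<open>L\<close> the colon space \<open>V : L\<close> has codimension less than \<open>d\<close> in degree \<open>d - 1\<close>, so
  by induction \<open>V : L\<close> and the multiples of a generic \<open>M\<close> span that degree, which puts \<open>V + L R\<close> inside
  \<open>V + M R\<close>. If \<open>L\<close> is bad with \<open>V + L R\<close> of maximal dimension, this space therefore contains all
  multiples of generic bad forms \<open>M\<close>; were these not thin, they would generate everything.\<close>

lemma thin_bad_forms:
  fixes V :: "'k::field poly4 set"
  assumes "Vec.subspace V" "V \<subseteq> forms d" "r \<ge> 1" "Vec.dim (forms d :: 'k poly4 set) < Vec.dim V + d + r"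
  shows "thin {L \<in> forms (Suc 0). Vec.dim (Vec.vsum V (lmul L d)) + r \<le> Vec.dim (forms d :: 'k poly4 set)}"
  using assms
proof (induction d arbitrary: V r)
  case 0
  have "Vec.vsum V {0} = V" by (auto simp: Vec.vsum_def)
  then have "{L \<in> forms (Suc 0). Vec.dim (Vec.vsum V (lmul L 0)) + r \<le> Vec.dim (forms 0 :: 'k poly4 set)} = {}"
    using 0 by auto
  then show ?case using thin_empty by (simp only:)
next
  case (Suc d)
  let ?R = "\<lambda>i. forms i :: 'k poly4 set"
  define B where "B = {L \<in> ?R (Suc 0). Vec.dim (Vec.vsum V (lmul L (Suc d))) + r \<le> Vec.dim (?R (Suc d))}"
  define D where "D = (\<lambda>L. Vec.dim (Vec.vsum V (lmul L (Suc d))))"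
  have fdV: "Vec.fd V" using Vec.fd_subset[OF fd_forms Suc.prems(1,2)] .
  show ?case
  proof (rule ccontr, fold B_def)
    assume nB: "\<not> thin B"
    obtain L0 where L0: "L0 \<in> B" "L0 \<notin> {0}" using not_thin_obtain[OF nB thin_zero] by blast
    have bd: "\<forall>L. L \<in> B - {0} \<longrightarrow> D L < Suc (Vec.dim (?R (Suc d)))"
      by (auto simp: B_def D_def)
    have "\<exists>L. L \<in> B - {0} \<and> (\<forall>M. M \<in> B - {0} \<longrightarrow> D M \<le> D L)"
      by (rule ex_has_greatest_nat[OF _ bd, of L0]) (use L0 in auto)
    then obtain L where L: "L \<in> B - {0}" and Lmax: "\<And>M. M \<in> B - {0} \<Longrightarrow> D M \<le> D L"
      by blast
    have LR: "L \<in> ?R (Suc 0)" "L \<noteq> 0" using L by (auto simp: B_def)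
    define C where "C = {g \<in> ?R d. L * g \<in> V}"
    define U where "U = Vec.vsum V (lmul L (Suc d))"
    have subC: "Vec.subspace C"
      using Suc.prems(1) by (auto simp: C_def Vec.subspace_def forms_add forms_pscale distrib_left)
    have fdU: "Vec.fd U" unfolding U_def by (intro Vec.fd_vsum fdV fd_lmul LR)
    have UR: "U \<subseteq> ?R (Suc d)"
      unfolding U_def by (intro Vec.vsum_least subspace_forms Suc.prems lmul_subset LR)
    have "V \<inter> lmul L (Suc d) = (*) L ` C" by (auto simp: lmul_Suc C_def)
    moreover have "Vec.dim ((*) L ` C) = Vec.dim C"
      by (rule Vec.dim_image_inj_fd(2)[OF linear_mult Vec.fd_subset[OF fd_forms subC]])
        (use LR in \<open>auto simp: C_def\<close>)
    ultimately have dimC: "Vec.dim U + Vec.dim C = Vec.dim V + Vec.dim (?R d)"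
      using Vec.dim_vsum_Int[OF fdV fd_lmul[OF LR(1)], of "Suc d"] dim_lmul[OF LR(2), of d]
      by (simp add: U_def)
    have "Vec.dim U + r \<le> Vec.dim (?R (Suc d))" using L by (auto simp: B_def U_def)
    \<comment> \<open>By \<open>dimC\<close> the codimension of \<open>C\<close> is that of
      \<open>V\<close> minus that of \<open>U\<close>, hence below \<open>Suc d + r - r\<close>;
      this is the hypothesis of the induction with \<open>r = 1\<close>.\<close>
    then have "Vec.dim (?R d) < Vec.dim C + d + 1" using dimC Suc.prems(4) by simp
    then have thinT: "thin {M \<in> ?R (Suc 0). Vec.dim (Vec.vsum C (lmul M d)) + 1 \<le> Vec.dim (?R d)}"
      using Suc.IH[OF subC, of 1] by (auto simp: C_def)
    define H where "H = {M \<in> ?R (Suc 0). \<forall>g\<in>?R d. M * g \<in> U}"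
    have subU: "Vec.subspace U" using fdU Vec.fd_subspace by blast
    have "Vec.subspace H"
      using subU by (auto simp: H_def Vec.subspace_def forms_add forms_pscale distrib_right)
    moreover have "H \<subset> ?R (Suc 0)"
    proof -
      have "H \<noteq> ?R (Suc 0)"
      proof
        assume HR: "H = ?R (Suc 0)"
        have "?R (Suc d) \<subseteq> U"
        proof (rule forms_Suc_subset[OF subU])
          fix v :: var4 and g :: "'k poly4" assume "g \<in> forms d"
          moreover have "pvar v \<in> H" using HR by simp
          ultimately show "pvar v * g \<in> U" by (auto simp: H_def)
        qed
        then have "Vec.dim (?R (Suc d)) \<le> Vec.dim U" by (rule Vec.dim_mono_fd[OF fdU])
        then show False using \<open>Vec.dim U + r \<le> Vec.dim (?R (Suc d))\<close> Suc.prems(3) by simp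
      qed
      then show ?thesis by (auto simp: H_def)
    qed
    ultimately have "thin H" by (rule thin_subspace)
    then obtain M where M: "M \<in> B" "M \<in> ?R (Suc 0)" "M \<noteq> 0" "M \<notin> H"
        "\<not> Vec.dim (Vec.vsum C (lmul M d)) + 1 \<le> Vec.dim (?R d)"
      using not_thin_obtain[OF nB thin_Un[OF thin_zero thin_Un[OF thinT \<open>thin H\<close>]]] by blast
    have "Vec.vsum C (lmul M d) = ?R d"
    proof (rule Vec.subspace_eq_if_dim_le[OF fd_forms])
      show "Vec.subspace (Vec.vsum C (lmul M d))" by (intro Vec.subspace_vsum subC subspace_lmul)
      show "Vec.vsum C (lmul M d) \<subseteq> ?R d"
        by (intro Vec.vsum_least subspace_forms lmul_subset M) (auto simp: C_def)
    qed (use M in auto)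
    define U' where "U' = Vec.vsum V (lmul M (Suc d))"
    have fdU': "Vec.fd U'" unfolding U'_def by (intro Vec.fd_vsum fdV fd_lmul M)
    have subU': "Vec.subspace U'" using fdU' Vec.fd_subspace by blast
    have VU': "V \<subseteq> U'" unfolding U'_def by (intro Vec.vsum_left subspace_lmul)
    have MU': "lmul M (Suc d) \<subseteq> U'" unfolding U'_def by (intro Vec.vsum_right Suc.prems)
    have "lmul L (Suc d) \<subseteq> U'"
    proof
      fix x assume "x \<in> lmul L (Suc d)"
      then obtain g where g: "g \<in> ?R d" "x = L * g" by (auto simp: lmul_Suc)
      have "g \<in> Vec.vsum C (lmul M d)" using g \<open>Vec.vsum C (lmul M d) = ?R d\<close> by simp
      then obtain c m where cm: "c \<in> C" "m \<in> lmul M d" "g = c + m"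
        by (rule Vec.vsumE)
      have "L * c \<in> U'" using cm VU' by (auto simp: C_def)
      moreover have "L * m \<in> U'" using mult_lmul[OF cm(2) LR(1)] MU' by auto
      ultimately show "x \<in> U'" using g cm Vec.subspace_add[OF subU'] by (simp add: distrib_left)
    qed
    then have "U \<subseteq> U'" unfolding U_def by (intro Vec.vsum_least subU' VU')
    moreover have "Vec.dim U' \<le> Vec.dim U"
      using Lmax[of M] M by (simp add: D_def U_def U'_def)
    ultimately have "U = U'" using Vec.subspace_eq_if_dim_le[OF fdU' subU] by blast
    then show False using MU' M lmulI[of _ d M] by (auto simp: H_def)
  qed
qed

text \<open>Modulo \<open>S\<close>, the multiples of \<open>M\<close> come from a complement of
  \<open>U\<close>. In particular, if multiplication by \<open>M\<close> from R_d/U to R_{d+1}/S is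
  onto, the codimension does not grow.\<close>

lemma dim_vsum_lmul_le:
  fixes U S :: "'k::field poly4 set"
  assumes "Vec.subspace U" "U \<subseteq> forms d" "Vec.subspace S" "S \<subseteq> forms (Suc d)"
    and M: "M \<in> forms (Suc 0)" and MU: "\<And>u. u \<in> U \<Longrightarrow> M * u \<in> S"
  shows "Vec.dim (Vec.vsum S (lmul M (Suc d))) + Vec.dim U \<le> Vec.dim S + Vec.dim (forms d :: 'k poly4 set)"
proof -
  obtain C where C: "Vec.fd C" "C \<subseteq> forms d" "Vec.vsum U C = forms d"
      "Vec.dim (forms d :: 'k poly4 set) = Vec.dim U + Vec.dim C"
    by (rule Vec.complement_exists[OF fd_forms assms(1,2)])
  interpret M: Vector_Spaces.linear pscale pscale "(*) M" by (rule linear_mult)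
  have fdS: "Vec.fd S" using Vec.fd_subset[OF fd_forms assms(3,4)] .
  obtain B where B: "finite B" "Vec.span B = C" "card B = Vec.dim C"
    by (rule Vec.fd_basis[OF C(1)])
  have img: "(*) M ` C = Vec.span ((*) M ` B)" unfolding B(2)[symmetric] M.span_image ..
  have fdMC: "Vec.fd ((*) M ` C)" unfolding img by (rule Vec.fdI_span) (simp add: B(1))
  have "Vec.dim ((*) M ` C) \<le> card ((*) M ` B)"
    unfolding img by (rule Vec.dim_le_card) (simp_all add: B(1))
  also have "\<dots> \<le> Vec.dim C" using card_image_le[OF B(1), of "(*) M"] B(3) by simp
  finally have dimMC: "Vec.dim ((*) M ` C) \<le> Vec.dim C" .
  have "Vec.vsum S (lmul M (Suc d)) \<subseteq> Vec.vsum S ((*) M ` C)"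
  proof (rule Vec.vsum_least)
    show sub: "Vec.subspace (Vec.vsum S ((*) M ` C))"
      by (rule Vec.fd_subspace[OF Vec.fd_vsum[OF fdS fdMC]])
    show S: "S \<subseteq> Vec.vsum S ((*) M ` C)" by (rule Vec.vsum_left[OF Vec.fd_subspace[OF fdMC]])
    show "lmul M (Suc d) \<subseteq> Vec.vsum S ((*) M ` C)"
    proof
      fix x assume "x \<in> lmul M (Suc d)"
      then obtain g where g: "g \<in> forms d" "x = M * g" by (auto simp: lmul_Suc)
      have "g \<in> Vec.vsum U C" using g C(3) by simp
      then obtain u c where uc: "u \<in> U" "c \<in> C" "g = u + c" by (rule Vec.vsumE)
      have "M * u + M * c \<in> Vec.vsum S ((*) M ` C)" using MU[OF uc(1)] uc(2) by (intro Vec.vsumI) auto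
      then show "x \<in> Vec.vsum S ((*) M ` C)" unfolding g(2) uc(3) distrib_left .
    qed
  qed
  then have "Vec.dim (Vec.vsum S (lmul M (Suc d))) \<le> Vec.dim (Vec.vsum S ((*) M ` C))"
    by (rule Vec.dim_mono_fd[OF Vec.fd_vsum[OF fdS fdMC]])
  also have "\<dots> \<le> Vec.dim S + Vec.dim ((*) M ` C)" by (rule Vec.dim_vsum_le[OF fdS fdMC])
  finally show ?thesis using dimMC C(4) by simp
qed

section \<open>Graded Gorenstein duality\<close>

text \<open>With A = R/I, \<open>duality\<close> is nondegeneracy of the pairing of A_i and A_{j-i}
  into A_j, and \<open>\<phi>\<close> identifies A_j with the field. The socle enters the argument
  only in this form.\<close>

locale graded_gorenstein =
  fixes I :: "'k::field poly4 set" and j :: nat and \<phi> :: "'k poly4 \<Rightarrow> 'k"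
  assumes zero_I: "0 \<in> I" and add_I: "p \<in> I \<Longrightarrow> q \<in> I \<Longrightarrow> p + q \<in> I"
    and mult_I: "p \<in> I \<Longrightarrow> f * p \<in> I"
    and duality: "f \<in> forms i \<Longrightarrow> i + n = j \<Longrightarrow> (\<And>g. g \<in> forms n \<Longrightarrow> f * g \<in> I) \<Longrightarrow> f \<in> I"
    and functional_top: "functional \<phi>" and top_iff: "f \<in> forms j \<Longrightarrow> \<phi> f = 0 \<longleftrightarrow> f \<in> I"
    and infinite_field: "infinite (UNIV :: 'k set)"
begin

abbreviation R :: "nat \<Rightarrow> 'k poly4 set" where "R \<equiv> forms"

abbreviation Id :: "nat \<Rightarrow> 'k poly4 set" where "Id i \<equiv> I \<inter> R i"

lemma subspace_I: "Vec.subspace I"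
  by (auto simp: Vec.subspace_def zero_I add_I pscale_conv_mult mult_I)

lemma subspace_Id: "Vec.subspace (Id i)"
  by (intro Vec.subspace_inter subspace_I subspace_forms)

lemma fd_Id: "Vec.fd (Id i)"
  by (rule Vec.fd_subset[OF fd_forms subspace_Id]) auto

lemma dim_Id_le: "Vec.dim (Id i) \<le> Vec.dim (R i)"
  by (rule Vec.dim_mono_fd[OF fd_forms]) auto

definition hdim :: "nat \<Rightarrow> nat" where
  "hdim i = Vec.dim (R i) - Vec.dim (Id i)"

definition colon :: "'k poly4 \<Rightarrow> nat \<Rightarrow> 'k poly4 set" where
  "colon F e = {f \<in> R e. F * f \<in> I}"

lemma subspace_colon: "Vec.subspace (colon F e)"
  using subspace_I subspace_forms
  by (auto simp: colon_def Vec.subspace_def distrib_left)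

lemma colon_subset: "colon F e \<subseteq> R e"
  by (auto simp: colon_def)

text \<open>The pairing \<open>(f, g) \<mapsto> \<phi> (F * f * g)\<close> has left kernel \<open>colon F e\<close> and right kernel
  \<open>colon F e'\<close>; this is the inequality between row rank and column rank.\<close>

lemma rank_le:
  assumes F: "F \<in> R d" and deg: "d + e + e' = j"
  shows "Vec.dim (R e) + Vec.dim (colon F e') \<le> Vec.dim (R e') + Vec.dim (colon F e)"
proof -
  obtain C where C: "Vec.fd C" "C \<subseteq> R e'" "Vec.vsum (colon F e') C = R e'"
      "Vec.dim (R e') = Vec.dim (colon F e') + Vec.dim C"
    by (rule Vec.complement_exists[OF fd_forms subspace_colon colon_subset])
  obtain B where B: "B \<subseteq> C" "finite B" "Vec.span B = C" "card B = Vec.dim C"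
    by (rule Vec.fd_basis[OF C(1)])
  have add: "\<phi> (F * (x + y) * b) = \<phi> (F * x * b) + \<phi> (F * y * b)" for x y b
    by (simp add: algebra_simps functional_add[OF functional_top])
  have scl: "\<phi> (F * pscale c x * b) = c * \<phi> (F * x * b)" for c x b
    by (simp add: functional_pscale[OF functional_top])
  \<comment> \<open>Pairing to zero with the basis \<open>B\<close> of a complement suffices, since
    \<open>colon F e'\<close> pairs to zero with everything. So \<open>dim C\<close> linear
    conditions already force \<open>f\<close> into \<open>colon F e\<close>.\<close>
  have "{f \<in> R e. \<forall>b\<in>B. \<phi> (F * f * b) = 0} \<subseteq> colon F e"
  proof
    fix f assume "f \<in> {f \<in> R e. \<forall>b\<in>B. \<phi> (F * f * b) = 0}"
    then have f: "f \<in> R e" "\<And>b. b \<in> B \<Longrightarrow> \<phi> (F * f * b) = 0" by auto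
    let ?S = "{g. \<phi> (F * f * g) = 0}"
    have S: "Vec.subspace ?S"
      using functional_add[OF functional_top] functional_pscale[OF functional_top]
        functional_zero[OF functional_top]
      by (auto simp: Vec.subspace_def distrib_left)
    have "C \<subseteq> ?S" using Vec.span_minimal[of B ?S] S f(2) B(3) by auto
    moreover have "colon F e' \<subseteq> ?S"
    proof
      fix g assume g: "g \<in> colon F e'"
      then have "F * f * g \<in> I" using mult_I[of "F * g" f] by (simp add: colon_def mult_ac)
      moreover have "F * f * g \<in> R j"
        using forms_mult[OF forms_mult[OF F f(1)], of g e'] g deg by (simp add: colon_def)
      ultimately show "g \<in> ?S" using top_iff by simp
    qed
    ultimately have "R e' \<subseteq> ?S" using Vec.vsum_least[OF S] C(3) by metis
    then have "F * f * g \<in> I" if "g \<in> R e'" for g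
      using top_iff[of "F * f * g"] forms_mult[OF forms_mult[OF F f(1)] that] deg that by auto
    then have "F * f \<in> I" using duality[OF forms_mult[OF F f(1)], of e'] deg by simp
    then show "f \<in> colon F e" using f by (simp add: colon_def)
  qed
  then have "Vec.dim {f \<in> R e. \<forall>b\<in>B. \<phi> (F * f * b) = 0} \<le> Vec.dim (colon F e)"
    by (rule Vec.dim_mono_fd[OF Vec.fd_subset[OF fd_forms subspace_colon colon_subset]])
  then show ?thesis
    using Vec.dim_kernel_functionals(2)[OF fd_forms B(2), of "\<lambda>b f. \<phi> (F * f * b)" e]
      add scl B(4) C(4) by simp
qed

lemma rank_eq:
  assumes "F \<in> R d" "d + e + e' = j"
  shows "Vec.dim (R e) + Vec.dim (colon F e') = Vec.dim (R e') + Vec.dim (colon F e)"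
  using rank_le[OF assms] rank_le[OF assms(1), of e' e] assms(2) by simp

text \<open>The rank identity for \<open>F = 1\<close>, where both kernels are the graded pieces of
  I.\<close>

lemma hdim_symmetric:
  assumes "e + e' = j"
  shows "hdim e = hdim e'"
proof -
  have "colon 1 i = Id i" for i by (auto simp: colon_def)
  then show ?thesis
    using rank_eq[OF one_in_forms, of e e'] assms dim_Id_le[of e] dim_Id_le[of e']
    by (simp add: hdim_def)
qed

subsection \<open>Hyperplane sections\<close>

text \<open>The degree \<open>i\<close> part of I + (L). Its codimension \<open>cdim L i\<close> is
  the value c_i of the Hilbert function of A/LA.\<close>

definition sect :: "'k poly4 \<Rightarrow> nat \<Rightarrow> 'k poly4 set" where
  "sect L i = Vec.vsum (Id i) (lmul L i)"

definition cdim :: "'k poly4 \<Rightarrow> nat \<Rightarrow> nat" where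
  "cdim L i = Vec.dim (R i) - Vec.dim (sect L i)"

lemma subspace_sect: "Vec.subspace (sect L i)"
  unfolding sect_def by (intro Vec.subspace_vsum subspace_Id subspace_lmul)

lemma sect_subset: "L \<in> R (Suc 0) \<Longrightarrow> sect L i \<subseteq> R i"
  unfolding sect_def by (intro Vec.vsum_least subspace_forms lmul_subset) auto

lemma fd_sect: "L \<in> R (Suc 0) \<Longrightarrow> Vec.fd (sect L i)"
  by (rule Vec.fd_subset[OF fd_forms subspace_sect sect_subset])

lemma dim_sect_le: "L \<in> R (Suc 0) \<Longrightarrow> Vec.dim (sect L i) \<le> Vec.dim (R i)"
  by (rule Vec.dim_mono_fd[OF fd_forms sect_subset])

lemma Id_subset_sect: "Id i \<subseteq> sect L i"
  unfolding sect_def by (rule Vec.vsum_left[OF subspace_lmul])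

lemma lmul_subset_sect: "lmul L i \<subseteq> sect L i"
  unfolding sect_def by (rule Vec.vsum_right[OF subspace_Id])

lemma mult_sect:
  assumes "N \<in> R (Suc 0)" "u \<in> sect L i"
  shows "N * u \<in> sect L (Suc i)"
proof -
  obtain x y where xy: "x \<in> Id i" "y \<in> lmul L i" "u = x + y"
    using assms(2) unfolding sect_def by (rule Vec.vsumE)
  have "N * x + N * y \<in> sect L (Suc i)"
    unfolding sect_def
    using xy mult_I forms_mult_linear[OF assms(1)] mult_lmul[OF xy(2) assms(1)] by (intro Vec.vsumI) auto
  then show ?thesis using xy by (simp add: distrib_left)
qed

lemma dim_sect:
  assumes "L \<in> R (Suc 0)" "L \<noteq> 0"
  shows "Vec.dim (sect L (Suc e)) + Vec.dim (colon L e) = Vec.dim (Id (Suc e)) + Vec.dim (R e)"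
proof -
  have "Id (Suc e) \<inter> lmul L (Suc e) = (*) L ` colon L e"
    using forms_mult_linear[OF assms(1)] by (auto simp: lmul_Suc colon_def)
  moreover have "Vec.dim ((*) L ` colon L e) = Vec.dim (colon L e)"
    by (rule Vec.dim_image_inj_fd(2)[OF linear_mult Vec.fd_subset[OF fd_forms subspace_colon colon_subset]])
      (use assms in auto)
  ultimately show ?thesis
    using Vec.dim_vsum_Int[OF fd_Id fd_lmul[OF assms(1)], of "Suc e" "Suc e"] dim_lmul[OF assms(2), of e]
    by (simp add: sect_def)
qed

text \<open>Multiplication by \<open>L\<close> out of degree \<open>e\<close> and out of degree
  \<open>e'\<close> are transposes of each other under the pairing, hence of equal rank. Their
  cokernels have the dimensions \<open>cdim\<close>, and the targets have dimensions
  \<open>hdim (Suc e)\<close> and \<open>hdim (Suc e') = hdim e\<close>.\<close>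

lemma hdim_diff:
  assumes L: "L \<in> R (Suc 0)" "L \<noteq> 0" and deg: "e + e' + 1 = j"
  shows "int (hdim (Suc e)) - int (hdim e) = int (cdim L (Suc e)) - int (cdim L (Suc e'))"
proof -
  have "hdim e = hdim (Suc e')" using hdim_symmetric[of e "Suc e'"] deg by simp
  then show ?thesis
    using rank_eq[OF L(1), of e e'] dim_sect[OF L, of e] dim_sect[OF L, of e'] deg
      dim_Id_le[of "Suc e"] dim_Id_le[of "Suc e'"] dim_sect_le[OF L(1), of "Suc e"]
      dim_sect_le[OF L(1), of "Suc e'"]
    by (simp add: hdim_def cdim_def)
qed

text \<open>Codimension at most \<open>i\<close> is what \<open>thin_bad_forms\<close> needs with
  \<open>r = 1\<close>: some \<open>M\<close> together with I and \<open>L\<close> fills degree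
  \<open>i\<close>. Multiplying by variables fills degree \<open>i + 1\<close> too, so
  \<open>M\<close> maps degree \<open>i\<close> of A/LA onto degree \<open>i + 1\<close>.\<close>

lemma cdim_antimono_step:
  assumes L: "L \<in> R (Suc 0)" and c: "cdim L i \<le> i"
  shows "cdim L (Suc i) \<le> cdim L i"
proof -
  have "thin {M \<in> R (Suc 0). Vec.dim (Vec.vsum (sect L i) (lmul M i)) + 1 \<le> Vec.dim (R i)}"
    by (rule thin_bad_forms[OF subspace_sect sect_subset[OF L]]) (use c in \<open>simp_all add: cdim_def\<close>)
  then obtain M where M: "M \<in> R (Suc 0)"
      "M \<notin> {M \<in> R (Suc 0). Vec.dim (Vec.vsum (sect L i) (lmul M i)) + 1 \<le> Vec.dim (R i)}"
    by (rule thin_obtain[OF infinite_field])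
  have full: "Vec.vsum (sect L i) (lmul M i) = R i"
  proof (rule Vec.subspace_eq_if_dim_le[OF fd_forms])
    show "Vec.subspace (Vec.vsum (sect L i) (lmul M i))"
      by (intro Vec.subspace_vsum subspace_sect subspace_lmul)
    show "Vec.vsum (sect L i) (lmul M i) \<subseteq> R i"
      by (intro Vec.vsum_least subspace_forms sect_subset L lmul_subset M)
    show "Vec.dim (R i) \<le> Vec.dim (Vec.vsum (sect L i) (lmul M i))" using M by auto
  qed
  let ?U = "Vec.vsum (sect L (Suc i)) (lmul M (Suc i))"
  have U: "Vec.subspace ?U" by (intro Vec.subspace_vsum subspace_sect subspace_lmul)
  have "R (Suc i) \<subseteq> ?U"
  proof (rule forms_Suc_subset[OF U])
    fix v :: var4 and g assume "g \<in> R i"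
    then have "g \<in> Vec.vsum (sect L i) (lmul M i)" using full by simp
    then obtain u m where um: "u \<in> sect L i" "m \<in> lmul M i" "g = u + m" by (rule Vec.vsumE)
    have "pvar v * u + pvar v * m \<in> ?U"
      by (rule Vec.vsumI[OF mult_sect[OF pvar_in_forms um(1)] mult_lmul[OF um(2) pvar_in_forms]])
    then show "pvar v * g \<in> ?U" unfolding um(3) distrib_left .
  qed
  then have "Vec.dim (R (Suc i)) \<le> Vec.dim ?U"
    by (rule Vec.dim_mono_fd[OF Vec.fd_vsum[OF fd_sect[OF L] fd_lmul[OF M(1)]]])
  moreover have "Vec.dim ?U + Vec.dim (sect L i) \<le> Vec.dim (sect L (Suc i)) + Vec.dim (R i)"
    by (rule dim_vsum_lmul_le[OF subspace_sect sect_subset[OF L] subspace_sect sect_subset[OF L] M(1)])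
      (rule mult_sect[OF M(1)])
  ultimately show ?thesis by (simp add: cdim_def)
qed

lemma cdim_le:
  assumes L: "L \<in> R (Suc 0)" and c: "cdim L a \<le> a" and "a \<le> i"
  shows "cdim L i \<le> a"
  using assms(3)
proof (induction i rule: dec_induct)
  case (step i)
  then show ?case using cdim_antimono_step[OF L, of i] by simp
qed (rule c)

lemma cdim_antimono:
  assumes L: "L \<in> R (Suc 0)" and c: "cdim L a \<le> a" and "a \<le> i" "i \<le> i'"
  shows "cdim L i' \<le> cdim L i"
  using assms(4)
proof (induction i' rule: dec_induct)
  case (step n)
  have "cdim L n \<le> n" using cdim_le[OF L c, of n] step assms(3) by simp
  then show ?case using cdim_antimono_step[OF L, of n] step by simp
qed simp

text \<open>For \<open>2 * i <= j\<close> the subtracted value sits at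
  \<open>Suc e' = j + 1 - i >= i\<close>, inside the range where \<open>cdim\<close> is
  non-increasing. Passing to \<open>i + 1\<close> moves the first index up and the second one down,
  and both lower the difference.\<close>

lemma delta_tail:
  assumes L: "L \<in> R (Suc 0)" "L \<noteq> 0" and c: "cdim L a \<le> a" and i: "0 < a" "a \<le> i" "2 * i \<le> j"
  shows "0 \<le> int (hdim i) - int (hdim (i - 1))" "int (hdim i) - int (hdim (i - 1)) \<le> int a"
    and "2 * (i + 1) \<le> j \<Longrightarrow> int (hdim (i + 1)) - int (hdim i) \<le> int (hdim i) - int (hdim (i - 1))"
proof -
  obtain e where e: "i = Suc e" using i by (cases i) auto
  define e' where "e' = j - 1 - e"
  have deg: "e + e' + 1 = j" "i \<le> Suc e'" using i e by (auto simp: e'_def)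
  have t: "int (hdim i) - int (hdim (i - 1)) = int (cdim L i) - int (cdim L (Suc e'))"
    using hdim_diff[OF L deg(1)] e by simp
  show "0 \<le> int (hdim i) - int (hdim (i - 1))"
    using t cdim_antimono[OF L(1) c i(2) deg(2)] by simp
  show "int (hdim i) - int (hdim (i - 1)) \<le> int a"
    using t cdim_le[OF L(1) c i(2)] by simp
  assume i': "2 * (i + 1) \<le> j"
  then have deg': "i + (e' - 1) + 1 = j" "Suc (e' - 1) = e'" "i \<le> e'" using i e by (auto simp: e'_def)
  have "int (hdim (i + 1)) - int (hdim i) = int (cdim L (i + 1)) - int (cdim L e')"
    using hdim_diff[OF L deg'(1)] deg'(2) by simp
  then show "int (hdim (i + 1)) - int (hdim i) \<le> int (hdim i) - int (hdim (i - 1))"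
    using t cdim_antimono[OF L(1) c i(2), of "i + 1"] cdim_antimono[OF L(1) c _, of e' "Suc e'"]
      deg'(3) i(2) by simp
qed

end

section \<open>From the socle condition to the pairing\<close>

lemma hilb_eq_dim:
  fixes I :: "'k::field poly4 set"
  shows "hilb I i = Vec.dim (forms i :: 'k poly4 set) - Vec.dim (I \<inter> forms i)"
  by (simp add: hilb_def kdim_eq)

text \<open>Degree \<open>j\<close> consists of socle elements because all forms of degree
  \<open>j + 1\<close> lie in I. Total socle dimension 1 then leaves \<open>hilb I j = 1\<close> and
  no socle elsewhere, so outside degree \<open>j\<close> a form not in I stays outside I after
  multiplication by some variable; repeating this reaches degree \<open>j\<close>.\<close>

lemma artinian_gorenstein_duality:
  fixes I :: "'k::field poly4 set"
  assumes inf: "infinite (UNIV :: 'k set)" and I: "artinian_gorenstein I"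
    and top: "hilb I j \<noteq> 0" and above: "\<And>i. j < i \<Longrightarrow> hilb I i = 0"
  shows "\<exists>\<phi>. graded_gorenstein I j \<phi>"
proof -
  have zero: "0 \<in> I" and add: "\<And>p q. p \<in> I \<Longrightarrow> q \<in> I \<Longrightarrow> p + q \<in> I"
    and mult: "\<And>p f. p \<in> I \<Longrightarrow> f * p \<in> I" and soc: "socle_dim I = 1"
    using I by (auto simp: artinian_gorenstein_def hom_ideal_def)
  have subI: "Vec.subspace I"
    by (auto simp: Vec.subspace_def zero add pscale_conv_mult mult)
  have subId: "Vec.subspace (I \<inter> forms i)" for i
    by (intro Vec.subspace_inter subI subspace_forms)
  have sub_soc: "Vec.subspace (socle_part I i)" for i
    using subI subspace_forms by (auto simp: socle_part_def Vec.subspace_def distrib_left)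
  have soc_forms: "socle_part I i \<subseteq> forms i" for i by (auto simp: socle_part_def)
  have Id_soc: "I \<inter> forms i \<subseteq> socle_part I i" for i using mult by (auto simp: socle_part_def)
  have "forms (Suc j) \<subseteq> I"
  proof -
    have "I \<inter> forms (Suc j) = forms (Suc j)"
      by (rule Vec.subspace_eq_if_dim_le[OF fd_forms subId]) (use above[of "Suc j"] in \<open>auto simp: hilb_eq_dim\<close>)
    then show ?thesis by auto
  qed
  then have "socle_part I j = forms j"
    using forms_mult_linear[OF pvar_in_forms] by (auto simp: socle_part_def)
  then have soc_j: "socle_dim_at I j = hilb I j"
    by (simp add: socle_dim_at_def hilb_def)
  \<comment> \<open>A sum over an infinite index set is 0 by default, so the value 1 forces
    finiteness.\<close>
  have fin: "finite {i. socle_dim_at I i \<noteq> 0}"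
    using soc by (metis socle_dim_def sum.infinite zero_neq_one)
  have "socle_dim_at I j \<le> socle_dim I"
    unfolding socle_dim_def by (rule member_le_sum) (use fin top soc_j in auto)
  then have h1: "hilb I j = 1" using soc soc_j top by simp
  have soc_other: "socle_dim_at I i = 0" if "i \<noteq> j" for i
  proof (rule ccontr)
    assume "socle_dim_at I i \<noteq> 0"
    then have "(\<Sum>i\<in>{i, j}. socle_dim_at I i) \<le> socle_dim I"
      unfolding socle_dim_def by (intro sum_mono2 fin) (use top soc_j in auto)
    then show False using soc that soc_j h1 \<open>socle_dim_at I i \<noteq> 0\<close> by simp
  qed
  have socle: "f \<in> I" if "i \<noteq> j" "f \<in> forms i" "\<And>v. pvar v * f \<in> I" for f i
  proof -
    have "I \<inter> forms i = socle_part I i"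
    proof (rule Vec.subspace_eq_if_dim_le[OF _ subId Id_soc])
      show "Vec.fd (socle_part I i)" by (rule Vec.fd_subset[OF fd_forms sub_soc soc_forms])
      show "Vec.dim (socle_part I i) \<le> Vec.dim (I \<inter> forms i)"
        using soc_other[OF that(1)] by (simp add: socle_dim_at_def kdim_eq)
    qed
    moreover have "f \<in> socle_part I i" using that by (simp add: socle_part_def)
    ultimately show ?thesis by auto
  qed
  have duality: "f \<in> I" if "f \<in> forms i" "i + n = j" "\<And>g. g \<in> forms n \<Longrightarrow> f * g \<in> I" for f i n
    using that
  proof (induction n arbitrary: f i)
    case 0
    then show ?case using 0(3)[OF one_in_forms] by simp
  next
    case (Suc n)
    show ?case
    proof (rule socle[OF _ Suc.prems(1)])
      fix v
      show "pvar v * f \<in> I"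
      proof (rule Suc.IH[of _ "Suc i"])
        show "pvar v * f \<in> forms (Suc i)" by (rule forms_mult_linear[OF pvar_in_forms Suc.prems(1)])
        fix g :: "'k poly4" assume "g \<in> forms n"
        then have "f * (pvar v * g) \<in> I"
          by (intro Suc.prems(3) forms_mult_linear pvar_in_forms)
        then show "pvar v * f * g \<in> I" by (simp add: mult_ac)
      qed (use Suc.prems in simp)
    qed (use Suc.prems in simp)
  qed
  have "I \<inter> forms j \<noteq> forms j" using top by (auto simp: hilb_eq_dim)
  then obtain x where x: "x \<in> forms j" "x \<notin> I" by auto
  obtain \<phi> where \<phi>: "functional \<phi>" "\<forall>t\<in>I. \<phi> t = 0" "\<phi> x = 1"
    by (rule functional_separates[OF subI x(2)])
  \<comment> \<open>Both \<open>?K\<close> and I in degree \<open>j\<close> have codimension one,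
    and the latter is contained in the former.\<close>
  let ?K = "{f \<in> forms j. \<phi> f = 0}"
  have K: "Vec.fd ?K"
    by (rule Vec.dim_kernel_functional(1)[OF fd_forms]) (use \<phi>(1) in \<open>auto simp: functional_def\<close>)
  have "?K \<noteq> forms j"
  proof
    assume eq: "?K = forms j"
    have "x \<in> ?K" unfolding eq by (rule x(1))
    then show False using \<phi>(3) by simp
  qed
  then have "Vec.dim ?K < Vec.dim (forms j :: 'k poly4 set)"
    by (intro Vec.dim_less_if_psubset fd_forms Vec.fd_subspace[OF K]) auto
  then have "I \<inter> forms j = ?K"
    by (intro Vec.subspace_eq_if_dim_le[OF K subId]) (use \<phi>(2) h1 in \<open>auto simp: hilb_eq_dim\<close>)
  then have "\<phi> f = 0 \<longleftrightarrow> f \<in> I" if "f \<in> forms j" for f using that by blast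
  then have "graded_gorenstein I j \<phi>"
    using zero add mult duality \<phi>(1) inf by unfold_locales blast+
  then show ?thesis by blast
qed

section \<open>Nets of quadrics with maximal growth\<close>

lemma separate_two_points:
  fixes r s :: "var4 \<Rightarrow> 'k::field"
  assumes "s \<noteq> (\<lambda>_. 0)" "\<And>c. r \<noteq> (\<lambda>v. c * s v)"
  obtains N where "N \<in> forms (Suc 0)" "ev s N = 0" "ev r N = 1"
proof -
  obtain u where u: "s u \<noteq> 0" using assms(1) by auto
  obtain v where v: "r v \<noteq> (r u / s u) * s v" using assms(2)[of "r u / s u"] by auto
  \<comment> \<open>A 2 by 2 minor of the coordinates with one row left variable: zero at
    \<open>s\<close>, nonzero at \<open>r\<close> by the choice of \<open>v\<close>.\<close>
  define M where "M = pscale (s u) (pvar v) - pscale (s v) (pvar u :: 'k poly4)"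
  have M: "M \<in> forms (Suc 0)" "ev s M = 0" "ev r M = s u * r v - s v * r u"
    by (simp_all add: M_def forms_diff forms_pscale ev.subst_diff ev.subst_pscale)
  have "ev r M \<noteq> 0" using u v M(3) by (auto simp: field_simps)
  then show thesis
    using M by (intro that[of "pscale (inverse (ev r M)) M"]) (auto simp: forms_pscale ev.subst_pscale)
qed

lemma separate_from_line:
  fixes r s t :: "var4 \<Rightarrow> 'k::field"
  assumes "s \<noteq> (\<lambda>_. 0)" "\<And>c. t \<noteq> (\<lambda>v. c * s v)" "\<And>a b. r \<noteq> (\<lambda>v. a * s v + b * t v)"
  obtains N where "N \<in> forms (Suc 0)" "ev s N = 0" "ev t N = 0" "ev r N \<noteq> 0"
proof -
  obtain B where B: "B \<in> forms (Suc 0)" "ev s B = 0" "ev t B = 1"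
    by (rule separate_two_points[OF assms(1,2)])
  obtain u where u: "s u \<noteq> 0" using assms(1) by auto
  \<comment> \<open>\<open>A\<close> and \<open>B\<close> are dual to \<open>s\<close> and
    \<open>t\<close>; the form \<open>?N\<close> below is the coordinate \<open>v\<close> minus its
    interpolation on the span of \<open>s\<close> and \<open>t\<close>.\<close>
  define A where "A = pscale (inverse (s u)) (pvar u) - pscale (inverse (s u) * t u) B"
  have A: "A \<in> forms (Suc 0)" "ev s A = 1" "ev t A = 0"
    using u B by (simp_all add: A_def forms_diff forms_pscale ev.subst_diff ev.subst_pscale)
  obtain v where v: "r v \<noteq> ev r A * s v + ev r B * t v" using assms(3)[of "ev r A" "ev r B"] by auto
  show thesis
  proof (rule that)
    let ?N = "pvar v - pscale (s v) A - pscale (t v) B"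
    show "?N \<in> forms (Suc 0)" using A B by (intro forms_diff forms_pscale) auto
    show "ev s ?N = 0" "ev t ?N = 0"
      using A B by (simp_all add: ev.subst_diff ev.subst_pscale)
    show "ev r ?N \<noteq> 0"
      unfolding ev.subst_diff ev.subst_pscale ev.subst_pvar using v by (simp add: diff_diff_eq mult.commute)
  qed
qed

text \<open>A linear space is irreducible: one of \<open>p\<close>, \<open>q\<close>,
  \<open>p + q\<close> avoids both forms. Hence a product \<open>L * M\<close> vanishing on the
  zeros of \<open>T\<close> has a factor in \<open>T\<close>.\<close>

lemma zero_locus_prime:
  fixes T :: "'k::field poly4 set"
  assumes T: "Vec.subspace T" "T \<subseteq> forms (Suc 0)"
    and L: "L \<in> forms (Suc 0)" "L \<notin> T" and M: "M \<in> forms (Suc 0)" "M \<notin> T"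
  obtains z where "\<forall>t\<in>T. ev z t = 0" "ev z L \<noteq> 0" "ev z M \<noteq> 0"
proof -
  obtain p where p: "\<forall>t\<in>T. ev p t = 0" "ev p L = 1" by (rule point_separates[OF T L])
  obtain q where q: "\<forall>t\<in>T. ev q t = 0" "ev q M = 1" by (rule point_separates[OF T M])
  have add: "ev (\<lambda>v. p v + q v) N = ev p N + ev q N" if "N \<in> forms (Suc 0)" for N
    using ev_linear_comb[OF that, of 1 p 1 q] by simp
  show thesis
  proof (cases "ev p M = 0")
    case False
    then show thesis using that[OF p(1)] p(2) by simp
  next
    case pM: True
    show thesis
    proof (cases "ev q L = 0")
      case False
      then show thesis using that[OF q(1)] q(2) by simp
    next
      case True
      have "\<forall>t\<in>T. ev (\<lambda>v. p v + q v) t = 0" using add p(1) q(1) T(2) by auto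
      then show thesis using that add[OF L(1)] add[OF M(1)] p(2) q(2) pM True by simp
    qed
  qed
qed

text \<open>The coefficients are indexed by \<open>A\<close> rather than by the image, since
  \<open>f\<close> may identify elements of \<open>A\<close>.\<close>

lemma span_image_sum:
  assumes "finite A" "x \<in> Vec.span (f ` A)"
  shows "\<exists>a. x = (\<Sum>y\<in>A. pscale (a y) (f y))"
  using assms
proof (induction A arbitrary: x rule: finite_induct)
  case (insert b A)
  then obtain c where "x - pscale c (f b) \<in> Vec.span (f ` A)" by (auto simp: Vec.span_insert)
  then obtain a where a: "x - pscale c (f b) = (\<Sum>y\<in>A. pscale (a y) (f y))" using insert.IH by blast
  have "(\<Sum>y\<in>insert b A. pscale ((a(b := c)) y) (f y)) = pscale c (f b) + (\<Sum>y\<in>A. pscale ((a(b := c)) y) (f y))"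
    using insert.hyps by simp
  also have "(\<Sum>y\<in>A. pscale ((a(b := c)) y) (f y)) = (\<Sum>y\<in>A. pscale (a y) (f y))"
    using insert.hyps by (intro sum.cong) auto
  also have "pscale c (f b) + \<dots> = x" using a by (simp add: algebra_simps)
  finally show ?case by metis
qed simp

context graded_gorenstein
begin

text \<open>For a nonzero \<open>L\<close> outside this set no quadric of I is lost by restriction
  to the plane \<open>L = 0\<close>.\<close>

definition reducers :: "'k poly4 set" where
  "reducers = {L \<in> R (Suc 0). \<exists>M\<in>R (Suc 0). M \<noteq> 0 \<and> L * M \<in> I}"

text \<open>If generic linear forms divided quadrics in \<open>I\<close>, one could successively choose four of
  them, with independent products: a relation \<open>L * M = (\<Sum> a\<^sub>i * L\<^sub>i * M\<^sub>i)\<close> forces first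
  \<open>M\<close> into the span of the \<open>L\<^sub>i\<close>, and then, by the Koszul syzygies, \<open>L\<close> into the span of one
  \<open>M\<^sub>i\<close> and the other \<open>L\<^sub>k\<close>.\<close>

lemma thin_reducers:
  assumes dim3: "Vec.dim (Id 2) \<le> 3"
  shows "thin reducers"
proof (rule ccontr)
  assume nthin: "\<not> thin reducers"
  let ?prd = "\<lambda>x :: 'k poly4 \<times> 'k poly4. fst x * snd x"
  define good where "good A \<longleftrightarrow> (\<forall>x\<in>A. fst x \<in> R (Suc 0) \<and> snd x \<in> R (Suc 0) \<and> ?prd x \<in> I \<and>
    fst x \<notin> Vec.span (fst ` (A - {x})))" for A
  have "\<exists>A. finite A \<and> card A = k \<and> good A \<and> Vec.dim (Vec.span (?prd ` A)) = k" if "k \<le> 4" for k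
    using that
  proof (induction k)
    case 0
    have "Vec.dim (Vec.span ({} :: 'k poly4 set)) = 0"
      using Vec.dim_le_card[of "Vec.span {}" "{}"] by simp
    then show ?case by (intro exI[of _ "{}"]) (simp add: good_def)
  next
    case (Suc k)
    from Suc.IH[OF Suc_leD[OF Suc.prems]] obtain A where
      A0: "finite A" "card A = k" "good A" "Vec.dim (Vec.span (?prd ` A)) = k"
      by (elim exE conjE)
    have gA: "fst x \<in> R (Suc 0)" "snd x \<in> R (Suc 0)" "?prd x \<in> I" "fst x \<notin> Vec.span (fst ` (A - {x}))"
      if "x \<in> A" for x
      using A0(3) that unfolding good_def by auto
    note A = A0(1,2) gA A0(4)
    \<comment> \<open>These spans have at most \<open>k <= 3\<close> generators, so they are proper
      in the four-dimensional space of linear forms and a general \<open>L\<close> avoids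
      them.\<close>
    let ?T = "\<lambda>x. Vec.span (insert (snd x) (fst ` (A - {x})))"
    have card_fst: "card (fst ` B) \<le> card B" if "B \<subseteq> A" for B
      using that A(1) finite_subset card_image_le by blast
    have thinT: "thin (Vec.span (fst ` A))"
      using A card_fst[of A] Suc.prems by (intro thin_span) auto
    have "thin (?T x)" if x: "x \<in> A" for x
    proof (rule thin_span)
      have "card (insert (snd x) (fst ` (A - {x}))) \<le> Suc (card (fst ` (A - {x})))"
        using A(1) by (simp add: card_insert_if)
      also have "\<dots> \<le> Suc (card (A - {x}))" using card_fst[OF Diff_subset] by simp
      also have "\<dots> = k" unfolding A(2)[symmetric] by (rule card_Suc_Diff1[OF A(1) x])
      finally show "card (insert (snd x) (fst ` (A - {x}))) < 4" using Suc.prems by simp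
    qed (use A x in auto)
    then have "thin (\<Union>x\<in>A. ?T x)" using A(1) by (intro thin_UN)
    then obtain L where L: "L \<in> reducers" "L \<in> R (Suc 0)" "L \<notin> Vec.span (fst ` A) \<union> (\<Union>x\<in>A. ?T x)"
      by (rule not_thin_obtain[OF nthin thin_Un[OF thinT]])
    then obtain M where M: "M \<in> R (Suc 0)" "M \<noteq> 0" "L * M \<in> I" by (auto simp: reducers_def)
    have sub: "Vec.span (fst ` B) \<subseteq> R (Suc 0)" if "B \<subseteq> A" for B
      by (rule Vec.span_minimal[OF _ subspace_forms]) (use that A(3) in auto)
    have new: "L * M \<notin> Vec.span (?prd ` A)"
    proof
      assume "L * M \<in> Vec.span (?prd ` A)"
      then obtain a where a: "L * M = (\<Sum>x\<in>A. pscale (a x) (?prd x))"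
        using span_image_sum[OF A(1)] by blast
      have "M \<in> Vec.span (fst ` A)"
      proof (rule ccontr)
        assume MT: "M \<notin> Vec.span (fst ` A)"
        have LT: "L \<notin> Vec.span (fst ` A)" using L(3) by blast
        obtain z where z: "\<forall>t\<in>Vec.span (fst ` A). ev z t = 0" "ev z L \<noteq> 0" "ev z M \<noteq> 0"
          by (rule zero_locus_prime[OF Vec.subspace_span sub[OF subset_refl] L(2) LT M(1) MT])
        have "ev z (L * M) = (\<Sum>x\<in>A. a x * (ev z (fst x) * ev z (snd x)))"
          unfolding a by (simp add: ev.subst_sum ev.subst_pscale ev.subst_mult)
        also have "\<dots> = 0" using z(1) by (intro sum.neutral) (auto intro: Vec.span_base)
        finally show False using z(2,3) by (simp add: ev.subst_mult)
      qed
      then obtain b where b: "M = (\<Sum>x\<in>A. pscale (b x) (fst x))"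
        using span_image_sum[OF A(1)] by blast
      have "\<exists>x\<in>A. b x \<noteq> 0"
      proof (rule ccontr)
        assume "\<not> (\<exists>x\<in>A. b x \<noteq> 0)"
        then have "M = 0" unfolding b by (intro sum.neutral) auto
        then show False using M(2) by simp
      qed
      then obtain x where x: "x \<in> A" "b x \<noteq> 0" by blast
      \<comment> \<open>Inserting the expansion of \<open>M\<close> turns the relation into a syzygy
        of the forms \<open>fst y\<close> with coefficients \<open>N y\<close>. On the common zeros
        of the others only the term of \<open>x\<close> survives, which puts \<open>N x\<close> into
        their span; as \<open>b x\<close> is nonzero, \<open>L\<close> can be solved for.\<close>
      define N where "N = (\<lambda>y. pscale (b y) L - pscale (a y) (snd y))"
      have NR: "N y \<in> R (Suc 0)" if "y \<in> A" for y
        unfolding N_def using A(4)[OF that] L(2) by (intro forms_diff forms_pscale)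
      have "(\<Sum>y\<in>A. fst y * N y) = L * (\<Sum>y\<in>A. pscale (b y) (fst y)) - (\<Sum>y\<in>A. pscale (a y) (?prd y))"
        by (simp add: N_def sum_distrib_left right_diff_distrib sum_subtractf mult.commute)
      also have "\<dots> = 0" using a b by simp
      finally have syz: "(\<Sum>y\<in>A. fst y * N y) = 0" .
      have "N x \<in> Vec.span (fst ` (A - {x}))"
      proof (rule ccontr)
        assume NT: "N x \<notin> Vec.span (fst ` (A - {x}))"
        obtain z where z: "\<forall>t\<in>Vec.span (fst ` (A - {x})). ev z t = 0" "ev z (fst x) \<noteq> 0" "ev z (N x) \<noteq> 0"
          by (rule zero_locus_prime[OF Vec.subspace_span sub[OF Diff_subset] A(3)[OF x(1)] A(6)[OF x(1)] NR[OF x(1)] NT])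
        have "0 = (\<Sum>y\<in>A. ev z (fst y) * ev z (N y))"
          using arg_cong[OF syz, of "ev z"] by (simp add: ev.subst_sum ev.subst_mult)
        also have "\<dots> = ev z (fst x) * ev z (N x) + (\<Sum>y\<in>A - {x}. ev z (fst y) * ev z (N y))"
          by (rule sum.remove[OF A(1) x(1)])
        also have "(\<Sum>y\<in>A - {x}. ev z (fst y) * ev z (N y)) = 0"
          using z(1) by (intro sum.neutral) (auto intro: Vec.span_base)
        finally show False using z(2,3) by simp
      qed
      then have "N x \<in> ?T x" by (rule subsetD[OF Vec.span_mono[OF subset_insertI]])
      moreover have "snd x \<in> ?T x" by (rule Vec.span_base) simp
      ultimately have "pscale (inverse (b x)) (N x + pscale (a x) (snd x)) \<in> ?T x"
        by (intro Vec.span_scale Vec.span_add)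
      also have "pscale (inverse (b x)) (N x + pscale (a x) (snd x)) = L"
        using x(2) by (simp add: N_def)
      finally show False using L(3) x(1) by blast
    qed
    let ?A = "insert (L, M) A"
    have LA: "L \<notin> Vec.span (fst ` A)" using L(3) by blast
    have notin: "(L, M) \<notin> A"
    proof
      assume "(L, M) \<in> A"
      then have "fst (L, M) \<in> fst ` A" by (rule imageI)
      then show False using LA Vec.span_base[of L "fst ` A"] by simp
    qed
    have ind: "fst x \<notin> Vec.span (fst ` (?A - {x}))" if "x \<in> ?A" for x
    proof (cases "x = (L, M)")
      case True
      then have "?A - {x} = A" using notin by auto
      then show ?thesis using True LA by simp
    next
      case False
      then have x: "x \<in> A" using that by auto
      have eq: "fst ` (?A - {x}) = insert L (fst ` (A - {x}))"
        using False by (simp add: insert_Diff_if)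
      show ?thesis
      proof
        assume "fst x \<in> Vec.span (fst ` (?A - {x}))"
        then have "L \<in> Vec.span (insert (fst x) (fst ` (A - {x})))"
          unfolding eq by (rule Vec.in_span_insert[OF _ A(6)[OF x]])
        also have "insert (fst x) (fst ` (A - {x})) = fst ` A" using x by auto
        finally show False using LA by simp
      qed
    qed
    have dimA: "Vec.dim (Vec.span (?prd ` ?A)) = Suc k"
    proof -
      have "Vec.span (?prd ` ?A) = Vec.vsum (Vec.span (?prd ` A)) (Vec.span {L * M})"
        unfolding Vec.vsum_def Vec.span_Un[symmetric] by simp
      moreover have "Vec.fd (Vec.span (?prd ` A))" using A(1) by (intro Vec.fdI_span) simp
      ultimately show ?thesis using Vec.dim_span_insert[OF _ new] A(7) by simp
    qed
    have "good ?A"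
      unfolding good_def
    proof
      fix x assume x: "x \<in> ?A"
      then have "fst x \<in> R (Suc 0) \<and> snd x \<in> R (Suc 0) \<and> ?prd x \<in> I"
        using A(3-5) L(2) M by (cases "x = (L, M)") auto
      then show "fst x \<in> R (Suc 0) \<and> snd x \<in> R (Suc 0) \<and> ?prd x \<in> I \<and> fst x \<notin> Vec.span (fst ` (?A - {x}))"
        using ind[OF x] by simp
    qed
    then show ?case
      using A(1,2) notin dimA by (intro exI[of _ ?A] conjI) simp_all
  qed
  from this[OF order_refl] obtain A where
    A: "finite A" "good A" "Vec.dim (Vec.span (?prd ` A)) = 4"
    by (elim exE conjE)
  have "?prd ` A \<subseteq> Id 2"
    using A(2) forms_mult_linear[of _ _ "Suc 0"] by (auto simp: good_def numeral_2_eq_2)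
  then have "Vec.span (?prd ` A) \<subseteq> Id 2" by (rule Vec.span_minimal[OF _ subspace_Id])
  then have "Vec.dim (Vec.span (?prd ` A)) \<le> Vec.dim (Id 2)" by (rule Vec.dim_mono_fd[OF fd_Id])
  then show False using A(3) dim3 by simp
qed

section \<open>Base points of the net on general lines\<close>

definition base_point :: "(var4 \<Rightarrow> 'k) \<Rightarrow> bool" where
  "base_point p \<longleftrightarrow> (\<forall>q\<in>Id 2. ev p q = 0)"

text \<open>Outside this set the quadrics modulo I, \<open>L\<close> and \<open>M\<close> have
  dimension at most one, which leaves room for at most one base point on the line
  \<open>L = M = 0\<close>.\<close>

definition special :: "'k poly4 \<Rightarrow> 'k poly4 set" where
  "special L = {M \<in> R (Suc 0). Vec.dim (Vec.vsum (sect L 2) (lmul M 2)) + 2 \<le> Vec.dim (R 2)}"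

lemma dim_sect_2:
  assumes "Vec.dim (Id 2) = 3" "L \<in> R (Suc 0)" "L \<noteq> 0" "L \<notin> reducers"
  shows "Vec.dim (sect L 2) = 7"
proof -
  have "colon L (Suc 0) = {0}"
    using assms zero_I forms_zero by (auto simp: reducers_def colon_def)
  moreover have "Vec.dim {0 :: 'k poly4} = 0"
    using Vec.dim_span_singleton_le[of 0] Vec.dim_le_card[of "{0}" "{}"] by simp
  ultimately show ?thesis
    using dim_sect[OF assms(2,3), of "Suc 0"] assms(1) by (simp add: dim_forms_1 numeral_2_eq_2)
qed

text \<open>With \<open>d = r = 2\<close> the bound reads \<open>10 < 7 + 2 + 2\<close>. For
  \<open>r = 1\<close> it would read \<open>10 < 10\<close>, which is why codimension one has to be
  tolerated.\<close>

lemma thin_special: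
  assumes "Vec.dim (Id 2) = 3" "L \<in> R (Suc 0)" "L \<noteq> 0" "L \<notin> reducers"
  shows "thin (special L)"
  unfolding special_def
  by (rule thin_bad_forms[OF subspace_sect sect_subset[OF assms(2)]])
    (use dim_sect_2[OF assms] in \<open>simp_all add: dim_forms_2\<close>)

text \<open>A functional \<open>\<chi>\<close> on cubics that kills \<open>I\<close>, \<open>L\<close> and \<open>M\<close> factors, for each linear
  form \<open>N\<close>, as \<open>\<chi> (N * q) = \<lambda> N * \<psi> q\<close>, since the quadrics modulo \<open>I\<close>, \<open>L\<close> and \<open>M\<close> are
  one-dimensional. Symmetry then makes \<open>\<psi>\<close> a multiple of evaluation at the point \<open>\<lambda>\<close>.\<close>

lemma base_point_unique:
  assumes dim3: "Vec.dim (Id 2) = 3" and L: "L \<in> R (Suc 0)" "L \<noteq> 0" "L \<notin> reducers"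
    and growth: "4 \<le> cdim L 3" and M: "M \<in> R (Suc 0)" "M \<notin> special L"
  obtains p where "p \<noteq> (\<lambda>_. 0)" "ev p L = 0" "ev p M = 0" "base_point p"
    "\<And>r. ev r L = 0 \<Longrightarrow> ev r M = 0 \<Longrightarrow> base_point r \<Longrightarrow> \<exists>c. r = (\<lambda>v. c * p v)"
proof -
  define U where "U = Vec.vsum (sect L 2) (lmul M 2)"
  define S where "S = Vec.vsum (sect L 3) (lmul M 3)"
  have num: "(2::nat) = Suc (Suc 0)" "(3::nat) = Suc 2" by simp_all
  have subU: "Vec.subspace U" and subS: "Vec.subspace S"
    unfolding U_def S_def by (intro Vec.subspace_vsum subspace_sect subspace_lmul)+
  have fdU: "Vec.fd U" unfolding U_def by (intro Vec.fd_vsum fd_sect fd_lmul L M)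
  have UR: "U \<subseteq> R 2" and SR: "S \<subseteq> R 3"
    unfolding U_def S_def by (intro Vec.vsum_least subspace_forms sect_subset lmul_subset L M)+
  have US: "N * u \<in> S" if N: "N \<in> R (Suc 0)" and uU: "u \<in> U" for N u
  proof -
    obtain x y where xy: "x \<in> sect L 2" "y \<in> lmul M 2" "u = x + y"
      using uU unfolding U_def by (rule Vec.vsumE)
    have "N * x + N * y \<in> S"
      unfolding S_def num(2) by (rule Vec.vsumI[OF mult_sect[OF N xy(1)] mult_lmul[OF xy(2) N]])
    then show ?thesis unfolding xy(3) distrib_left .
  qed
  \<comment> \<open>Adding \<open>M\<close> lowers the codimension in degree 3 by at most the
    codimension 3 of \<open>sect L 2\<close>; the growth to 4 therefore leaves a cubic outside
    \<open>S\<close>.\<close>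
  have "Vec.dim S + Vec.dim (sect L 2) \<le> Vec.dim (sect L 3) + Vec.dim (R 2)"
    unfolding S_def num(2)
    by (rule dim_vsum_lmul_le[OF subspace_sect sect_subset[OF L(1)] subspace_sect sect_subset[OF L(1)] M(1)])
      (rule mult_sect[OF M(1)])
  then have "Vec.dim S < Vec.dim (R 3)"
    using growth dim_sect_2[OF dim3 L] by (simp add: dim_forms_2 cdim_def)
  then have "S \<noteq> R 3" by auto
  then obtain x where x: "x \<in> R 3" "x \<notin> S" using SR by auto
  obtain \<chi> where \<chi>: "functional \<chi>" "\<forall>s\<in>S. \<chi> s = 0" "\<chi> x = 1"
    by (rule functional_separates[OF subS x(2)])
  have R3: "R 3 \<subseteq> T" if "Vec.subspace T" "\<And>v g. g \<in> R 2 \<Longrightarrow> pvar v * g \<in> T" for T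
    unfolding num(2) by (rule forms_Suc_subset[OF that])
  have "U \<noteq> R 2"
  proof
    assume "U = R 2"
    then have "R 3 \<subseteq> S" using US[OF pvar_in_forms] by (intro R3[OF subS]) auto
    then show False using x by auto
  qed
  then obtain q0 where q0: "q0 \<in> R 2" "q0 \<notin> U" using UR by auto
  have dec: "\<exists>u\<in>U. \<exists>c. q = u + pscale c q0" if "q \<in> R 2" for q
  proof -
    have "Vec.vsum U (Vec.span {q0}) = R 2"
    proof (rule Vec.subspace_eq_if_dim_le[OF fd_forms])
      show "Vec.subspace (Vec.vsum U (Vec.span {q0}))" by (intro Vec.subspace_vsum subU Vec.subspace_span)
      show "Vec.vsum U (Vec.span {q0}) \<subseteq> R 2"
        using q0(1) by (intro Vec.vsum_least subspace_forms UR Vec.span_minimal) auto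
      have "\<not> Vec.dim U + 2 \<le> Vec.dim (R 2)" using M by (simp add: special_def U_def)
      then show "Vec.dim (R 2) \<le> Vec.dim (Vec.vsum U (Vec.span {q0}))"
        using Vec.dim_span_insert[OF fdU q0(2)] by simp
    qed
    then have "q \<in> Vec.vsum U (Vec.span {q0})" using that by simp
    then obtain u w where "u \<in> U" "w \<in> Vec.span {q0}" "q = u + w" by (rule Vec.vsumE)
    then show ?thesis by (auto simp: Vec.span_singleton)
  qed
  define p where "p = (\<lambda>v. \<chi> (pvar v * q0))"
  have "functional (\<lambda>N. \<chi> (N * q0))"
    using \<chi>(1) by (simp add: functional_def distrib_right)
  then have lam: "\<chi> (N * q0) = ev p N" if "N \<in> R (Suc 0)" for N
    using functional_eq_ev[OF _ that] unfolding p_def by blast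
  have \<chi>_dec: "\<chi> (N * (u + pscale c q0)) = c * ev p N" if "N \<in> R (Suc 0)" "u \<in> U" for N u c
    using \<chi>(2) US[OF that] lam[OF that(1)]
    by (simp add: distrib_left functional_add[OF \<chi>(1)] functional_pscale[OF \<chi>(1)])
  have p0: "p \<noteq> (\<lambda>_. 0)"
  proof
    assume p: "p = (\<lambda>_. 0)"
    have "R 3 \<subseteq> {f. \<chi> f = 0}"
    proof (rule R3)
      show "Vec.subspace {f. \<chi> f = 0}"
        using \<chi>(1) functional_zero[OF \<chi>(1)] by (auto simp: Vec.subspace_def functional_def)
      fix v and g :: "'k poly4" assume "g \<in> R 2"
      then obtain u c where u: "u \<in> U" "g = u + pscale c q0" using dec by blast
      have "\<chi> (pvar v * g) = c * ev p (pvar v)" unfolding u(2) by (rule \<chi>_dec[OF pvar_in_forms u(1)])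
      then show "pvar v * g \<in> {f. \<chi> f = 0}" by (simp add: p)
    qed
    then show False using x \<chi>(3) by auto
  qed
  then obtain v0 where v0: "p v0 \<noteq> 0" by auto
  \<comment> \<open>Normalized to value 1 at \<open>p\<close>, so that the second factor of
    \<open>\<chi> (N * q)\<close> can be read off as \<open>\<chi> (M0 * q)\<close>.\<close>
  define M0 where "M0 = pscale (inverse (p v0)) (pvar v0 :: 'k poly4)"
  have M0: "M0 \<in> R (Suc 0)" "ev p M0 = 1"
    using v0 by (simp_all add: M0_def forms_pscale ev.subst_pscale)
  have key: "\<chi> (N * q) = \<chi> (M0 * q) * ev p N" if N: "N \<in> R (Suc 0)" and q: "q \<in> R 2" for N q
  proof -
    obtain u c where u: "u \<in> U" "q = u + pscale c q0" using dec[OF q] by blast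
    show ?thesis unfolding u(2) \<chi>_dec[OF N u(1)] \<chi>_dec[OF M0(1) u(1)] M0(2) by simp
  qed
  define \<kappa> where "\<kappa> = \<chi> (M0 * (M0 * M0))"
  have prod2: "N * P \<in> R 2" if "N \<in> R (Suc 0)" "P \<in> R (Suc 0)" for N P
    unfolding num(1) by (rule forms_mult_linear[OF that])
  have psi: "\<chi> (M0 * q) = \<kappa> * ev p q" if "q \<in> R 2" for q
  proof -
    have "R 2 \<subseteq> {q. \<chi> (M0 * q) = \<kappa> * ev p q}"
      unfolding num(1)
    proof (rule forms_Suc_subset)
      show "Vec.subspace {q. \<chi> (M0 * q) = \<kappa> * ev p q}"
        using functional_zero[OF \<chi>(1)]
        by (simp add: Vec.subspace_def functional_add[OF \<chi>(1)] functional_pscale[OF \<chi>(1)]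
            distrib_left ev.subst_add ev.subst_pscale)
      fix v :: var4 and P :: "'k poly4" assume P: "P \<in> R (Suc 0)"
      have "\<chi> (M0 * (pvar v * P)) = \<chi> (pvar v * (M0 * P))" by (simp add: mult.left_commute)
      also have "\<dots> = \<chi> (M0 * (M0 * P)) * p v"
        using key[OF pvar_in_forms prod2[OF M0(1) P]] by simp
      also have "M0 * (M0 * P) = P * (M0 * M0)" by (simp add: mult_ac)
      also have "\<chi> (P * (M0 * M0)) = \<kappa> * ev p P"
        unfolding \<kappa>_def by (rule key[OF P prod2[OF M0(1) M0(1)]])
      finally show "pvar v * P \<in> {q. \<chi> (M0 * q) = \<kappa> * ev p q}" by (simp add: ev.subst_mult mult_ac)
    qed
    then show ?thesis using that by auto
  qed
  have "\<kappa> * ev p q0 = 1" using psi[OF q0(1)] lam[OF M0(1)] M0(2) by simp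
  then have nz: "\<kappa> \<noteq> 0" "ev p q0 \<noteq> 0" by auto
  have evU: "ev p u = 0" if "u \<in> U" for u
    using psi[of u] \<chi>(2) US[OF M0(1) that] UR that nz(1) by auto
  have IdU: "Id 2 \<subseteq> U"
    unfolding U_def using Id_subset_sect Vec.vsum_left[OF subspace_lmul] by (rule subset_trans)
  have LU: "lmul L 2 \<subseteq> U"
    unfolding U_def using lmul_subset_sect Vec.vsum_left[OF subspace_lmul] by (rule subset_trans)
  have MU: "lmul M 2 \<subseteq> U" unfolding U_def by (rule Vec.vsum_right[OF subspace_sect])
  have mul2: "N * P \<in> lmul N 2" if "P \<in> R (Suc 0)" for N P
    unfolding num(1) by (rule lmulI[OF that])
  show thesis
  proof (rule that[OF p0])
    show "base_point p" using evU IdU by (auto simp: base_point_def)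
    show "ev p L = 0" using evU[OF subsetD[OF LU mul2[OF M0(1)]]] M0(2) by (simp add: ev.subst_mult)
    show "ev p M = 0" using evU[OF subsetD[OF MU mul2[OF M0(1)]]] M0(2) by (simp add: ev.subst_mult)
    fix r assume r: "ev r L = 0" "ev r M = 0" "base_point r"
    have "U \<subseteq> {q. ev r q = 0}"
    proof -
      have S0: "Vec.subspace {q. ev r q = 0}"
        by (auto simp: Vec.subspace_def ev.subst_add ev.subst_pscale)
      show ?thesis
        unfolding U_def sect_def
      proof (intro Vec.vsum_least S0)
        show "Id 2 \<subseteq> {q. ev r q = 0}" using r(3) by (auto simp: base_point_def)
      qed (use r(1,2) in \<open>auto simp: num(1) lmul_Suc ev.subst_mult\<close>)
    qed
    then have evr: "ev r q = (ev r q0 / ev p q0) * ev p q" if q: "q \<in> R 2" for q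
    proof -
      obtain u c where u: "u \<in> U" "q = u + pscale c q0" using dec[OF q] by blast
      have "ev r u = 0" using \<open>U \<subseteq> {q. ev r q = 0}\<close> u(1) by auto
      then show ?thesis unfolding u(2) using nz(2) evU[OF u(1)] by (simp add: ev.subst_add ev.subst_pscale)
    qed
    \<comment> \<open>On quadrics, evaluation at \<open>r\<close> is a fixed multiple of evaluation
      at \<open>p\<close>. Comparing values on \<open>M0 * M0\<close> and on
      \<open>pvar v * M0\<close> gives the ratio of coordinates; if \<open>M0\<close> vanishes at
      \<open>r\<close>, the multiple is 0 and the squares of the coordinates show
      \<open>r = 0\<close>.\<close>
    have "r v = ev r M0 * p v" for v
    proof (cases "ev r M0 = 0")
      case True
      then have z: "ev r q0 / ev p q0 = 0" using evr[OF prod2[OF M0(1) M0(1)]] M0(2) by (simp add: ev.subst_mult)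
      have "ev r (pvar v * pvar v) = 0" using evr[OF prod2, of "pvar v" "pvar v"] unfolding z by simp
      then show ?thesis using True by (simp add: ev.subst_mult)
    next
      case False
      have "ev r M0 * ev r M0 = ev r q0 / ev p q0"
        using evr[OF prod2[OF M0(1) M0(1)]] M0(2) by (simp add: ev.subst_mult)
      moreover have "r v * ev r M0 = ev r q0 / ev p q0 * p v"
        using evr[OF prod2[OF pvar_in_forms M0(1)], of v] M0(2) by (simp add: ev.subst_mult)
      ultimately have "ev r M0 * r v = ev r M0 * (ev r M0 * p v)" by (simp add: mult_ac)
      then show ?thesis using False by simp
    qed
    then show "\<exists>c. r = (\<lambda>v. c * p v)" by blast
  qed
qed

end

section \<open>The base plane of the net\<close>

context graded_gorenstein
begin

lemma not_multiple:
  assumes N: "N \<in> R (Suc 0)" "ev s N \<noteq> 0" "ev r N = 0" and r: "r \<noteq> (\<lambda>_. 0)"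
  shows "r \<noteq> (\<lambda>v. c * s v)" "s \<noteq> (\<lambda>v. c * r v)"
proof -
  have lin: "ev (\<lambda>v. c * t v) N = c * ev t N" for c t
    using ev_linear_comb[OF N(1), of c t 0 t] by simp
  show "r \<noteq> (\<lambda>v. c * s v)"
  proof
    assume eq: "r = (\<lambda>v. c * s v)"
    have "c = 0" using lin[of c s] N(2,3) unfolding eq[symmetric] by simp
    then show False using eq r by simp
  qed
  show "s \<noteq> (\<lambda>v. c * r v)"
  proof
    assume eq: "s = (\<lambda>v. c * r v)"
    show False using lin[of c r] N(2,3) unfolding eq[symmetric] by simp
  qed
qed

text \<open>Four base points in the plane \<open>L = 0\<close> fail to impose independent conditions on the
  quadrics, as \<open>I\<close> has codimension only three there; hence three of them are collinear.\<close>

lemma base_points_collinear: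
  assumes dim3: "Vec.dim (Id 2) = 3" and L: "L \<in> R (Suc 0)" "L \<noteq> 0" "L \<notin> reducers"
    and base: "\<And>i. i < 4 \<Longrightarrow> base_point (p i) \<and> ev (p i) L = 0 \<and> p i \<noteq> (\<lambda>_. 0)"
    and distinct: "\<And>i k c. i < 4 \<Longrightarrow> k < 4 \<Longrightarrow> i \<noteq> k \<Longrightarrow> p i \<noteq> (\<lambda>v. c * p k v)"
  shows "\<exists>a b. p 2 = (\<lambda>v. a * p 0 v + b * p (1::nat) v)"
proof (rule ccontr)
  assume "\<nexists>a b. p 2 = (\<lambda>v. a * p 0 v + b * p (1::nat) v)"
  then have nl: "p 2 \<noteq> (\<lambda>v. a * p 0 v + b * p (1::nat) v)" for a b by blast
  have kill: "ev (p i) s = 0" if i: "i < 4" and s: "s \<in> sect L 2" for i s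
  proof -
    obtain x y where xy: "x \<in> Id 2" "y \<in> lmul L 2" "s = x + y"
      using s unfolding sect_def by (rule Vec.vsumE)
    have "ev (p i) y = 0"
      using xy(2) base[OF i] by (auto simp: numeral_2_eq_2 lmul_Suc ev.subst_mult)
    then show ?thesis using xy base[OF i] by (simp add: ev.subst_add base_point_def)
  qed
  have step: "Vec.fd (Vec.vsum S (Vec.span {q})) \<and> Vec.vsum S (Vec.span {q}) \<subseteq> R 2 \<and>
      Vec.dim (Vec.vsum S (Vec.span {q})) = Suc (Vec.dim S)"
    if S: "Vec.fd S" "S \<subseteq> R 2" and q: "q \<in> R 2" and r: "\<And>s. s \<in> S \<Longrightarrow> ev r s = 0" "ev r q \<noteq> 0"
    for S q r
  proof (intro conjI)
    have "q \<notin> S" using r by blast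
    then show "Vec.dim (Vec.vsum S (Vec.span {q})) = Suc (Vec.dim S)" by (rule Vec.dim_span_insert[OF S(1)])
    show "Vec.fd (Vec.vsum S (Vec.span {q}))" by (intro Vec.fd_vsum S Vec.fdI_span) simp
    show "Vec.vsum S (Vec.span {q}) \<subseteq> R 2"
      using q by (intro Vec.vsum_least subspace_forms S Vec.span_minimal) auto
  qed
  have kill_step: "ev r s = 0"
    if S: "\<And>s. s \<in> S \<Longrightarrow> ev r s = 0" and q: "ev r q = 0" and s: "s \<in> Vec.vsum S (Vec.span {q})" for S q r s
    using s by (rule Vec.vsumE) (auto simp: Vec.span_singleton ev.subst_add ev.subst_pscale S q)
  \<comment> \<open>The products of these forms are triangular for the order \<open>p 2\<close>,
    \<open>p 0\<close>, \<open>p 1\<close>, \<open>p 3\<close>: each quadric is nonzero at its own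
    point and zero at the later ones. Starting from dimension 7, four such quadrics would give 11 >
    10. Non-collinearity provides \<open>N1\<close>, which takes care of two points at once.\<close>
  obtain N1 where N1: "N1 \<in> R (Suc 0)" "ev (p 0) N1 = 0" "ev (p 1) N1 = 0" "ev (p 2) N1 \<noteq> 0"
  proof (rule separate_from_line[of "p 0" "p 1" "p 2"])
    show "p 0 \<noteq> (\<lambda>_. 0)" using base[of 0] by simp
    show "p 1 \<noteq> (\<lambda>v. c * p 0 v)" for c by (rule distinct) simp_all
    show "p 2 \<noteq> (\<lambda>v. a * p 0 v + b * p 1 v)" for a b by (rule nl)
  qed
  have sep: "\<exists>N. N \<in> R (Suc 0) \<and> ev (p k) N = 0 \<and> ev (p i) N = 1"
    if ik: "i < 4" "k < 4" "i \<noteq> k" for i k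
  proof (rule separate_two_points[of "p k" "p i"])
    show "p k \<noteq> (\<lambda>_. 0)" using base[OF ik(2)] by simp
    show "p i \<noteq> (\<lambda>v. c * p k v)" for c using distinct[OF ik] .
  qed blast
  obtain N2 where N2: "N2 \<in> R (Suc 0)" "ev (p 3) N2 = 0" "ev (p 2) N2 = 1" using sep[of 2 3] by auto
  obtain N3 where N3: "N3 \<in> R (Suc 0)" "ev (p 1) N3 = 0" "ev (p 0) N3 = 1" using sep[of 0 1] by auto
  obtain N4 where N4: "N4 \<in> R (Suc 0)" "ev (p 3) N4 = 0" "ev (p 0) N4 = 1" using sep[of 0 3] by auto
  obtain N5 where N5: "N5 \<in> R (Suc 0)" "ev (p 3) N5 = 0" "ev (p 1) N5 = 1" using sep[of 1 3] by auto
  obtain N6 where N6: "N6 \<in> R (Suc 0)" "ev (p 0) N6 = 0" "ev (p 3) N6 = 1" using sep[of 3 0] by auto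
  have prod2: "N * P \<in> R 2" if "N \<in> R (Suc 0)" "P \<in> R (Suc 0)" for N P
    unfolding numeral_2_eq_2 by (rule forms_mult_linear[OF that])
  define S1 where "S1 = Vec.vsum (sect L 2) (Vec.span {N1 * N2})"
  define S2 where "S2 = Vec.vsum S1 (Vec.span {N3 * N4})"
  define S3 where "S3 = Vec.vsum S2 (Vec.span {N5 * N5})"
  define S4 where "S4 = Vec.vsum S3 (Vec.span {N6 * N6})"
  note evm = ev.subst_mult
  have 1: "Vec.fd S1 \<and> S1 \<subseteq> R 2 \<and> Vec.dim S1 = 8"
    using step[OF fd_sect[OF L(1)] sect_subset[OF L(1)] prod2[OF N1(1) N2(1)], of "p 2"] kill[of 2] N1 N2
      dim_sect_2[OF dim3 L]
    by (simp add: S1_def evm)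
  have k1: "ev (p i) s = 0" if "i \<in> {0, 1, 3}" "s \<in> S1" for i s
    using that(2) unfolding S1_def
    by (rule kill_step[rotated 2]) (use that(1) kill N1 N2 in \<open>auto simp: evm\<close>)
  have 2: "Vec.fd S2 \<and> S2 \<subseteq> R 2 \<and> Vec.dim S2 = 9"
    using step[of S1 "N3 * N4" "p 0"] prod2[OF N3(1) N4(1)] k1[of 0] 1 N3 N4 by (simp add: S2_def evm)
  have k2: "ev (p i) s = 0" if "i \<in> {1, 3}" "s \<in> S2" for i s
    using that(2) unfolding S2_def
    by (rule kill_step[rotated 2]) (use that(1) k1 N3 N4 in \<open>auto simp: evm\<close>)
  have 3: "Vec.fd S3 \<and> S3 \<subseteq> R 2 \<and> Vec.dim S3 = 10"
    using step[of S2 "N5 * N5" "p 1"] prod2[OF N5(1) N5(1)] k2[of 1] 2 N5 by (simp add: S3_def evm)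
  have k3: "ev (p 3) s = 0" if "s \<in> S3" for s
    using that unfolding S3_def
    by (rule kill_step[rotated 2]) (use k2[of 3] N5 in \<open>auto simp: evm\<close>)
  have 4: "Vec.fd S4 \<and> S4 \<subseteq> R 2 \<and> Vec.dim S4 = 11"
    using step[of S3 "N6 * N6" "p 3"] prod2[OF N6(1) N6(1)] k3 3 N6 by (simp add: S4_def evm)
  then have "11 \<le> Vec.dim (R 2)" using Vec.dim_mono_fd[OF fd_forms, of S4 2] by simp
  then show False by (simp add: dim_forms_2)
qed

text \<open>Each \<open>M\<close> is chosen off the forms vanishing at the earlier points, so its
  base point is a new one. Of four such points three are collinear, and a quadric with three zeros
  on a line vanishes on all of it.\<close>

lemma base_line:
  assumes dim3: "Vec.dim (Id 2) = 3" and L: "L \<in> R (Suc 0)" "L \<noteq> 0" "L \<notin> reducers"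
    and growth: "4 \<le> cdim L 3"
  obtains p q where "p \<noteq> (\<lambda>_. 0)" "\<forall>c. q \<noteq> (\<lambda>v. c * p v)"
    "\<forall>a b. base_point (\<lambda>v. a * p v + b * q v)" "\<forall>a b. ev (\<lambda>v. a * p v + b * q v) L = 0"
proof -
  note thin_sp = thin_special[OF dim3 L]
  have point: "\<exists>p. p \<noteq> (\<lambda>_. 0) \<and> ev p L = 0 \<and> base_point p \<and> ev p M = 0"
    if M: "M \<in> R (Suc 0)" "M \<notin> special L" for M
    by (rule base_point_unique[OF dim3 L growth M]) blast
  let ?Z = "\<lambda>p. {N \<in> R (Suc 0). ev p N = 0}"
  obtain M0 where M0: "M0 \<in> R (Suc 0)" "M0 \<notin> special L"
    by (rule thin_obtain[OF infinite_field thin_sp])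
  obtain p0 where p0: "p0 \<noteq> (\<lambda>_. 0)" "ev p0 L = 0" "base_point p0" using point[OF M0] by blast
  note t1 = thin_Un[OF thin_sp thin_vanishing[OF p0(1)]]
  obtain M1 where M1: "M1 \<in> R (Suc 0)" "M1 \<notin> special L \<union> ?Z p0"
    by (rule thin_obtain[OF infinite_field t1])
  obtain p1 where p1: "p1 \<noteq> (\<lambda>_. 0)" "ev p1 L = 0" "base_point p1" "ev p1 M1 = 0" using point[of M1] M1 by blast
  note t2 = thin_Un[OF t1 thin_vanishing[OF p1(1)]]
  obtain M2 where M2: "M2 \<in> R (Suc 0)" "M2 \<notin> special L \<union> ?Z p0 \<union> ?Z p1"
    by (rule thin_obtain[OF infinite_field t2])
  obtain p2 where p2: "p2 \<noteq> (\<lambda>_. 0)" "ev p2 L = 0" "base_point p2" "ev p2 M2 = 0" using point[of M2] M2 by blast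
  note t3 = thin_Un[OF t2 thin_vanishing[OF p2(1)]]
  obtain M3 where M3: "M3 \<in> R (Suc 0)" "M3 \<notin> special L \<union> ?Z p0 \<union> ?Z p1 \<union> ?Z p2"
    by (rule thin_obtain[OF infinite_field t3])
  obtain p3 where p3: "p3 \<noteq> (\<lambda>_. 0)" "ev p3 L = 0" "base_point p3" "ev p3 M3 = 0" using point[of M3] M3 by blast
  define p where "p = (\<lambda>i::nat. if i = 0 then p0 else if i = 1 then p1 else if i = 2 then p2 else p3)"
  have nm: "p i \<noteq> (\<lambda>v. c * p k v) \<and> p k \<noteq> (\<lambda>v. c * p i v)" if ik: "k < i" "i < 4" for i k c
  proof -
    have "\<exists>N\<in>R (Suc 0). ev (p i) N = 0 \<and> ev (p k) N \<noteq> 0"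
    proof -
      consider "i = 1" "k = 0" | "i = 2" "k = 0 \<or> k = 1" | "i = 3" "k = 0 \<or> k = 1 \<or> k = 2" using ik by linarith
      then show ?thesis
      proof cases
        case 1
        then show ?thesis using M1 p1(4) by (intro bexI[of _ M1]) (auto simp: p_def)
      next
        case 2
        then show ?thesis using M2 p2(4) by (intro bexI[of _ M2]) (auto simp: p_def)
      next
        case 3
        then show ?thesis using M3 p3(4) by (intro bexI[of _ M3]) (auto simp: p_def)
      qed
    qed
    then obtain N where N: "N \<in> R (Suc 0)" "ev (p i) N = 0" "ev (p k) N \<noteq> 0" by blast
    have "p i \<noteq> (\<lambda>_. 0)" using p0(1) p1(1) p2(1) p3(1) by (simp add: p_def)
    then show ?thesis using not_multiple[OF N(1,3,2)] by blast
  qed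
  have "\<exists>a b. p 2 = (\<lambda>v. a * p 0 v + b * p 1 v)"
  proof (rule base_points_collinear[OF dim3 L])
    show "base_point (p i) \<and> ev (p i) L = 0 \<and> p i \<noteq> (\<lambda>_. 0)" for i
      using p0 p1 p2 p3 by (simp add: p_def)
    show "p i \<noteq> (\<lambda>v. c * p k v)" if "i < 4" "k < 4" "i \<noteq> k" for i k c
      using nm[of k i c] nm[of i k c] that by (metis nat_neq_iff)
  qed
  then obtain a b where ab: "p2 = (\<lambda>v. a * p0 v + b * p1 v)" by (auto simp: p_def)
  have "a \<noteq> 0" using nm[of 1 2 b] ab by (auto simp: p_def)
  moreover have "b \<noteq> 0" using nm[of 0 2 a] ab by (auto simp: p_def)
  \<comment> \<open>At \<open>p2\<close> the polarized formula reduces to \<open>a * b\<close> times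
    the cross term, and \<open>a\<close> and \<open>b\<close> are nonzero.\<close>
  ultimately have cross: "ev (\<lambda>v. p0 v + p1 v) q - ev p0 q - ev p1 q = 0" if q: "q \<in> Id 2" for q
    using quadric_ev[of q a p0 b p1 0 p0] q p0(3) p1(3) p2(3)
    by (simp add: base_point_def flip: ab)
  show thesis
  proof (rule that)
    show "p0 \<noteq> (\<lambda>_. 0)" by (rule p0(1))
    show "\<forall>c. p1 \<noteq> (\<lambda>v. c * p0 v)"
    proof
      show "p1 \<noteq> (\<lambda>v. c * p0 v)" for c using nm[of 0 1 c] by (simp add: p_def)
    qed
    have "base_point (\<lambda>v. a * p0 v + b * p1 v)" for a b
      using quadric_ev[of _ a p0 b p1 0 p0] cross p0(3) p1(3) by (simp add: base_point_def)
    then show "\<forall>a b. base_point (\<lambda>v. a * p0 v + b * p1 v)" by blast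
    show "\<forall>a b. ev (\<lambda>v. a * p0 v + b * p1 v) L = 0"
      unfolding ev_linear_comb[OF L(1)] using p0(2) p1(2) by simp
  qed
qed

text \<open>The cone over a line of base points in the plane \<open>L = 0\<close>. A nonzero point
  on every hyperplane expresses dimension at least two without choosing a basis.\<close>

definition base_line_of :: "'k poly4 \<Rightarrow> (var4 \<Rightarrow> 'k) set \<Rightarrow> bool" where
  "base_line_of L T \<longleftrightarrow> (\<forall>x\<in>T. \<forall>y\<in>T. \<forall>a b. (\<lambda>v. a * x v + b * y v) \<in> T) \<and>
    (\<forall>x\<in>T. base_point x \<and> ev x L = 0) \<and>
    (\<forall>N\<in>R (Suc 0). \<exists>x\<in>T. x \<noteq> (\<lambda>_. 0) \<and> ev x N = 0)"

lemma base_line_ofD: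
  assumes "base_line_of L T"
  shows "x \<in> T \<Longrightarrow> y \<in> T \<Longrightarrow> (\<lambda>v. a * x v + b * y v) \<in> T"
    and "x \<in> T \<Longrightarrow> base_point x" "x \<in> T \<Longrightarrow> ev x L = 0"
    and "N \<in> R (Suc 0) \<Longrightarrow> \<exists>x\<in>T. x \<noteq> (\<lambda>_. 0) \<and> ev x N = 0"
  using assms by (simp_all add: base_line_of_def)

lemma base_line_exists:
  assumes dim3: "Vec.dim (Id 2) = 3" and L: "L \<in> R (Suc 0)" "L \<noteq> 0" "L \<notin> reducers"
    and growth: "4 \<le> cdim L 3"
  obtains T where "base_line_of L T"
proof -
  obtain p q where pq: "p \<noteq> (\<lambda>_. 0)" "\<forall>c. q \<noteq> (\<lambda>v. c * p v)"
    "\<forall>a b. base_point (\<lambda>v. a * p v + b * q v)" "\<forall>a b. ev (\<lambda>v. a * p v + b * q v) L = 0"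
    by (rule base_line[OF dim3 L growth])
  define T where "T = {x. \<exists>a b. x = (\<lambda>v. a * p v + b * q v)}"
  have "base_line_of L T"
    unfolding base_line_of_def
  proof (intro conjI ballI allI)
    fix x y a b assume "x \<in> T" "y \<in> T"
    then obtain a1 b1 a2 b2 where "x = (\<lambda>v. a1 * p v + b1 * q v)" "y = (\<lambda>v. a2 * p v + b2 * q v)"
      unfolding T_def by blast
    then have "(\<lambda>v. a * x v + b * y v) = (\<lambda>v. (a * a1 + b * a2) * p v + (a * b1 + b * b2) * q v)"
      by (auto simp: algebra_simps)
    then show "(\<lambda>v. a * x v + b * y v) \<in> T" unfolding T_def by blast
  next
    fix x assume "x \<in> T"
    then show "base_point x" "ev x L = 0" using pq(3,4) by (auto simp: T_def)
  next
    fix N :: "'k poly4" assume N: "N \<in> R (Suc 0)"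
    show "\<exists>x\<in>T. x \<noteq> (\<lambda>_. 0) \<and> ev x N = 0"
    proof (cases "ev p N = 0")
      case True
      have "p = (\<lambda>v. 1 * p v + 0 * q v)" by simp
      then have "p \<in> T" unfolding T_def by blast
      then show ?thesis using True pq(1) by blast
    next
      case False
      let ?x = "\<lambda>v. (- ev q N / ev p N) * p v + 1 * q v"
      have "?x \<in> T" unfolding T_def by blast
      moreover have "ev ?x N = 0" unfolding ev_linear_comb[OF N] using False by simp
      moreover have "?x \<noteq> (\<lambda>_. 0)"
      proof
        assume "?x = (\<lambda>_. 0)"
        then have "q v = (ev q N / ev p N) * p v" for v
          by (drule_tac fun_cong[of _ _ v]) (simp add: algebra_simps add_eq_0_iff)
        then show False using pq(2) by blast
      qed
      ultimately show ?thesis by blast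
    qed
  qed
  then show thesis by (rule that)
qed

text \<open>The base lines in three general planes meet pairwise, by uniqueness of the base point
  on the intersection of two of these planes, and so they span a base plane.\<close>

lemma quadrics_common_factor:
  assumes dim3: "Vec.dim (Id 2) = 3" and growth: "\<And>L. L \<in> R (Suc 0) \<Longrightarrow> L \<noteq> 0 \<Longrightarrow> 4 \<le> cdim L 3"
  obtains l where "l \<in> R (Suc 0)" "l \<noteq> 0" "Id 2 \<subseteq> lmul l 2"
proof -
  note t0 = thin_Un[OF thin_zero thin_reducers[OF eq_refl[OF dim3]]]
  obtain L1 where "L1 \<in> R (Suc 0)" "L1 \<notin> {0} \<union> reducers"
    by (rule thin_obtain[OF infinite_field t0])
  then have L1: "L1 \<in> R (Suc 0)" "L1 \<noteq> 0" "L1 \<notin> reducers" by auto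
  note t1 = thin_Un[OF t0 thin_special[OF dim3 L1]]
  obtain L2 where "L2 \<in> R (Suc 0)" "L2 \<notin> {0} \<union> reducers \<union> special L1"
    by (rule thin_obtain[OF infinite_field t1])
  then have L2: "L2 \<in> R (Suc 0)" "L2 \<noteq> 0" "L2 \<notin> reducers" and s12: "L2 \<notin> special L1" by auto
  define meet_at where "meet_at L M p \<longleftrightarrow> p \<noteq> (\<lambda>_. 0) \<and> ev p L = 0 \<and> ev p M = 0 \<and> base_point p \<and>
      (\<forall>r. ev r L = 0 \<longrightarrow> ev r M = 0 \<longrightarrow> base_point r \<longrightarrow> (\<exists>c. r = (\<lambda>v. c * p v)))" for L M p
  have meet_atD: "p \<noteq> (\<lambda>_. 0)" "ev p L = 0" "ev p M = 0" "base_point p" if "meet_at L M p" for L M p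
    using that unfolding meet_at_def by simp_all
  have meet_at_unique: "\<exists>c. r = (\<lambda>v. c * p v)"
    if m: "meet_at L M p" and r: "ev r L = 0" "ev r M = 0" "base_point r" for L M p r
    using m[unfolded meet_at_def, THEN conjunct2, THEN conjunct2, THEN conjunct2, THEN conjunct2,
        THEN spec, THEN mp, OF r(1), THEN mp, OF r(2), THEN mp, OF r(3)] .
  have uniq: "\<exists>p. meet_at L M p"
    if L: "L \<in> R (Suc 0)" "L \<noteq> 0" "L \<notin> reducers" and M: "M \<in> R (Suc 0)" "M \<notin> special L" for L M
    unfolding meet_at_def by (rule base_point_unique[OF dim3 L growth[OF L(1,2)] M]) blast
  obtain u where u0: "meet_at L1 L2 u" using uniq[OF L1 L2(1) s12] ..
  note u = meet_atD[OF u0] meet_at_unique[OF u0]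
  note t2 = thin_Un[OF thin_Un[OF t1 thin_special[OF dim3 L2]] thin_vanishing[OF u(1)]]
  obtain L3 where "L3 \<in> R (Suc 0)"
      "L3 \<notin> {0} \<union> reducers \<union> special L1 \<union> special L2 \<union> {N \<in> R (Suc 0). ev u N = 0}"
    by (rule thin_obtain[OF infinite_field t2])
  then have L3: "L3 \<in> R (Suc 0)" "L3 \<noteq> 0" "L3 \<notin> reducers"
    and s13: "L3 \<notin> special L1" and s23: "L3 \<notin> special L2" and uL3: "ev u L3 \<noteq> 0" by auto
  obtain v1 where v10: "meet_at L1 L3 v1" using uniq[OF L1 L3(1) s13] ..
  note v1 = meet_atD[OF v10] meet_at_unique[OF v10]
  obtain v2 where v20: "meet_at L2 L3 v2" using uniq[OF L2 L3(1) s23] ..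
  note v2 = meet_atD[OF v20] meet_at_unique[OF v20]
  obtain T1 where T1: "base_line_of L1 T1" by (rule base_line_exists[OF dim3 L1 growth[OF L1(1,2)]])
  obtain T2 where T2: "base_line_of L2 T2" by (rule base_line_exists[OF dim3 L2 growth[OF L2(1,2)]])
  obtain T3 where T3: "base_line_of L3 T3" by (rule base_line_exists[OF dim3 L3 growth[OF L3(1,2)]])
  have scale: "(\<lambda>v. c * x v) \<in> T" if T: "base_line_of L T" "x \<in> T" for T L x c
    using base_line_ofD(1)[OF T(1,2) T(2), of c 0] by simp
  \<comment> \<open>The line meets \<open>N = 0\<close> in some nonzero base point, which by
    uniqueness is a multiple of \<open>w\<close>.\<close>
  have meet: "w \<in> T"
    if T: "base_line_of L T" and N: "N \<in> R (Suc 0)" and w: "meet_at L N w \<or> meet_at N L w" for L T N w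
  proof -
    obtain x where x: "x \<in> T" "x \<noteq> (\<lambda>_. 0)" "ev x N = 0" using base_line_ofD(4)[OF T N] by auto
    note bx = base_line_ofD(2,3)[OF T x(1)]
    have "\<exists>c. x = (\<lambda>v. c * w v)"
      using w meet_at_unique[OF _ bx(2) x(3) bx(1)] meet_at_unique[OF _ x(3) bx(2) bx(1)] by (elim disjE)
    then obtain c where c: "x = (\<lambda>v. c * w v)" ..
    then have "c \<noteq> 0" using x(2) by auto
    then have "w = (\<lambda>v. inverse c * x v)" using c by auto
    then show ?thesis using scale[OF T x(1), of "inverse c"] by simp
  qed
  have uT: "u \<in> T1" "u \<in> T2" using meet[OF T1 L2(1)] meet[OF T2 L1(1)] u0 by simp_all
  have v1T: "v1 \<in> T1" "v1 \<in> T3" using meet[OF T1 L3(1)] meet[OF T3 L1(1)] v10 by simp_all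
  have v2T: "v2 \<in> T2" "v2 \<in> T3" using meet[OF T2 L3(1)] meet[OF T3 L2(1)] v20 by simp_all
  define p where "p = (\<lambda>i::nat. if i = 0 then u else if i = 1 then v1 else v2)"
  have nm1: "v1 \<noteq> (\<lambda>v. c * u v)" for c by (rule not_multiple(1)[OF L3(1) uL3 v1(3,1)])
  \<comment> \<open>A relation restricted to \<open>L3\<close> has \<open>a = 0\<close>, as only
    \<open>u\<close> is off that plane. Then \<open>v1\<close> is a multiple of \<open>v2\<close>,
    lies on all three planes and is a multiple of \<open>u\<close>, which is impossible.\<close>
  have nm2: "v2 \<noteq> (\<lambda>v. a * u v + b * v1 v)" for a b
  proof
    assume eq: "v2 = (\<lambda>v. a * u v + b * v1 v)"
    have "0 = a * ev u L3 + b * ev v1 L3"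
      using v2(3) unfolding eq ev_linear_comb[OF L3(1)] by simp
    then have "a = 0" using uL3 v1(3) by simp
    then have eq': "v2 = (\<lambda>v. b * v1 v)" using eq by simp
    then have "b \<noteq> 0" using v2(1) by auto
    then have "v1 = (\<lambda>v. inverse b * v2 v)" using eq' by auto
    then have "v1 \<in> T2" using scale[OF T2 v2T(1), of "inverse b"] by simp
    then have "ev v1 L2 = 0" by (rule base_line_ofD(3)[OF T2])
    then have "\<exists>c. v1 = (\<lambda>v. c * u v)" by (rule u(5)[OF v1(2) _ v1(4)])
    then obtain c where "v1 = (\<lambda>v. c * u v)" ..
    then show False using nm1[of c] by simp
  qed
  \<comment> \<open>By polarization a quadric vanishes on the span once it vanishes at the three
    points and at their pairwise sums, and each pair lies on one of the three base lines.\<close>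
  have comb_base: "base_point (\<lambda>v. a * u v + b * v1 v + c * v2 v)" for a b c
  proof -
    have pair: "ev (\<lambda>v. x v + y v) q = 0" if T: "base_line_of L T" "x \<in> T" "y \<in> T" and q: "q \<in> Id 2" for L T x y q
    proof -
      have "(\<lambda>v. x v + y v) \<in> T" using base_line_ofD(1)[OF T, of 1 1] by simp
      then have "base_point (\<lambda>v. x v + y v)" by (rule base_line_ofD(2)[OF T(1)])
      then show ?thesis using q by (simp add: base_point_def)
    qed
    have "ev (\<lambda>v. a * u v + b * v1 v + c * v2 v) q = 0" if q: "q \<in> Id 2" for q
      using quadric_ev[of q a u b v1 c v2] q u(4) v1(4) v2(4)
        pair[OF T1 uT(1) v1T(1) q] pair[OF T2 uT(2) v2T(1) q] pair[OF T3 v1T(2) v2T(2) q]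
      by (simp add: base_point_def)
    then show ?thesis by (simp add: base_point_def)
  qed
  have indep3: "indep_points f 3" if f: "f 0 = u" "f 1 = v1" "f 2 = v2" for f
  proof -
    have f1: "f (Suc 0) = v1" using f(2) by simp
    have "indep_points f (Suc 0)"
      by (rule indep_points_Suc[OF indep_points_0]) (use u(1) f(1) in simp)
    then have "indep_points f (Suc (Suc 0))"
      by (rule indep_points_Suc) (use nm1 f f1 in simp)
    then have "indep_points f (Suc (Suc (Suc 0)))"
      by (rule indep_points_Suc) (use nm2 f f1 in \<open>simp add: numeral_2_eq_2\<close>)
    then show ?thesis by (simp add: numeral_3_eq_3)
  qed
  have "Vec.dim (R (Suc 0)) \<le> card {0, 1, 2::nat} + Vec.dim {N \<in> R (Suc 0). \<forall>i\<in>{0, 1, 2::nat}. ev (p i) N = 0}"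
    by (rule Vec.dim_kernel_functionals(2)[OF fd_forms]) (auto simp: ev.subst_add ev.subst_pscale)
  then have "0 < Vec.dim {N \<in> R (Suc 0). \<forall>i\<in>{0, 1, 2::nat}. ev (p i) N = 0}"
    by (simp add: dim_forms_1)
  then have "\<not> {N \<in> R (Suc 0). \<forall>i\<in>{0, 1, 2::nat}. ev (p i) N = 0} \<subseteq> {0}"
    using Vec.dim_le_card[of "{N \<in> R (Suc 0). \<forall>i\<in>{0, 1, 2::nat}. ev (p i) N = 0}" "{}"] by auto
  then obtain l where l: "l \<in> R (Suc 0)" "l \<noteq> 0" "ev u l = 0" "ev v1 l = 0" "ev v2 l = 0"
    by (auto simp: p_def)
  show thesis
  proof (rule that[OF l(1,2)])
    show "Id 2 \<subseteq> lmul l 2"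
    proof
      fix q assume q: "q \<in> Id 2"
      show "q \<in> lmul l 2"
      proof (rule vanishing_imp_lmul[OF infinite_field l(1,2)])
        show "q \<in> forms 2" using q by simp
        fix z assume z: "ev z l = 0"
        define f where "f = (\<lambda>i::nat. if i = 3 then z else p i)"
        have f: "f 0 = u" "f 1 = v1" "f 2 = v2" "f 3 = z" by (simp_all add: f_def p_def)
        \<comment> \<open>Otherwise \<open>z\<close> would be a fourth independent zero of
          \<open>l\<close>, forcing \<open>l = 0\<close>.\<close>
        have "\<exists>a. f 3 = (\<lambda>v. \<Sum>i<3. a i * f i v)"
        proof (rule ccontr)
          assume "\<nexists>a. f 3 = (\<lambda>v. \<Sum>i<3. a i * f i v)"
          then have "indep_points f (Suc 3)"
            by (intro indep_points_Suc indep3 f(1-3)) blast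
          then have i4: "indep_points f 4" by simp
          have "ev (f i) l = 0" if "i < 4" for i
          proof -
            have "i = 0 \<or> i = 1 \<or> i = 2 \<or> i = 3" using that by linarith
            then show ?thesis using f l(3-5) z by auto
          qed
          then have "l = 0" by (rule indep_points_4[OF i4 l(1)])
          then show False using l(2) by simp
        qed
        then obtain a where "f 3 = (\<lambda>v. \<Sum>i<3. a i * f i v)" by blast
        then have "z = (\<lambda>v. a 0 * u v + a 1 * v1 v + a 2 * v2 v)"
          using f by (simp add: numeral_3_eq_3 numeral_2_eq_2)
        then show "ev z q = 0" using comb_base q by (simp add: base_point_def)
      qed
    qed
  qed
qed

end

section \<open>Ideals whose quadrics have a common factor\<close>

context graded_gorenstein
begin

text \<open>\<open>L\<close> is prime and does not divide \<open>l\<close>. In terms of points: a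
  zero of \<open>L\<close> where \<open>g\<close> is nonzero can be moved along \<open>e\<close>
  inside \<open>L = 0\<close> to one where \<open>l\<close> is nonzero too.\<close>

lemma mult_lmul_divides:
  assumes L: "L \<in> R (Suc 0)" "L \<noteq> 0" and l: "l \<in> R (Suc 0)" "l \<notin> Vec.span {L}"
    and g: "g \<in> R d" and lg: "l * g \<in> lmul L (Suc d)"
  shows "g \<in> lmul L d"
proof (rule vanishing_imp_lmul[OF infinite_field L g])
  fix z assume z: "ev z L = 0"
  obtain e where e: "\<forall>t\<in>Vec.span {L}. ev e t = 0" "ev e l = 1"
    by (rule point_separates[OF Vec.subspace_span _ l]) (use L in \<open>simp_all add: Vec.span_minimal subspace_forms\<close>)
  have eL: "ev e L = 0" using e(1) by (simp add: Vec.span_base)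
  have zero: "ev y l * ev y g = 0" if y: "ev y L = 0" for y
  proof -
    obtain h where "l * g = L * h" using lg by (auto simp: lmul_Suc)
    then have "ev y (l * g) = ev y (L * h)" by simp
    then show ?thesis using y by (simp add: ev.subst_mult)
  qed
  show "ev z g = 0"
  proof (rule ccontr)
    assume nz: "ev z g \<noteq> 0"
    then have zl: "ev z l = 0" using zero[OF z] by simp
    obtain s where s: "s \<noteq> 0" "ev (\<lambda>v. z v + s * e v) g \<noteq> 0"
      using ev_nonzero_on_line[OF infinite_field nz, of e] by blast
    have lin: "ev (\<lambda>v. z v + s * e v) N = ev z N + s * ev e N" if "N \<in> R (Suc 0)" for N
      using ev_linear_comb[OF that, of 1 z s e] by simp
    show False using zero[of "\<lambda>v. z v + s * e v"] s lin[OF L(1)] lin[OF l(1)] z eL zl e(2) by simp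
  qed
qed

text \<open>Two independent linear forms form a regular sequence: their multiples overlap only in
  multiples of the product, so the codimension is at most a second difference of
  \<open>dim R\<close>.\<close>

lemma dim_two_multiples:
  assumes L: "L \<in> R (Suc 0)" "L \<noteq> 0" and l: "l \<in> R (Suc 0)" "l \<notin> Vec.span {L}"
  shows "Vec.dim (R (n + 2)) \<le> Vec.dim (Vec.vsum (lmul l (n + 2)) (lmul L (n + 2))) + n + 3"
proof -
  have l0: "l \<noteq> 0" using l(2) Vec.span_zero by auto
  let ?B = "lmul L (Suc n)"
  have "lmul l (n + 2) \<inter> lmul L (n + 2) \<subseteq> (*) l ` ?B"
  proof
    fix x assume "x \<in> lmul l (n + 2) \<inter> lmul L (n + 2)"
    then have xl: "x \<in> lmul l (Suc (Suc n))" and xL: "x \<in> lmul L (Suc (Suc n))" by simp_all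
    obtain g where g: "g \<in> R (Suc n)" "x = l * g" using xl unfolding lmul_Suc by blast
    then have "g \<in> ?B" using mult_lmul_divides[OF L l g(1)] xL by simp
    then show "x \<in> (*) l ` ?B" unfolding g(2) by (rule imageI)
  qed
  moreover have img: "Vec.fd ((*) l ` ?B)" "Vec.dim ((*) l ` ?B) = Vec.dim ?B"
    by (rule Vec.dim_image_inj_fd[OF linear_mult fd_lmul[OF L(1)]]; use l0 in auto)+
  ultimately have "Vec.dim (lmul l (n + 2) \<inter> lmul L (n + 2)) \<le> Vec.dim ((*) l ` ?B)"
    by (intro Vec.dim_mono_fd)
  then have "Vec.dim (lmul l (n + 2) \<inter> lmul L (n + 2)) \<le> Vec.dim (R n)"
    unfolding img(2) dim_lmul[OF L(2)] .
  moreover have "Vec.dim (Vec.vsum (lmul l (n + 2)) (lmul L (n + 2))) +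
      Vec.dim (lmul l (n + 2) \<inter> lmul L (n + 2)) = Vec.dim (R (n + 1)) + Vec.dim (R (n + 1))"
    using Vec.dim_vsum_Int[OF fd_lmul[OF l(1)] fd_lmul[OF L(1)], of "n + 2" "n + 2"]
      dim_lmul[OF l0, of "n + 1"] dim_lmul[OF L(2), of "n + 1"] by simp
  ultimately show ?thesis using dim_forms_second_difference[where 'k = 'k, of n] by linarith
qed

text \<open>Two conditions on the four-dimensional space of linear forms leave a solution space of
  dimension at least two, too large for the multiples of \<open>l\<close>.\<close>

lemma linear_form_through_points:
  assumes "finite A" "card A \<le> 2"
  obtains P where "P \<in> R (Suc 0)" "\<And>p. p \<in> A \<Longrightarrow> ev p P = 0" "P \<notin> Vec.span {l}"
proof -
  let ?K = "{N \<in> R (Suc 0). \<forall>p\<in>A. ev p N = 0}"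
  have K: "Vec.dim (R (Suc 0)) \<le> card A + Vec.dim ?K"
    by (rule Vec.dim_kernel_functionals(2)[OF fd_forms assms(1)]) (auto simp: ev.subst_add ev.subst_pscale)
  have "\<not> ?K \<subseteq> Vec.span {l}"
  proof
    assume "?K \<subseteq> Vec.span {l}"
    then have "Vec.dim ?K \<le> 1" using Vec.dim_le_card[of ?K "{l}"] by simp
    then show False using K assms(2) by (simp add: dim_forms_1)
  qed
  then show thesis using that by blast
qed

context
  fixes l :: "'k poly4"
  assumes l: "l \<in> R (Suc 0)" "l \<noteq> 0" and quadrics: "Id 2 \<subseteq> lmul l 2"
    and dim_quadrics: "Vec.dim (Id 2) = 3" and no_linear: "Id (Suc 0) = {0}"
begin

lemma dim_Id_eq_colon:
  assumes "Id (Suc e) \<subseteq> lmul l (Suc e)"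
  shows "Vec.dim (Id (Suc e)) = Vec.dim (colon l e)"
proof -
  have "Id (Suc e) = (*) l ` colon l e"
    using assms forms_mult_linear[OF l(1)] by (fastforce simp: lmul_Suc colon_def)
  moreover have "Vec.dim ((*) l ` colon l e) = Vec.dim (colon l e)"
    by (rule Vec.dim_image_inj_fd(2)[OF linear_mult Vec.fd_subset[OF fd_forms subspace_colon colon_subset]])
      (use l in auto)
  ultimately show ?thesis by simp
qed

lemma dim_colon_1: "Vec.dim (colon l (Suc 0)) = 3"
  using dim_Id_eq_colon[of "Suc 0"] quadrics dim_quadrics by (simp add: numeral_2_eq_2)

lemma colon_1_complement:
  assumes N: "N \<in> R (Suc 0)" "N \<notin> colon l (Suc 0)" and P: "P \<in> R (Suc 0)"
  obtains n b where "n \<in> colon l (Suc 0)" "P = n + pscale b N"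
proof -
  have fd: "Vec.fd (colon l (Suc 0))" by (rule Vec.fd_subset[OF fd_forms subspace_colon colon_subset])
  have "Vec.vsum (colon l (Suc 0)) (Vec.span {N}) = R (Suc 0)"
  proof (rule Vec.subspace_eq_if_dim_le[OF fd_forms])
    show "Vec.subspace (Vec.vsum (colon l (Suc 0)) (Vec.span {N}))"
      by (intro Vec.subspace_vsum subspace_colon Vec.subspace_span)
    show "Vec.vsum (colon l (Suc 0)) (Vec.span {N}) \<subseteq> R (Suc 0)"
      using N(1) by (intro Vec.vsum_least subspace_forms colon_subset Vec.span_minimal) auto
    show "Vec.dim (R (Suc 0)) \<le> Vec.dim (Vec.vsum (colon l (Suc 0)) (Vec.span {N}))"
      using Vec.dim_span_insert[OF fd N(2)] by (simp add: dim_colon_1 dim_forms_1)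
  qed
  then have "P \<in> Vec.vsum (colon l (Suc 0)) (Vec.span {N})" using P by simp
  then obtain n w where "n \<in> colon l (Suc 0)" "w \<in> Vec.span {N}" "P = n + w" by (rule Vec.vsumE)
  then show thesis using that by (auto simp: Vec.span_singleton)
qed

lemma colon_1_proper: obtains N where "N \<in> R (Suc 0)" "N \<notin> colon l (Suc 0)"
proof -
  have "colon l (Suc 0) \<noteq> R (Suc 0)" using dim_colon_1 dim_forms_1[where 'k = 'k] by auto
  then show thesis using that colon_subset by blast
qed

lemma mult_colon: "u \<in> colon l e \<Longrightarrow> f \<in> R i \<Longrightarrow> f * u \<in> colon l (i + e)"
  using mult_I[of "l * u" f] by (auto simp: colon_def forms_mult mult.left_commute)

text \<open>The three linear forms in \<open>colon l 1\<close> cut out a point, so modulo them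
  degree \<open>e\<close> is spanned by \<open>N ^ e\<close>. The colon is not everything: fullness
  would propagate up to degree \<open>j - 1\<close>, and duality would put \<open>l\<close> into
  I.\<close>

lemma dim_colon:
  assumes "e + 1 \<le> j"
  shows "Vec.dim (R e) = Vec.dim (colon l e) + 1"
proof (rule antisym)
  obtain N where N: "N \<in> R (Suc 0)" "N \<notin> colon l (Suc 0)" by (rule colon_1_proper)
  have pow: "N ^ e \<in> R e" for e
    by (induction e) (auto intro: forms_mult_linear[OF N(1)])
  have dec: "R e \<subseteq> Vec.vsum (colon l e) (Vec.span {N ^ e})" for e
  proof (induction e)
    case 0
    show ?case
      using Vec.vsum_right[OF subspace_colon, of "Vec.span {1}" l 0] by (simp add: forms_0 Vec.span_singleton)
  next
    case (Suc e)
    let ?S = "Vec.vsum (colon l (Suc e)) (Vec.span {N ^ Suc e})"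
    have S: "Vec.subspace ?S" by (intro Vec.subspace_vsum subspace_colon Vec.subspace_span)
    show ?case
    proof (rule forms_Suc_subset[OF S])
      fix v :: var4 and g assume "g \<in> R e"
      then have "g \<in> Vec.vsum (colon l e) (Vec.span {N ^ e})" using Suc.IH by blast
      then obtain u w where uw: "u \<in> colon l e" "w \<in> Vec.span {N ^ e}" "g = u + w" by (rule Vec.vsumE)
      obtain c where c: "w = pscale c (N ^ e)" using uw(2) by (auto simp: Vec.span_singleton)
      obtain n b where nb: "n \<in> colon l (Suc 0)" "pvar v = n + pscale b N"
        by (rule colon_1_complement[OF N pvar_in_forms])
      have eq: "pvar v * g = (pvar v * u + pscale c (N ^ e * n)) + pscale (c * b) (N ^ Suc e)"
        unfolding uw(3) c by (simp add: nb(2) algebra_simps)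
      have "pvar v * u + pscale c (N ^ e * n) \<in> colon l (Suc e)"
        using mult_colon[OF uw(1) pvar_in_forms] mult_colon[OF nb(1) pow]
        by (intro Vec.subspace_add[OF subspace_colon] Vec.subspace_scale[OF subspace_colon]) simp_all
      then show "pvar v * g \<in> ?S"
        unfolding eq by (rule Vec.vsumI) (intro Vec.span_scale Vec.span_base, simp)
    qed
  qed
  have fd: "Vec.fd (colon l e)" by (rule Vec.fd_subset[OF fd_forms subspace_colon colon_subset])
  have "Vec.dim (R e) \<le> Vec.dim (Vec.vsum (colon l e) (Vec.span {N ^ e}))"
    by (rule Vec.dim_mono_fd[OF Vec.fd_vsum[OF fd Vec.fdI_span] dec]) simp
  also have "\<dots> \<le> Vec.dim (colon l e) + 1"
    using Vec.dim_vsum_le[OF fd Vec.fdI_span[of "{N ^ e}"]] Vec.dim_span_singleton_le[of "N ^ e"] by simp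
  finally show "Vec.dim (R e) \<le> Vec.dim (colon l e) + 1" .
  have "colon l e \<noteq> R e"
  proof
    assume full: "colon l e = R e"
    have "R (e + n) \<subseteq> colon l (e + n)" for n
    proof (induction n)
      case (Suc n)
      have "R (Suc (e + n)) \<subseteq> colon l (Suc (e + n))"
        by (rule forms_Suc_subset[OF subspace_colon])
          (use mult_colon[OF _ pvar_in_forms, of _ "e + n"] Suc.IH in auto)
      then show ?case by simp
    qed (simp add: full)
    from this[of "j - 1 - e"] have "R (j - 1) \<subseteq> colon l (j - 1)" using assms by simp
    then have "l \<in> I" using duality[OF l(1), of "j - 1"] assms by (auto simp: colon_def)
    then show False using l no_linear by auto
  qed
  then show "Vec.dim (colon l e) + 1 \<le> Vec.dim (R e)"
    using Vec.dim_less_if_psubset[OF fd_forms subspace_colon colon_subset] by fastforce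
qed

text \<open>In both degrees I has dimension \<open>dim R - 1\<close> taken one degree lower, so the
  constants cancel and the second difference of \<open>dim R\<close> remains.\<close>

lemma hdim_common_factor:
  assumes i: "3 \<le> i" "i \<le> j" and sub: "Id i \<subseteq> lmul l i" "Id (i - 1) \<subseteq> lmul l (i - 1)"
  shows "int (hdim i) - int (hdim (i - 1)) = int i + 1"
proof -
  define n where "n = i - 2"
  have n: "i = n + 2" using i by (simp add: n_def)
  have 1: "Vec.dim (Id (n + 2)) + 1 = Vec.dim (R (n + 1))"
    using dim_Id_eq_colon[of "n + 1"] dim_colon[of "n + 1"] sub i n by simp
  have 2: "Vec.dim (Id (n + 1)) + 1 = Vec.dim (R n)"
    using dim_Id_eq_colon[of n] dim_colon[of n] sub i n by simp
  have "Vec.dim (R (n + 1)) \<le> Vec.dim (R (n + 2))" "Vec.dim (R n) \<le> Vec.dim (R (n + 1))"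
    by (simp_all add: dim_forms)
  then show ?thesis
    using 1 2 dim_forms_second_difference[where 'k = 'k, of n] n by (simp add: hdim_def)
qed

text \<open>\<open>L\<close> is chosen off the point \<open>z0\<close> defined by
  \<open>colon l 1\<close> and through a zero \<open>z\<close> of \<open>l\<close> at which
  \<open>f\<close> is nonzero. The first property puts the multiples of \<open>l\<close> into I +
  (L), the second keeps \<open>f\<close> outside (l, L), whose codimension in degree
  \<open>a\<close> is at most \<open>a + 1\<close>.\<close>

lemma cdim_new_generator:
  assumes a: "3 \<le> a" and f: "f \<in> Id a" "f \<notin> lmul l a"
  obtains L where "L \<in> R (Suc 0)" "L \<noteq> 0" "cdim L a \<le> a"
proof -
  obtain N where N: "N \<in> R (Suc 0)" "N \<notin> colon l (Suc 0)" by (rule colon_1_proper)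
  obtain z0 where z0: "\<forall>t\<in>colon l (Suc 0). ev z0 t = 0" "ev z0 N = 1"
    by (rule point_separates[OF subspace_colon colon_subset N])
  \<comment> \<open>\<open>P\<close> serves to tell \<open>z\<close> from \<open>z0\<close>: it
    vanishes at \<open>z0\<close>, and \<open>z\<close> is moved along \<open>e\<close> inside
    \<open>l = 0\<close> until \<open>P\<close> is nonzero there.\<close>
  obtain P where P: "P \<in> R (Suc 0)" "ev z0 P = 0" "P \<notin> Vec.span {l}"
    by (rule linear_form_through_points[of "{z0}" l]) auto
  obtain e where e: "\<forall>t\<in>Vec.span {l}. ev e t = 0" "ev e P = 1"
    by (rule point_separates[OF Vec.subspace_span _ P(1,3)]) (use l in \<open>simp_all add: Vec.span_minimal subspace_forms\<close>)
  have el: "ev e l = 0" using e(1) by (simp add: Vec.span_base)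
  have "\<exists>z. ev z l = 0 \<and> ev z f \<noteq> 0"
    using vanishing_imp_lmul[OF infinite_field l, of f a] f by blast
  then obtain z1 where z1: "ev z1 l = 0" "ev z1 f \<noteq> 0" by blast
  have "\<exists>z. ev z l = 0 \<and> ev z f \<noteq> 0 \<and> ev z P \<noteq> 0"
  proof (cases "ev z1 P = 0")
    case True
    obtain s where s: "s \<noteq> 0" "ev (\<lambda>v. z1 v + s * e v) f \<noteq> 0"
      using ev_nonzero_on_line[OF infinite_field z1(2), of e] by blast
    have lin: "ev (\<lambda>v. z1 v + s * e v) M = ev z1 M + s * ev e M" if "M \<in> R (Suc 0)" for M
      using ev_linear_comb[OF that, of 1 z1 s e] by simp
    show ?thesis
      using s z1(1) el e(2) True lin[OF l(1)] lin[OF P(1)] by (intro exI[of _ "\<lambda>v. z1 v + s * e v"]) simp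
  next
    case False
    then show ?thesis using z1 by blast
  qed
  then obtain z where z: "ev z l = 0" "ev z f \<noteq> 0" "ev z P \<noteq> 0" by blast
  have z0_nz: "z0 \<noteq> (\<lambda>_. 0)"
  proof
    assume "z0 = (\<lambda>_. 0)"
    then have "ev z0 N = 0" using ev_scale[OF N(1), of 0 z0] by simp
    then show False using z0(2) by simp
  qed
  have z_nz: "z \<noteq> (\<lambda>_. 0)"
  proof
    assume "z = (\<lambda>_. 0)"
    then have "ev z P = 0" using ev_scale[OF P(1), of 0 z] by simp
    then show False using z(3) by simp
  qed
  obtain M where M: "M \<in> R (Suc 0)" "ev z M = 0" "ev z0 M = 1"
  proof (rule separate_two_points[OF z_nz])
    show "z0 \<noteq> (\<lambda>v. c * z v)" for c by (rule not_multiple(1)[OF P(1) z(3) P(2) z0_nz])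
  qed
  \<comment> \<open>\<open>M\<close> might be a multiple of \<open>l\<close>. Adding
    \<open>Q\<close> repairs this without changing the values at \<open>z\<close> and
    \<open>z0\<close>.\<close>
  obtain Q where Q: "Q \<in> R (Suc 0)" "ev z Q = 0" "ev z0 Q = 0" "Q \<notin> Vec.span {l}"
    by (rule linear_form_through_points[of "{z, z0}" l]) (auto simp: card_insert_if)
  define L where "L = (if M \<in> Vec.span {l} then M + Q else M)"
  have L: "L \<in> R (Suc 0)" "ev z L = 0" "ev z0 L = 1"
    using M Q by (auto simp: L_def forms_add ev.subst_add)
  have Ll: "L \<notin> Vec.span {l}"
  proof (cases "M \<in> Vec.span {l}")
    case True
    show ?thesis
    proof
      assume "L \<in> Vec.span {l}"
      then have "L - M \<in> Vec.span {l}" using True by (rule Vec.span_diff)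
      then show False using Q(4) True by (simp add: L_def)
    qed
  qed (simp add: L_def)
  have L0: "L \<noteq> 0" using L(3) by auto
  have lL: "l \<notin> Vec.span {L}"
  proof
    assume "l \<in> Vec.span {L}"
    then obtain c where c: "l = pscale c L" by (auto simp: Vec.span_singleton)
    then have "c \<noteq> 0" using l(2) by auto
    then have "L = pscale (inverse c) l" using c by simp
    then show False using Ll by (auto simp: Vec.span_singleton)
  qed
  have LV: "L \<notin> colon l (Suc 0)" using z0(1) L(3) by auto
  define n where "n = a - 2"
  have n: "a = n + 2" using a by (simp add: n_def)
  let ?B = "Vec.vsum (lmul l a) (lmul L a)"
  have fdB: "Vec.fd ?B" by (intro Vec.fd_vsum fd_lmul l L)
  have an: "a = Suc (Suc n)" using n by simp
  have van: "ev z x = 0" if "x \<in> ?B" for x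
    using that by (rule Vec.vsumE) (auto simp: an lmul_Suc ev.subst_add ev.subst_mult z(1) L(2))
  then have fB: "f \<notin> ?B" using z(2) by blast
  \<comment> \<open>Each variable is some \<open>m\<close> with \<open>l * m\<close> in I plus a
    multiple of \<open>L\<close>, so \<open>l\<close> times any form of positive degree falls into I
    + (L).\<close>
  have "R (Suc n) \<subseteq> {g. l * g \<in> sect L a}"
  proof (rule forms_Suc_subset)
    show "Vec.subspace {g. l * g \<in> sect L a}"
      using subspace_sect[of L a] by (auto simp: Vec.subspace_def distrib_left)
    fix v :: var4 and g assume g: "g \<in> R n"
    obtain m b where mb: "m \<in> colon l (Suc 0)" "pvar v = m + pscale b L"
      by (rule colon_1_complement[OF L(1) LV pvar_in_forms])
    have eq: "l * (pvar v * g) = g * (l * m) + L * (pscale b (l * g))"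
      unfolding mb(2) by (simp add: algebra_simps)
    have "g * (l * m) \<in> I" using mb(1) mult_I by (simp add: colon_def)
    moreover have "g * (l * m) \<in> R (n + 2)"
      using forms_mult[OF g forms_mult_linear[OF l(1), of m "Suc 0"]] mb(1) by (simp add: colon_def)
    moreover have "L * (pscale b (l * g)) \<in> lmul L a"
      unfolding an by (intro lmulI forms_pscale forms_mult_linear l g)
    ultimately show "pvar v * g \<in> {g. l * g \<in> sect L a}"
      unfolding mem_Collect_eq eq sect_def n by (intro Vec.vsumI) auto
  qed
  then have "lmul l a \<subseteq> sect L a" unfolding an lmul_Suc by auto
  then have "Vec.vsum ?B (Vec.span {f}) \<subseteq> sect L a"
    using f(1) Id_subset_sect[of a L]
    by (intro Vec.vsum_least subspace_sect lmul_subset_sect Vec.span_minimal) auto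
  then have "Vec.dim (Vec.vsum ?B (Vec.span {f})) \<le> Vec.dim (sect L a)"
    by (rule Vec.dim_mono_fd[OF fd_sect[OF L(1)]])
  then have "Vec.dim ?B + 1 \<le> Vec.dim (sect L a)" using Vec.dim_span_insert[OF fdB fB] by simp
  moreover have "Vec.dim (R a) \<le> Vec.dim ?B + n + 3"
    unfolding n by (rule dim_two_multiples[OF L(1) L0 l(1) lL])
  ultimately have "cdim L a \<le> a" using n by (simp add: cdim_def)
  then show thesis by (rule that[OF L(1) L0])
qed

end

section \<open>The critical degree\<close>

lemma critical_degree:
  assumes dim3: "Vec.dim (Id 2) = 3" and no_linear: "Id (Suc 0) = {0}" and art: "R m \<subseteq> I" "3 \<le> m"
    and t2: "int (hdim 2) - int (hdim 1) = 3"
  obtains a L where "3 \<le> a" "L \<in> R (Suc 0)" "L \<noteq> 0" "cdim L a \<le> a"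
    "\<forall>i. 2 \<le> i \<longrightarrow> i < a \<longrightarrow> i \<le> j \<longrightarrow> int (hdim i) - int (hdim (i - 1)) = int i + 1"
proof (cases "\<exists>L\<in>R (Suc 0). L \<noteq> 0 \<and> cdim L 3 \<le> 3")
  case True
  then obtain L where L: "L \<in> R (Suc 0)" "L \<noteq> 0" "cdim L 3 \<le> 3" by blast
  show thesis
  proof (rule that[OF _ L])
    have "i = 2" if "2 \<le> i" "i < 3" for i :: nat using that by simp
    then show "\<forall>i. 2 \<le> i \<longrightarrow> i < 3 \<longrightarrow> i \<le> j \<longrightarrow> int (hdim i) - int (hdim (i - 1)) = int i + 1"
      using t2 by fastforce
  qed simp
next
  case False
  have growth: "4 \<le> cdim L 3" if "L \<in> R (Suc 0)" "L \<noteq> 0" for L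
  proof (rule ccontr)
    assume "\<not> 4 \<le> cdim L 3"
    then have "cdim L 3 \<le> 3" by simp
    then show False using False that by blast
  qed
  obtain l where l: "l \<in> R (Suc 0)" "l \<noteq> 0" "Id 2 \<subseteq> lmul l 2"
    by (rule quadrics_common_factor[OF dim3 growth])
  define Q where "Q a \<longleftrightarrow> 2 \<le> a \<and> \<not> Id a \<subseteq> lmul l a" for a
  \<comment> \<open>I contains all forms of degree \<open>m\<close>, and there are more of them than
    multiples of \<open>l\<close>; so a least such degree exists.\<close>
  have "Q m"
  proof -
    obtain e where e: "m = Suc e" using art(2) by (cases m) auto
    have "\<not> R m \<subseteq> lmul l m"
    proof
      assume "R m \<subseteq> lmul l m"
      then have "Vec.dim (R m) \<le> Vec.dim (lmul l m)" by (rule Vec.dim_mono_fd[OF fd_lmul[OF l(1)]])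
      then show False unfolding e dim_lmul[OF l(2)] by (simp add: dim_forms)
    qed
    then show ?thesis using art by (auto simp: Q_def)
  qed
  define a where "a = (LEAST a. Q a)"
  have Qa: "Q a" unfolding a_def by (rule LeastI[of Q, OF \<open>Q m\<close>])
  have below: "Id i \<subseteq> lmul l i" if "2 \<le> i" "i < a" for i
    using not_less_Least[of i Q] that unfolding a_def Q_def by blast
  have "a \<noteq> 2" using Qa l(3) by (auto simp: Q_def)
  then have a3: "3 \<le> a" using Qa by (simp add: Q_def)
  obtain f where f: "f \<in> Id a" "f \<notin> lmul l a" using Qa by (auto simp: Q_def)
  obtain L where L: "L \<in> R (Suc 0)" "L \<noteq> 0" "cdim L a \<le> a"
    by (rule cdim_new_generator[OF l dim3 no_linear a3 f])
  show thesis
  proof (rule that[OF a3 L], intro allI impI)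
    fix i assume i: "2 \<le> i" "i < a" "i \<le> j"
    show "int (hdim i) - int (hdim (i - 1)) = int i + 1"
    proof (cases "i = 2")
      case True
      then show ?thesis using t2 by simp
    next
      case False
      then show ?thesis
        using i below[of i] below[of "i - 1"] by (intro hdim_common_factor[OF l dim3 no_linear]) auto
    qed
  qed
qed

end

section \<open>Macaulay bounds\<close>

text \<open>Pascal's rule gives the bound term by term for whichever representation
  \<open>SOME\<close> selects.\<close>

lemma macaulay_upper_ge:
  assumes "\<exists>k. macaulay_rep c d k"
  shows "c \<le> macaulay_upper c d"
proof (cases "c = 0")
  case False
  define k where "k = (SOME k. macaulay_rep c d k)"
  have "macaulay_rep c d k" unfolding k_def by (rule someI_ex[OF assms])
  then have "c = (\<Sum>i=1..d. k i choose i)" by (simp add: macaulay_rep_def)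
  also have "\<dots> \<le> (\<Sum>i=1..d. (k i + 1) choose (i + 1))" by (intro sum_mono) simp
  also have "\<dots> = macaulay_upper c d" using False by (simp add: macaulay_upper_def k_def Let_def)
  finally show ?thesis .
qed simp

lemma macaulay_rep_small:
  assumes "c \<le> d"
  shows "\<exists>k. macaulay_rep c d k"
proof -
  \<comment> \<open>The top \<open>c\<close> terms are binom(i,i) = 1, the lower ones binom(i-1,i) =
    0.\<close>
  define k :: "nat \<Rightarrow> nat" where "k = (\<lambda>i. if i \<le> d - c then i - 1 else i)"
  have "(\<Sum>i=1..d. k i choose i) = (\<Sum>i\<in>{1..d}. if i \<in> {d - c<..d} then 1 else 0)"
    by (intro sum.cong) (auto simp: k_def)
  also have "\<dots> = (\<Sum>i\<in>{1..d} \<inter> {d - c<..d}. 1)" by (rule sum.inter_restrict[symmetric]) simp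
  also have "{1..d} \<inter> {d - c<..d} = {d - c<..d}" by auto
  finally have "c = (\<Sum>i=1..d. k i choose i)" using assms by simp
  moreover have "\<forall>i\<in>{1..<d}. k i < k (Suc i)" by (auto simp: k_def)
  ultimately show ?thesis unfolding macaulay_rep_def by blast
qed

lemma macaulay_rep_Suc:
  assumes "1 \<le> d"
  shows "\<exists>k. macaulay_rep (d + 1) d k"
proof -
  define k :: "nat \<Rightarrow> nat" where "k = (\<lambda>i. if i = d then d + 1 else i - 1)"
  have "(\<Sum>i=1..d. k i choose i) = (\<Sum>i\<in>{1..d}. if i = d then d + 1 else 0)"
    by (intro sum.cong) (auto simp: k_def)
  then have "d + 1 = (\<Sum>i=1..d. k i choose i)" using assms by simp
  moreover have "\<forall>i\<in>{1..<d}. k i < k (Suc i)" by (auto simp: k_def)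
  ultimately show ?thesis unfolding macaulay_rep_def by blast
qed

text \<open>In any representation of \<open>d + 1\<close> the top entry exceeds \<open>d\<close>:
  otherwise \<open>k i <= i\<close> throughout, and the terms, each at most 1, sum to at most
  \<open>d\<close>. By Pascal's rule this top entry contributes the extra 1.\<close>

lemma macaulay_upper_Suc:
  assumes "1 \<le> d"
  shows "d + 2 \<le> macaulay_upper (d + 1) d"
proof -
  define k where "k = (SOME k. macaulay_rep (d + 1) d k)"
  have "macaulay_rep (d + 1) d k" unfolding k_def by (rule someI_ex[OF macaulay_rep_Suc[OF assms]])
  then have inc: "\<And>i. i \<in> {1..<d} \<Longrightarrow> k i < k (Suc i)" and sum: "(\<Sum>i=1..d. k i choose i) = d + 1"
    by (auto simp: macaulay_rep_def)
  have "d + 1 \<le> k d"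
  proof (rule ccontr)
    assume "\<not> d + 1 \<le> k d"
    then have top: "k d \<le> d" by simp
    have "k (d - n) \<le> d - n" if "n < d" for n
      using that
    proof (induction n)
      case (Suc n)
      then have "d - Suc n \<in> {1..<d}" "Suc (d - Suc n) = d - n" by auto
      then show ?case using inc[of "d - Suc n"] Suc by simp
    qed (use top in simp)
    then have low: "k i \<le> i" if "i \<in> {1..d}" for i using that by (metis atLeastAtMost_iff diff_diff_cancel diff_less less_le_trans zero_less_one)
    have "(k i choose i) \<le> 1" if "i \<in> {1..d}" for i
      using low[OF that] by (cases "k i = i") (auto simp: binomial_eq_0)
    then have "(\<Sum>i=1..d. k i choose i) \<le> (\<Sum>i=1..d. 1)" by (intro sum_mono) simp
    then show False using sum by simp
  qed
  then have "1 \<le> k d choose (d + 1)" by (simp add: Suc_le_eq zero_less_binomial_iff)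
  also have "\<dots> \<le> (\<Sum>i=1..d. k i choose (i + 1))"
    using assms by (intro member_le_sum) auto
  finally have "d + 2 \<le> (\<Sum>i=1..d. k i choose i) + (\<Sum>i=1..d. k i choose (i + 1))" using sum by simp
  also have "\<dots> = (\<Sum>i=1..d. (k i + 1) choose (i + 1))" by (simp add: sum.distrib)
  also have "\<dots> = macaulay_upper (d + 1) d" by (simp add: macaulay_upper_def k_def Let_def)
  finally show ?thesis .
qed

lemma macaulay_upper_3_1: "3 \<le> macaulay_upper 3 1"
  by (rule macaulay_upper_ge) (auto simp: macaulay_rep_def intro!: exI[of _ "\<lambda>_. 3"])

text \<open>Below \<open>a\<close> the increase from \<open>i + 1\<close> to \<open>i + 2\<close> is
  permitted by \<open>macaulay_upper_Suc\<close>, and the value at \<open>a\<close> is lower still.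
  From \<open>a\<close> on \<open>t d <= d\<close>, so a representation exists and the bound is at
  least \<open>t d\<close>, while the sequence does not increase.\<close>

lemma O_seq_from_critical_degree:
  fixes t :: "nat \<Rightarrow> int"
  assumes a: "3 \<le> a" and t: "t 0 = 1" "t 1 = 3" "t 2 = 3"
    and below: "\<And>i. 2 \<le> i \<Longrightarrow> i < a \<Longrightarrow> i \<le> n \<Longrightarrow> t i = int i + 1"
    and above: "\<And>i. a \<le> i \<Longrightarrow> i \<le> n \<Longrightarrow> 0 \<le> t i \<and> t i \<le> int a"
    and dec: "\<And>i. a \<le> i \<Longrightarrow> i + 1 \<le> n \<Longrightarrow> t (i + 1) \<le> t i"
  shows "O_seq t n"
  unfolding O_seq_def
proof (intro conjI allI impI)
  show "t 0 = 1" by (rule t)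
  fix i assume i: "i \<le> n"
  consider "i = 0" | "i = 1" | "2 \<le> i" "i < a" | "a \<le> i" by linarith
  then show "0 \<le> t i" by cases (use t below above i in auto)
next
  fix d assume d: "1 \<le> d \<and> d + 1 \<le> n"
  consider "d = 1" | "2 \<le> d" "d < a" | "a \<le> d" using d by linarith
  then show "t (d + 1) \<le> int (macaulay_upper (nat (t d)) d)"
  proof cases
    case 1
    have "t (d + 1) = 3" "nat (t d) = 3" using 1 t by (simp_all add: numeral_2_eq_2)
    then show ?thesis using macaulay_upper_3_1 1 by simp
  next
    case 2
    have "t (d + 1) \<le> int d + 2"
    proof (cases "d + 1 < a")
      case True
      then show ?thesis using below[of "d + 1"] 2 d by simp
    next
      case False
      then have "d + 1 = a" using 2 by simp
      then show ?thesis using above[of "d + 1"] d by simp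
    qed
    moreover have "nat (t d) = d + 1" using below[of d] 2 d by simp
    ultimately show ?thesis using macaulay_upper_Suc[of d] d by simp
  next
    case 3
    have "0 \<le> t d" "t d \<le> int d" using above[of d] 3 d by auto
    then have "int (nat (t d)) = t d" "nat (t d) \<le> d" by auto
    moreover have "nat (t d) \<le> macaulay_upper (nat (t d)) d"
      by (rule macaulay_upper_ge[OF macaulay_rep_small]) fact
    moreover have "t (d + 1) \<le> t d" using dec[of d] 3 d by simp
    ultimately show ?thesis by linarith
  qed
qed

section \<open>Gorenstein sequences starting with 1, 4, 7\<close>

text \<open>Over a finite field, 1 plus the product of all \<open>x - a\<close> takes the value 1
  everywhere.\<close>

lemma alg_closed_infinite:
  assumes "alg_closed TYPE('k::field)"
  shows "infinite (UNIV :: 'k set)"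
proof
  assume fin: "finite (UNIV :: 'k set)"
  define q :: "'k poly" where "q = (\<Prod>a\<in>UNIV. [:- a, 1:])"
  have "degree q = (\<Sum>a\<in>(UNIV :: 'k set). degree [:- a, 1:])"
    unfolding q_def by (rule degree_prod_eq_sum_degree) simp
  then have "0 < degree q" using fin by (simp add: card_gt_0_iff)
  then have "0 < degree (q + 1)" by (simp add: degree_add_eq_left)
  then obtain x where "poly (q + 1) x = 0" using assms unfolding alg_closed_def by blast
  moreover have "poly q x = 0" using fin by (auto simp: q_def poly_prod)
  ultimately show False by simp
qed

theorem theorem4p2:
  fixes h :: "nat \<Rightarrow> nat" and j :: nat
  assumes "alg_closed TYPE('k::field)"
    and "gorenstein_seq TYPE('k) h j"
    and "h 0 = 1" and "h 1 = 4" and "h 2 = 7"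
  shows "O_seq (delta h) (j div 2)"
proof -
  obtain I :: "'k poly4 set" where I: "artinian_gorenstein I" "\<And>i. hilb I i = h i"
    and top: "h j \<noteq> 0" "\<And>i. j < i \<Longrightarrow> h i = 0"
    using assms(2) unfolding gorenstein_seq_def by blast
  obtain \<phi> where "graded_gorenstein I j \<phi>"
    using artinian_gorenstein_duality[OF alg_closed_infinite[OF assms(1)] I(1), of j] I(2) top by auto
  then interpret graded_gorenstein I j \<phi> .
  have hdim: "hdim i = h i" for i using I(2)[of i] by (simp add: hdim_def hilb_eq_dim)
  have dim3: "Vec.dim (Id 2) = 3"
    using hdim[of 2] assms(5) by (simp add: hdim_def dim_forms_2)
  have "Vec.dim (Id (Suc 0)) = 0"
    using hdim[of 1] assms(4) dim_Id_le[of "Suc 0"] by (simp add: hdim_def dim_forms_1)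
  then have no_linear: "Id (Suc 0) = {0}"
    by (intro Vec.subspace_eq_if_dim_le[OF fd_Id, symmetric]) (auto simp: zero_I Vec.subspace_single_0)
  obtain m where m: "\<forall>i\<ge>m. R i \<subseteq> I"
    using I(1) by (auto simp: artinian_gorenstein_def artinian_def)
  then have art: "R (max m 3) \<subseteq> I" by simp
  have t2: "int (hdim 2) - int (hdim 1) = 3" by (simp only: hdim assms(4,5))
  obtain a L where a: "3 \<le> a" and L: "L \<in> R (Suc 0)" "L \<noteq> 0" "cdim L a \<le> a"
    and below: "\<forall>i. 2 \<le> i \<longrightarrow> i < a \<longrightarrow> i \<le> j \<longrightarrow> int (hdim i) - int (hdim (i - 1)) = int i + 1"
    by (rule critical_degree[OF dim3 no_linear art _ t2]) simp
  have t: "delta h i = int (hdim i) - int (hdim (i - 1))" if "0 < i" for i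
    using that by (simp add: delta_def hdim)
  show ?thesis
  proof (rule O_seq_from_critical_degree[OF a])
    show "delta h 0 = 1" "delta h 1 = 3" "delta h 2 = 3"
      using assms(3-5) by (simp_all add: delta_def)
    show "delta h i = int i + 1" if "2 \<le> i" "i < a" "i \<le> j div 2" for i
      using below that t[of i] by simp
    show "0 \<le> delta h i \<and> delta h i \<le> int a" if "a \<le> i" "i \<le> j div 2" for i
      using delta_tail(1,2)[OF L, of i] t[of i] a that by simp
    show "delta h (i + 1) \<le> delta h i" if "a \<le> i" "i + 1 \<le> j div 2" for i
      using delta_tail(3)[OF L, of i] t[of i] t[of "i + 1"] a that by simp
  qed
qed

end
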